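(* For $f\in\Sigma(\Delta^* )$ with sufficiently small norm $\|S_f\|_{\mathbf B}$ of its Schwarzian derivative, $$\varkappa(f)=\sup\big\{|\langle\nu_{S_f},\psi\rangle_\Delta|:\ \psi\in A_1^2(\Delta),\ \|\psi\|_{A_1(\Delta)}=1\big\}+O(\|S_f\|_{\mathbf B}^2),$$ where the ratio $O(\|S_f\|_{\mathbf B}^2)/\|S_f\|_{\mathbf B}^2$ remains bounded as $\|S_f\|_{\mathbf B}\to0$.
   Context: $\Delta=\{|z|<1\}$, $\Delta^*=\{z\in\mathbb C\cup\{\infty\}:|z|>1\}$. $\Sigma(\Delta^* )$ is the class of univalent functions $f$ on $\Delta^*$ with $f(z)=z+b_0+b_1z^{-1}+\dots$ near $\infty$. The Grunsky coefficients $\alpha_{mn}$ of $f$ are defined by $\log\frac{f(z)-f(\zeta)}{z-\zeta}=-\sum_{m,n=1}^\infty\alpha_{mn}z^{-m}\zeta^{-n}$ for $(z,\zeta)\in(\Delta^* )^2$ (principal branch), and the Grunsky norm is $\varkappa(f)=\sup\{|\sum_{m,n=1}^\infty\sqrt{mn}\,\alpha_{mn}x_mx_n|:\mathbf x=(x_n)\in S(l^2)\}$, with $S(l^2)$ the unit sphere of complex $l^2$. $S_f=(f''/f')'-\tfrac12(f''/f')^2$ is the Schwarzian derivative on $\Delta^*$. $\mathbf B=\mathbf B(\Delta^* )$ is the space of holomorphic $\varphi$ on $\Delta^*$ with finite norm $\|\varphi\|_{\mathbf B}=\sup_{\Delta^*}\lambda_{\Delta^*}^{-2}(z)|\varphi(z)|=\sup_{|z|>1}(|z|^2-1)^2|\varphi(z)|$,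 where $\lambda_{\Delta^*}|dz|$ is the hyperbolic metric of curvature $-4$. For $\varphi\in\mathbf B$, $$\nu_\varphi(z)=\tfrac12(1-|z|^2)^2\varphi(1/\bar z)\,\frac1{\bar z^4},\qquad z\in\Delta.$$ $\langle\nu,\psi\rangle_\Delta=\iint_\Delta\nu(z)\psi(z)\,dx\,dy$. $A_1(\Delta)$ is the space of $\psi\in L_1(\Delta)$ holomorphic in $\Delta$, with the $L_1$ norm, and $A_1^2(\Delta)=\{\psi=\omega^2\in A_1(\Delta):\omega\text{ holomorphic in }\Delta\}$. *)

theory Defs
  imports "HOL-Complex_Analysis.Complex_Analysis"
begin

abbreviation unit_disk :: "complex set" where
  "unit_disk \<equiv> ball 0 1"

text \<open>The finite part of the exterior disk; the point at infinity is handled by the expansion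
  required in \<open>Sigma_class\<close> (it forces \<open>f(\<infinity>) = \<infinity>\<close>).\<close>

definition ext_disk :: "complex set" where
  "ext_disk = {z. 1 < norm z}"

definition Sigma_class :: "(complex \<Rightarrow> complex) set" where
  "Sigma_class = {f. f holomorphic_on ext_disk \<and> inj_on f ext_disk \<and>
     (\<exists>(b :: nat \<Rightarrow> complex) R. \<forall>z. R < norm z \<longrightarrow> (\<lambda>n. b n / z ^ n) sums (f z - z))}"

text \<open>The branch of the logarithm of \<open>(f(z) - f(\<zeta>)) / (z - \<zeta>)\<close> on the exterior bidisk is the one
  that vanishes at infinity.  It is expressed through \<open>exp\<close>: the double series is continuous and
  has no constant term, so it can only be (minus) that branch.  The library's \<open>Ln\<close> would be wrong
  here, since the quotient may cross the negative real axis.  The diagonal, where the quotient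
  stands for \<open>f'(z)\<close>, is covered by continuity.\<close>

definition grunsky_expansion :: "(complex \<Rightarrow> complex) \<Rightarrow> (nat \<Rightarrow> nat \<Rightarrow> complex) \<Rightarrow> bool" where
  "grunsky_expansion f \<alpha> \<longleftrightarrow>
     (\<forall>z\<in>ext_disk. \<forall>\<zeta>\<in>ext_disk. z \<noteq> \<zeta> \<longrightarrow>
        (\<exists>s. ((\<lambda>(m, n). \<alpha> m n / (z ^ m * \<zeta> ^ n)) has_sum s) ({1..} \<times> {1..}) \<and>
             exp (- s) = (f z - f \<zeta>) / (z - \<zeta>)))"

text \<open>Indices start at 1; the entries with an index 0 are set to 0 to make the matrix unique.\<close>

definition grunsky_coeff :: "(complex \<Rightarrow> complex) \<Rightarrow> nat \<Rightarrow> nat \<Rightarrow> complex" where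
  "grunsky_coeff f =
     (THE \<alpha>. grunsky_expansion f \<alpha> \<and> (\<forall>m n. m = 0 \<or> n = 0 \<longrightarrow> \<alpha> m n = 0))"

text \<open>Sequences in \<open>l\<^sup>2\<close> are indexed by the positive integers; the value at 0 is ignored.\<close>

definition l2_sphere :: "(nat \<Rightarrow> complex) set" where
  "l2_sphere = {x. ((\<lambda>n. (norm (x n))\<^sup>2) has_sum 1) {1..}}"

text \<open>The double sum is iterated.  For univalent \<open>f\<close> the matrix \<open>sqrt(mn) \<alpha>\<^sub>m\<^sub>n\<close> is a contraction
  of \<open>l\<^sup>2\<close>, so both the inner and the outer sums converge absolutely, whereas the sum over all
  pairs need not, and the supremum is at most 1.\<close>

definition grunsky_norm :: "(complex \<Rightarrow> complex) \<Rightarrow> real" where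
  "grunsky_norm f =
     (SUP x\<in>l2_sphere. norm (\<Sum>\<^sub>\<infinity>m\<in>{1..}. \<Sum>\<^sub>\<infinity>n\<in>{1..}.
        of_real (sqrt (real m * real n)) * grunsky_coeff f m n * x m * x n))"

definition schwarzian :: "(complex \<Rightarrow> complex) \<Rightarrow> complex \<Rightarrow> complex" where
  "schwarzian f z =
     deriv (\<lambda>w. deriv (deriv f) w / deriv f w) z - 1 / 2 * (deriv (deriv f) z / deriv f z)\<^sup>2"

text \<open>The norm takes values in \<open>[0, \<infinity>]\<close>: a function holomorphic in \<open>ext_disk\<close> belongs to
  \<open>\<^bold>B\<close> iff the value is finite (holomorphy at infinity then follows, as \<open>\<phi>(z) = O(z\<^sup>-\<^sup>4)\<close>).\<close>

definition bers_norm :: "(complex \<Rightarrow> complex) \<Rightarrow> ennreal" where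
  "bers_norm \<phi> = (SUP z\<in>ext_disk. ennreal (((norm z)\<^sup>2 - 1)\<^sup>2 * norm (\<phi> z)))"

text \<open>The value at \<open>z = 0\<close>, where \<open>1/z\<close> is infinite, is irrelevant for integration.\<close>

definition harmonic_beltrami :: "(complex \<Rightarrow> complex) \<Rightarrow> complex \<Rightarrow> complex" where
  "harmonic_beltrami \<phi> z =
     1 / 2 * of_real ((1 - (norm z)\<^sup>2)\<^sup>2) * \<phi> (1 / cnj z) * (1 / cnj z ^ 4)"

definition disk_pairing :: "(complex \<Rightarrow> complex) \<Rightarrow> (complex \<Rightarrow> complex) \<Rightarrow> complex" where
  "disk_pairing \<nu> \<psi> = (LINT z:unit_disk|lborel. \<nu> z * \<psi> z)"

definition A1 :: "(complex \<Rightarrow> complex) set" where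
  "A1 = {\<psi>. \<psi> holomorphic_on unit_disk \<and> set_integrable lborel unit_disk \<psi>}"

definition A1_norm :: "(complex \<Rightarrow> complex) \<Rightarrow> real" where
  "A1_norm \<psi> = (LINT z:unit_disk|lborel. norm (\<psi> z))"

definition A1_sq :: "(complex \<Rightarrow> complex) set" where
  "A1_sq = {\<psi>\<in>A1. \<exists>\<omega>. \<omega> holomorphic_on unit_disk \<and> (\<forall>z\<in>unit_disk. \<psi> z = (\<omega> z)\<^sup>2)}"

end

theory Submission
  imports Defs
begin

text \<open>Put \<open>f(1/t) = B(t)/t\<close> with \<open>B\<close> holomorphic in the unit disk.  The Ahlfors-Weill formula extends a
slightly dilated \<open>f\<close> from the exterior of the unit circle to a smooth map \<open>F\<close> of the closed disk.
It satisfies the Beltrami equation \<open>F\<^bsub>zbar\<^esub> = \<mu> F\<^sub>z\<close>, where \<open>-\<mu>\<close> is the harmonic Beltrami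
coefficient of the Schwarzian, and \<open>\<bar>\<mu>\<bar> \<le> k\<close> with \<open>k\<close> half the norm of the Schwarzian.  Smallness of the
Schwarzian also bounds \<open>f''/f'\<close> (\<open>preschwarz_bound\<close>), which keeps the denominator in the formula for
\<open>F\<close> away from zero.

Let \<open>P\<close> be a combination of Faber functions of \<open>f\<close>.  Outside the disk \<open>P \<circ> f = c + D(1/z)\<close> with \<open>c\<close> a
polynomial and \<open>D\<close> a power series, and the coefficients of \<open>D\<close> arise from those of \<open>c\<close> by applying the Grunsky matrix.
On the unit circle \<open>1/z\<close> is the conjugate of \<open>z\<close>, so \<open>u = P \<circ> F - c\<close> is a function on the disk with
antiholomorphic boundary values.  For such a function the Jacobian has integral at most 0, that is
\<open>\<parallel>u\<^sub>z\<parallel> \<le> \<parallel>u\<^bsub>zbar\<^esub>\<parallel>\<close> in the \<open>L\<^sup>2\<close> norm, and the integral of \<open>u\<^bsub>zbar\<^esub> g\<close> for holomorphic \<open>g\<close> depends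
on \<open>D\<close> only (\<open>boundary_energy\<close>); the latter integral is the bilinear Grunsky form.  Since
\<open>u\<^bsub>zbar\<^esub> = \<mu> (c' + u\<^sub>z)\<close>, both norms are at most \<open>2 k \<parallel>c'\<parallel>\<close>, so the Grunsky form differs from the integral
of \<open>\<mu> c' g\<close> by at most \<open>2 k\<^sup>2 \<parallel>c'\<parallel> \<parallel>g\<parallel>\<close> (\<open>reflected_energy_estimate\<close>).

The dilation is removed by a limit in finite sums (\<open>finite_estimate\<close>).  The same estimate bounds the
Grunsky coefficients, whence the double series defining them converges, and a uniqueness argument identifies the matrix with
the one in the definition of the Grunsky norm.  Finally \<open>x \<mapsto> \<omega> = \<Sum> sqrt (n/\<pi>) x\<^sub>n z\<^bsup>n-1\<^esup>\<close> maps the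
unit sphere of \<open>l\<^sup>2\<close> onto the unit sphere of square integrable holomorphic functions, so the squares \<open>\<omega>\<^sup>2\<close> are
exactly the competitors in the second supremum, and two functions that differ by at most \<open>2 k\<^sup>2\<close> in
modulus have suprema that differ by at most \<open>2 k\<^sup>2\<close> (\<open>sup_estimate\<close>).\<close>

section \<open>Stokes' theorem on the unit disk\<close>

text \<open>Fubini's theorem over the plane is transferred from the product measure along this identity.\<close>

lemma lborel_complex_eq_distr_pair:
  "(lborel :: complex measure) = distr (lborel \<Otimes>\<^sub>M lborel) borel (\<lambda>(x, y). Complex x y)"
proof (rule lborel_eqI)
  have meas [measurable]: "(\<lambda>(x, y). Complex x y) \<in> borel_measurable (lborel \<Otimes>\<^sub>M lborel)"
    unfolding lborel_prod
    by (simp add: case_prod_beta borel_measurable_continuous_onI Complex_eq continuous_intros)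
  fix l u :: complex
  assume lu: "\<And>b. b \<in> Basis \<Longrightarrow> l \<bullet> b \<le> u \<bullet> b"
  have le: "Re l \<le> Re u" "Im l \<le> Im u"
    using lu[of 1] lu[of \<i>] by (auto simp: Basis_complex_def)
  have vim: "(\<lambda>(x, y). Complex x y) -` box l u = {Re l<..<Re u} \<times> {Im l<..<Im u}"
    by (auto simp: in_box_complex_iff)
  have "emeasure (distr (lborel \<Otimes>\<^sub>M lborel) borel (\<lambda>(x, y). Complex x y)) (box l u)
     = emeasure (lborel \<Otimes>\<^sub>M lborel) ({Re l<..<Re u} \<times> {Im l<..<Im u})"
    by (subst emeasure_distr) (auto simp: vim space_pair_measure)
  also have "\<dots> = ennreal (Re u - Re l) * ennreal (Im u - Im l)"
    using le by (subst lborel.emeasure_pair_measure_Times) auto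
  also have "\<dots> = ennreal (\<Prod>b\<in>Basis. (u - l) \<bullet> b)"
    using le by (simp add: Basis_complex_def ennreal_mult')
  finally show "emeasure (distr (lborel \<Otimes>\<^sub>M lborel) borel (\<lambda>(x, y). Complex x y)) (box l u)
     = ennreal (\<Prod>b\<in>Basis. (u - l) \<bullet> b)" .
qed simp

lemma integral_zero_of_slices:
  fixes F :: "complex \<Rightarrow> complex"
  assumes F: "integrable lborel F"
  shows "(\<And>y. (LINT x|lborel. F (Complex x y)) = 0) \<Longrightarrow> (LINT z|lborel. F z) = 0"
    and "(\<And>x. (LINT y|lborel. F (Complex x y)) = 0) \<Longrightarrow> (LINT z|lborel. F z) = 0"
proof -
  have meas [measurable]: "(\<lambda>(x, y). Complex x y) \<in> lborel \<Otimes>\<^sub>M lborel \<rightarrow>\<^sub>M borel"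
    unfolding lborel_prod
    by (simp add: case_prod_beta borel_measurable_continuous_onI Complex_eq continuous_intros)
  have [measurable]: "F \<in> borel_measurable borel"
    using F by (simp add: borel_measurable_integrable)
  have int: "integrable (lborel \<Otimes>\<^sub>M lborel) (\<lambda>(x, y). F (Complex x y))"
    using F by (subst (asm) lborel_complex_eq_distr_pair)
      (simp add: integrable_distr_eq case_prod_beta')
  have eq: "(LINT z|lborel. F z) = integral\<^sup>L (lborel \<Otimes>\<^sub>M lborel) (\<lambda>(x, y). F (Complex x y))"
    by (subst lborel_complex_eq_distr_pair, subst integral_distr) (auto simp: case_prod_beta')
  show "(LINT z|lborel. F z) = 0" if "\<And>y. (LINT x|lborel. F (Complex x y)) = 0"
    unfolding eq using lborel_pair.integral_snd[OF int] that by simp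
  show "(LINT z|lborel. F z) = 0" if "\<And>x. (LINT y|lborel. F (Complex x y)) = 0"
    unfolding eq using lborel_pair.integral_fst'[OF int] that by simp
qed

lemma LINT_derivative_zero:
  fixes W W' :: "real \<Rightarrow> complex"
  assumes "0 \<le> l"
    and der: "\<And>x. x \<in> {-l<..<l} \<Longrightarrow> (W has_vector_derivative W' x) (at x)"
    and contW: "continuous_on {-l..l} W" and contW': "continuous_on {-l..l} W'"
    and ends: "W l = 0" "W (-l) = 0"
  shows "(LINT x|lborel. indicator {-l<..<l} x *\<^sub>R W' x) = 0"
proof -
  have "(W' has_integral (W l - W (-l))) {-l..l}"
    using assms by (intro fundamental_theorem_of_calculus_interior) auto
  hence I: "integral {-l..l} W' = 0" using ends by (simp add: integral_unique)
  have "set_integrable lborel {-l..l} W'"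
    using contW' by (intro borel_integrable_atLeastAtMost' )
  hence si: "set_integrable lborel {-l<..<l} W'"
    by (rule set_integrable_subset) auto
  have "(LINT x:{-l<..<l}|lborel. W' x) = integral {-l<..<l} W'"
    using set_borel_integral_eq_integral[OF si] by simp
  also have "\<dots> = 0" using I by (simp add: integral_open_interval_real)
  finally show ?thesis by (simp add: set_lebesgue_integral_def)
qed

text \<open>A measure is used in place of a set integral so that the results on finite measures apply directly.\<close>

definition disk_measure :: "complex measure" where
  "disk_measure = restrict_space lborel unit_disk"

lemma space_disk_measure [simp]: "space disk_measure = unit_disk"
  by (simp add: disk_measure_def space_restrict_space)

lemma finite_measure_disk: "finite_measure disk_measure"
  by (rule finite_measureI)
    (use emeasure_lborel_ball_finite[of "0 :: complex" 1] in
      \<open>simp add: disk_measure_def emeasure_restrict_space space_restrict_space\<close>)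

lemma LINT_disk_measure:
  fixes f :: "complex \<Rightarrow> 'a::{banach, second_countable_topology}"
  shows "(LINT z|disk_measure. f z) = (LINT z:unit_disk|lborel. f z)"
  unfolding disk_measure_def set_lebesgue_integral_def by (subst integral_restrict_space) auto

lemma integrable_disk_measure:
  fixes f :: "complex \<Rightarrow> 'a::{banach, second_countable_topology}"
  shows "integrable disk_measure f \<longleftrightarrow> set_integrable lborel unit_disk f"
  unfolding disk_measure_def set_integrable_def by (subst integrable_restrict_space) auto

lemma measurable_disk_continuous:
  fixes f :: "complex \<Rightarrow> 'a::topological_space"
  assumes "continuous_on unit_disk f"
  shows "f \<in> borel_measurable disk_measure"
proof -
  have "sets disk_measure = sets (restrict_space borel unit_disk)"
    by (simp add: disk_measure_def sets_restrict_space)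
  hence "borel_measurable disk_measure = (borel_measurable (restrict_space borel unit_disk) :: (complex \<Rightarrow> 'a) set)"
    by (rule measurable_cong_sets) simp
  thus ?thesis using borel_measurable_continuous_on_restrict[OF assms] by blast
qed

lemma integrable_disk_bounded:
  fixes f :: "complex \<Rightarrow> 'a::{banach, second_countable_topology}"
  assumes "f \<in> borel_measurable disk_measure" "\<And>z. z \<in> unit_disk \<Longrightarrow> norm (f z) \<le> K"
  shows "integrable disk_measure f"
proof -
  interpret finite_measure disk_measure by (rule finite_measure_disk)
  show ?thesis
    using assms by (intro integrable_const_bound[where B = K]) auto
qed

lemma integrable_disk_continuous:
  fixes f :: "complex \<Rightarrow> 'a::{banach, second_countable_topology}"
  assumes "continuous_on (cball 0 1) f"
  shows "integrable disk_measure f"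
proof -
  have "bounded (f ` cball 0 1)"
    by (rule compact_imp_bounded[OF compact_continuous_image[OF assms]]) simp
  then obtain K where "\<And>z. z \<in> cball 0 1 \<Longrightarrow> norm (f z) \<le> K"
    unfolding bounded_iff by blast
  moreover have "continuous_on unit_disk f"
    using assms by (rule continuous_on_subset) auto
  ultimately show ?thesis
    by (intro integrable_disk_bounded[where K = K] measurable_disk_continuous) auto
qed

lemma chord_eq:
  assumes "y\<^sup>2 < 1"
  shows "x\<^sup>2 + y\<^sup>2 < 1 \<longleftrightarrow> x \<in> {-sqrt (1 - y\<^sup>2)<..<sqrt (1 - y\<^sup>2)}"
    and "x\<^sup>2 + y\<^sup>2 \<le> 1 \<longleftrightarrow> x \<in> {-sqrt (1 - y\<^sup>2)..sqrt (1 - y\<^sup>2)}"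
proof -
  have "x\<^sup>2 + y\<^sup>2 < 1 \<longleftrightarrow> \<bar>x\<bar> < sqrt (1 - y\<^sup>2)"
    using assms by (metis abs_ge_zero less_diff_eq power2_abs real_less_rsqrt real_sqrt_abs real_sqrt_less_iff)
  thus "x\<^sup>2 + y\<^sup>2 < 1 \<longleftrightarrow> x \<in> {-sqrt (1 - y\<^sup>2)<..<sqrt (1 - y\<^sup>2)}" by (auto simp: abs_less_iff)
  have "x\<^sup>2 + y\<^sup>2 \<le> 1 \<longleftrightarrow> \<bar>x\<bar> \<le> sqrt (1 - y\<^sup>2)"
    using assms by (metis le_diff_eq real_sqrt_abs real_sqrt_le_iff)
  thus "x\<^sup>2 + y\<^sup>2 \<le> 1 \<longleftrightarrow> x \<in> {-sqrt (1 - y\<^sup>2)..sqrt (1 - y\<^sup>2)}" by (auto simp: abs_le_iff)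
qed

text \<open>The numbers \<open>p\<close> and \<open>q\<close> are the complex partial derivatives with respect to \<open>z\<close> and to the conjugate of \<open>z\<close>.\<close>

definition wirtinger :: "(complex \<Rightarrow> complex) \<Rightarrow> complex \<Rightarrow> complex \<Rightarrow> complex \<Rightarrow> bool" where
  "wirtinger w p q z \<longleftrightarrow> (w has_derivative (\<lambda>v. p * v + q * cnj v)) (at z)"

lemma wirtinger_const: "wirtinger (\<lambda>_. c) 0 0 z"
  unfolding wirtinger_def by simp

lemma wirtinger_ident: "wirtinger (\<lambda>z. z) 1 0 z"
  unfolding wirtinger_def by simp

lemma wirtinger_cnj: "wirtinger w p q z \<Longrightarrow> wirtinger (\<lambda>z. cnj (w z)) (cnj q) (cnj p) z"
  unfolding wirtinger_def
  by (drule bounded_linear.has_derivative[OF bounded_linear_cnj]) (simp add: add.commute)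

lemma wirtinger_add:
  "wirtinger v p q z \<Longrightarrow> wirtinger w p' q' z \<Longrightarrow> wirtinger (\<lambda>z. v z + w z) (p + p') (q + q') z"
  unfolding wirtinger_def by (drule (1) has_derivative_add) (simp add: algebra_simps)

lemma wirtinger_diff:
  "wirtinger v p q z \<Longrightarrow> wirtinger w p' q' z \<Longrightarrow> wirtinger (\<lambda>z. v z - w z) (p - p') (q - q') z"
  unfolding wirtinger_def by (drule (1) has_derivative_diff) (simp add: algebra_simps)

lemma wirtinger_mult:
  "wirtinger v p q z \<Longrightarrow> wirtinger w p' q' z \<Longrightarrow>
   wirtinger (\<lambda>z. v z * w z) (v z * p' + p * w z) (v z * q' + q * w z) z"
  unfolding wirtinger_def by (drule (1) has_derivative_mult) (simp add: algebra_simps)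

lemma wirtinger_chain:
  assumes "(f has_field_derivative f') (at (w z))" "wirtinger w p q z"
  shows "wirtinger (\<lambda>z. f (w z)) (f' * p) (f' * q) z"
  using has_derivative_compose[OF assms(2)[unfolded wirtinger_def]
      assms(1)[unfolded has_field_derivative_def]]
  unfolding wirtinger_def by (simp add: algebra_simps)

lemma wirtinger_power:
  assumes "wirtinger w p q z"
  shows "wirtinger (\<lambda>z. w z ^ n) (of_nat n * w z ^ (n - 1) * p) (of_nat n * w z ^ (n - 1) * q) z"
proof (rule wirtinger_chain[OF _ assms])
  show "((\<lambda>x. x ^ n) has_field_derivative of_nat n * w z ^ (n - 1)) (at (w z))"
    by (auto intro!: derivative_eq_intros)
qed

lemma wirtinger_cong:
  "wirtinger w p q z \<Longrightarrow> p = p' \<Longrightarrow> q = q' \<Longrightarrow> wirtinger w p' q' z"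
  by simp

text \<open>The path \<open>\<gamma>\<close> runs along a line at distance \<open>\<bar>y\<bar>\<close> from the origin and meets the disk in a chord whose
ends lie on the circle, where \<open>w\<close> vanishes; the integrand is the derivative of \<open>w\<close> along the path.\<close>

lemma chord_integral_zero:
  fixes w p q :: "complex \<Rightarrow> complex" and \<gamma> :: "real \<Rightarrow> complex"
  assumes contw: "continuous_on (cball 0 1) w" and zero: "\<And>z. norm z = 1 \<Longrightarrow> w z = 0"
    and der: "\<And>z. norm z < 1 \<Longrightarrow> wirtinger w (p z) (q z) z"
    and contp: "continuous_on (cball 0 1) p" and contq: "continuous_on (cball 0 1) q"
    and \<gamma>: "\<And>x. (\<gamma> has_vector_derivative e) (at x)" "\<And>x. (norm (\<gamma> x))\<^sup>2 = x\<^sup>2 + y\<^sup>2"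
  shows "(LINT x|lborel. indicator unit_disk (\<gamma> x) *\<^sub>R (p (\<gamma> x) * e + q (\<gamma> x) * cnj e)) = 0"
proof (cases "y\<^sup>2 < 1")
  case False
  hence "\<gamma> x \<notin> unit_disk" for x
  proof -
    have "(norm (\<gamma> x))\<^sup>2 \<ge> 1" using False \<gamma>(2)[of x] by (smt (verit) zero_le_power2)
    thus ?thesis by (simp add: abs_square_less_1 not_less[symmetric])
  qed
  thus ?thesis by simp
next
  case True
  define l where "l = sqrt (1 - y\<^sup>2)"
  have n1: "norm (\<gamma> x) < 1 \<longleftrightarrow> x \<in> {-l<..<l}" for x
    using chord_eq(1)[OF True, of x] \<gamma>(2)[of x] unfolding l_def
    by (metis abs_norm_cancel abs_square_less_1)
  have n2: "norm (\<gamma> x) \<le> 1 \<longleftrightarrow> x \<in> {-l..l}" for x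
    using chord_eq(2)[OF True, of x] \<gamma>(2)[of x] unfolding l_def
    by (metis abs_norm_cancel abs_square_le_1)
  have l0: "0 \<le> l" using True by (simp add: l_def)
  have l2: "l\<^sup>2 + y\<^sup>2 = 1" using True by (simp add: l_def)
  have contg: "continuous_on A \<gamma>" for A
    by (meson \<gamma>(1) continuous_at_imp_continuous_on has_vector_derivative_continuous)
  have img: "\<gamma> ` {-l..l} \<subseteq> cball 0 1" using n2 by auto
  note cc = continuous_on_compose2[OF _ contg img]
  have "(LINT x|lborel. indicator {-l<..<l} x *\<^sub>R (p (\<gamma> x) * e + q (\<gamma> x) * cnj e)) = 0"
  proof (rule LINT_derivative_zero[where W = "\<lambda>x. w (\<gamma> x)"])
    fix x assume "x \<in> {-l<..<l}"
    hence "norm (\<gamma> x) < 1" using n1 by simp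
    note d = der[OF this, unfolded wirtinger_def]
    have "((\<lambda>x. w (\<gamma> x)) has_derivative (\<lambda>h. p (\<gamma> x) * (h *\<^sub>R e) + q (\<gamma> x) * cnj (h *\<^sub>R e))) (at x)"
      using has_derivative_compose[OF \<gamma>(1)[unfolded has_vector_derivative_def] d] by simp
    thus "((\<lambda>x. w (\<gamma> x)) has_vector_derivative (p (\<gamma> x) * e + q (\<gamma> x) * cnj e)) (at x)"
      unfolding has_vector_derivative_def by (simp add: algebra_simps scaleR_conv_of_real)
  next
    have "(norm (\<gamma> l))\<^sup>2 = 1" "(norm (\<gamma> (-l)))\<^sup>2 = 1" using l2 by (simp_all add: \<gamma>(2))
    hence "norm (\<gamma> l) = 1" "norm (\<gamma> (-l)) = 1" by (simp_all add: power2_eq_1_iff)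
       (use norm_ge_zero in \<open>smt (verit)\<close>)+
    thus "w (\<gamma> l) = 0" "w (\<gamma> (-l)) = 0" by (auto intro: zero)
  qed (use l0 in \<open>auto intro!: continuous_intros cc contw contp contq\<close>)
  moreover have "indicator unit_disk (\<gamma> x) = (indicator {-l<..<l} x :: real)" for x
    using n1[of x] by (auto simp: indicator_def)
  ultimately show ?thesis by simp
qed

text \<open>Integration over horizontal chords annihilates \<open>p + q\<close>, over vertical chords \<open>\<i> (p - q)\<close>.  Every boundary term
in the sequel is arranged to vanish, so that no integral over the circle occurs.\<close>

lemma stokes_vanishing_boundary:
  fixes w p q :: "complex \<Rightarrow> complex"
  assumes contw: "continuous_on (cball 0 1) w" and zero: "\<And>z. norm z = 1 \<Longrightarrow> w z = 0"
    and der: "\<And>z. norm z < 1 \<Longrightarrow> wirtinger w (p z) (q z) z"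
    and contp: "continuous_on (cball 0 1) p" and contq: "continuous_on (cball 0 1) q"
  shows "(LINT z|disk_measure. p z) = 0" "(LINT z|disk_measure. q z) = 0"
proof -
  have ip: "integrable disk_measure p" and iq: "integrable disk_measure q"
    using contp contq by (auto intro: integrable_disk_continuous)
  have int: "integrable lborel (\<lambda>z. indicator unit_disk z *\<^sub>R (p z * e + q z * cnj e))" for e
    using ip iq unfolding set_integrable_def[symmetric] integrable_disk_measure[symmetric]
    by (intro Bochner_Integration.integrable_add integrable_mult_left) auto
  have chord: "(LINT x|lborel. indicator unit_disk (\<gamma> x) *\<^sub>R (p (\<gamma> x) * e + q (\<gamma> x) * cnj e)) = 0"
    if "\<And>x. (\<gamma> has_vector_derivative e) (at x)" "\<And>x. (norm (\<gamma> x))\<^sup>2 = x\<^sup>2 + y\<^sup>2"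
    for \<gamma> :: "real \<Rightarrow> complex" and e y
    by (rule chord_integral_zero[of w p q \<gamma> e y]) (use assms that in auto)
  have vd1: "((\<lambda>x. Complex x y) has_vector_derivative 1) (at x)" for x y
    unfolding Complex_eq by (auto intro!: derivative_eq_intros simp: has_vector_derivative_def fun_eq_iff scaleR_conv_of_real)
  have vd2: "((\<lambda>y. Complex x y) has_vector_derivative \<i>) (at y)" for x y
    unfolding Complex_eq by (auto intro!: derivative_eq_intros simp: has_vector_derivative_def fun_eq_iff scaleR_conv_of_real)
  have "(LINT z|lborel. indicator unit_disk z *\<^sub>R (p z * 1 + q z * cnj 1)) = 0"
    by (rule integral_zero_of_slices(1)[OF int], rule chord, rule vd1) (simp add: cmod_def)
  hence a: "(LINT z|disk_measure. p z + q z) = 0"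
    unfolding LINT_disk_measure set_lebesgue_integral_def by simp
  have "(LINT z|lborel. indicator unit_disk z *\<^sub>R (p z * \<i> + q z * cnj \<i>)) = 0"
    by (rule integral_zero_of_slices(2)[OF int], rule chord, rule vd2) (simp add: cmod_def)
  hence b: "(LINT z|disk_measure. p z * \<i> + q z * (- \<i>)) = 0"
    unfolding LINT_disk_measure set_lebesgue_integral_def by simp
  have "(LINT z|disk_measure. p z) + (LINT z|disk_measure. q z) = 0"
    using a ip iq by simp
  moreover have "(LINT z|disk_measure. p z) * \<i> - (LINT z|disk_measure. q z) * \<i> = 0"
    using b ip iq by simp
  hence "(LINT z|disk_measure. p z) = (LINT z|disk_measure. q z)" by simp
  ultimately show "(LINT z|disk_measure. p z) = 0" "(LINT z|disk_measure. q z) = 0" by auto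
qed

section \<open>Square integrals of power series over the disk\<close>

text \<open>Stokes' theorem for \<open>z\<^sup>a\<close> times the \<open>b\<close>-th power of the conjugate times \<open>1 - \<bar>z\<bar>\<^sup>2\<close>.  The resulting recursion
determines all monomial integrals from the area of the disk.\<close>

lemma disk_monomial_step:
  "(LINT z|disk_measure. z ^ Suc a * cnj z ^ b) * of_nat (Suc b)
    = of_nat b * (LINT z|disk_measure. z ^ a * cnj z ^ (b - 1))"
proof -
  define w where "w = (\<lambda>z. z ^ a * cnj z ^ b * (1 - z * cnj z))"
  define p where "p = (\<lambda>z. (of_nat a * z ^ (a - 1) * cnj z ^ b) * (1 - z * cnj z)
      - z ^ a * cnj z ^ b * cnj z)"
  define q where "q = (\<lambda>z. of_nat b * (z ^ a * cnj z ^ (b - 1)) - of_nat (Suc b) * (z ^ Suc a * cnj z ^ b))"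
  have d: "wirtinger w (p z) (q z) z" for z
  proof -
    have e: "cnj z * cnj z ^ (b - Suc 0) = cnj z ^ b" if "0 < b"
      using that by (cases b) auto
    show ?thesis unfolding w_def
      by (rule wirtinger_cong, (rule wirtinger_mult wirtinger_diff wirtinger_const wirtinger_power
            wirtinger_cnj wirtinger_ident)+) (auto simp: p_def q_def algebra_simps e)
  qed
  have nz: "z * cnj z = 1" if "norm z = 1" for z
    using complex_norm_square[of z] that by simp
  have "(LINT z|disk_measure. q z) = 0"
  proof (rule stokes_vanishing_boundary(2)[where w = w and p = p and q = q])
    show "continuous_on (cball 0 1) w" "continuous_on (cball 0 1) p" "continuous_on (cball 0 1) q"
      unfolding w_def p_def q_def by (intro continuous_intros)+
  qed (use d nz in \<open>auto simp: w_def\<close>)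
  moreover have "integrable disk_measure (\<lambda>z. z ^ n * cnj z ^ m)" for n m
    by (intro integrable_disk_continuous continuous_intros)
  ultimately show ?thesis unfolding q_def
    by (simp add: mult.commute del: power_Suc of_nat_Suc)
qed

lemma measure_disk: "measure disk_measure unit_disk = pi"
proof -
  have "measure disk_measure unit_disk = measure lborel (ball (0 :: complex) 1)"
    unfolding disk_measure_def by (subst measure_restrict_space) auto
  also have "\<dots> = pi"
    using content_ball[of 1 "0 :: complex"] by (simp add: unit_ball_vol_2)
  finally show ?thesis .
qed

lemma disk_monomial_integral:
  "(LINT z|disk_measure. z ^ a * cnj z ^ b) = (if a = b then of_real pi / of_nat (Suc a) else 0)"
proof -
  have step: "(LINT z|disk_measure. z ^ Suc a * cnj z ^ Suc b)
      = of_nat (Suc b) / of_nat (Suc (Suc b)) * (LINT z|disk_measure. z ^ a * cnj z ^ b)" for a b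
    using disk_monomial_step[of a "Suc b"]
    by (simp add: field_simps del: of_nat_Suc power_Suc)
  have left0: "(LINT z|disk_measure. z ^ Suc a * cnj z ^ 0) = 0" for a
    using disk_monomial_step[of a 0] by simp
  have right0: "(LINT z|disk_measure. z ^ 0 * cnj z ^ Suc b) = 0" for b
    using Bochner_Integration.integral_cnj[of disk_measure "\<lambda>z. z ^ Suc b"] left0[of b] by simp
  show ?thesis
  proof (induction a arbitrary: b)
    case 0
    show ?case
    proof (cases b)
      case 0
      thus ?thesis using measure_disk by (simp add: scaleR_conv_of_real)
    next
      case (Suc b')
      thus ?thesis using right0[of b'] by simp
    qed
  next
    case (Suc a)
    show ?case
    proof (cases b)
      case 0
      thus ?thesis using left0[of a] by simp
    next
      case (Suc b')
      have "of_nat (Suc a) / of_nat (Suc (Suc a)) * (of_real pi / of_nat (Suc a))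
          = (of_real pi / of_nat (Suc (Suc a)) :: complex)"
        by (simp del: of_nat_Suc)
      thus ?thesis unfolding Suc step Suc.IH by (auto simp del: of_nat_Suc)
    qed
  qed
qed

text \<open>Absolute summability of the coefficients dominates the series on the whole disk, which allows termwise integration.\<close>

lemma integral_disk_power_series:
  fixes h :: "complex \<Rightarrow> complex"
  assumes a: "summable (\<lambda>n. norm (a n))"
    and h: "h \<in> borel_measurable disk_measure" "\<And>z. z \<in> unit_disk \<Longrightarrow> norm (h z) \<le> K"
  shows "(\<lambda>n. a n * (LINT z|disk_measure. z ^ n * h z)) sums
    (LINT z|disk_measure. (\<Sum>n. a n * z ^ n) * h z)"
proof -
  interpret finite_measure disk_measure by (rule finite_measure_disk)
  have [measurable]: "(\<lambda>z. z ^ n) \<in> borel_measurable disk_measure" for n :: nat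
    by (intro measurable_disk_continuous continuous_intros)
  note [measurable] = h(1)
  have K: "0 \<le> K" using h(2)[of 0] norm_ge_zero[of "h 0"] by (simp del: norm_ge_zero)
  have bd: "norm (a n * z ^ n * h z) \<le> norm (a n) * K" if "z \<in> unit_disk" for n z
    unfolding norm_mult norm_power
    using that h(2)[OF that] K by (intro mult_mono) (auto simp: power_le_one mult_left_le)
  have int: "integrable disk_measure (\<lambda>z. a n * z ^ n * h z)" for n
    by (rule integrable_disk_bounded[where K = "norm (a n) * K"]) (use bd in auto)
  have s: "summable (\<lambda>n. norm (a n * z ^ n * h z))" if "z \<in> unit_disk" for z
    using bd[OF that] by (intro summable_comparison_test'[OF summable_mult2[OF a, of K]]) auto
  have s2: "summable (\<lambda>n. LINT z|disk_measure. norm (a n * z ^ n * h z))"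
  proof (rule summable_comparison_test'[where N = 0])
    show "summable (\<lambda>n. norm (a n) * (K * measure disk_measure unit_disk))"
      using a by (rule summable_mult2)
    fix n :: nat
    have "(LINT z|disk_measure. norm (a n * z ^ n * h z)) \<le> (LINT z|disk_measure. norm (a n) * K)"
      using bd int by (intro integral_mono) auto
    thus "norm (LINT z|disk_measure. norm (a n * z ^ n * h z)) \<le> norm (a n) * (K * measure disk_measure unit_disk)"
      by (simp add: mult_ac)
  qed
  have "(\<lambda>n. LINT z|disk_measure. a n * z ^ n * h z) sums (LINT z|disk_measure. (\<Sum>n. a n * z ^ n * h z))"
    using int s s2 by (intro sums_integral) auto
  also have "(LINT z|disk_measure. (\<Sum>n. a n * z ^ n * h z)) = (LINT z|disk_measure. (\<Sum>n. a n * z ^ n) * h z)"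
  proof (rule Bochner_Integration.integral_cong[OF refl])
    fix z assume "z \<in> space disk_measure"
    hence "z \<in> unit_disk" by simp
    hence sm: "summable (\<lambda>n. norm (a n * z ^ n))"
      by (intro summable_comparison_test'[OF a]) (auto simp: norm_mult norm_power power_le_one mult_left_le)
    show "(\<Sum>n. a n * z ^ n * h z) = (\<Sum>n. a n * z ^ n) * h z"
      using suminf_mult2[OF summable_norm_cancel[OF sm], of "h z"] by simp
  qed
  also have "(\<lambda>n. LINT z|disk_measure. a n * z ^ n * h z) = (\<lambda>n. a n * (LINT z|disk_measure. z ^ n * h z))"
    by (simp add: mult.assoc)
  finally show ?thesis .
qed

lemma continuous_on_abs_power_series:
  fixes a :: "nat \<Rightarrow> complex"
  assumes a: "summable (\<lambda>n. norm (a n))"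
  shows "continuous_on (cball 0 1) (\<lambda>z. \<Sum>n. a n * z ^ n)"
proof (rule uniform_limit_theorem[where F = sequentially])
  show "uniform_limit (cball 0 1) (\<lambda>n z. \<Sum>i<n. a i * z ^ i) (\<lambda>z. \<Sum>n. a n * z ^ n) sequentially"
    by (rule Weierstrass_m_test[OF _ a]) (auto simp: norm_mult norm_power power_le_one mult_left_le)
qed (auto intro!: always_eventually continuous_intros)

lemma disk_coefficient_integral:
  assumes a: "summable (\<lambda>n. norm (a n))"
  shows "(LINT z|disk_measure. (\<Sum>n. a n * z ^ n) * cnj z ^ m) = a m * (of_real pi / of_nat (Suc m))"
proof -
  have "(\<lambda>n. a n * (LINT z|disk_measure. z ^ n * cnj z ^ m)) sums
      (LINT z|disk_measure. (\<Sum>n. a n * z ^ n) * cnj z ^ m)"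
    by (rule integral_disk_power_series[OF a, where K = 1])
      (auto intro!: measurable_disk_continuous continuous_intros simp: norm_power power_le_one)
  moreover have "(\<lambda>n. a n * (LINT z|disk_measure. z ^ n * cnj z ^ m))
      = (\<lambda>n. if n = m then a n * (of_real pi / of_nat (Suc n)) else 0)"
    by (auto simp: disk_monomial_integral)
  ultimately have "(\<lambda>n. if n = m then a n * (of_real pi / of_nat (Suc n)) else 0) sums
      (LINT z|disk_measure. (\<Sum>n. a n * z ^ n) * cnj z ^ m)"
    by simp
  from sums_unique2[OF this sums_single[of m "\<lambda>n. a n * (of_real pi / of_nat (Suc n))"]]
  show ?thesis .
qed

lemma disk_parseval:
  assumes a: "summable (\<lambda>n. norm (a n))"
  shows "(\<lambda>n. pi * (norm (a n))\<^sup>2 / Suc n) sums (LINT z|disk_measure. (norm (\<Sum>n. a n * z ^ n))\<^sup>2)"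
proof -
  define f where "f = (\<lambda>z. \<Sum>n. a n * z ^ n)"
  have cf: "continuous_on (cball 0 1) f"
    unfolding f_def by (rule continuous_on_abs_power_series[OF a])
  have "bounded (f ` cball 0 1)"
    by (rule compact_imp_bounded[OF compact_continuous_image[OF cf]]) simp
  then obtain K where K: "\<And>z. z \<in> cball 0 1 \<Longrightarrow> norm (f z) \<le> K"
    unfolding bounded_iff by blast
  have cf': "continuous_on unit_disk f" using cf by (rule continuous_on_subset) auto
  have "(\<lambda>n. a n * (LINT z|disk_measure. z ^ n * cnj (f z))) sums (LINT z|disk_measure. f z * cnj (f z))"
    unfolding f_def
    by (rule integral_disk_power_series[OF a, where K = K])
      (use K cf' in \<open>auto intro!: measurable_disk_continuous continuous_intros simp: f_def\<close>)
  moreover have "(LINT z|disk_measure. z ^ n * cnj (f z)) = cnj (a n) * (of_real pi / of_nat (Suc n))" for n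
  proof -
    have "(LINT z|disk_measure. z ^ n * cnj (f z)) = cnj (LINT z|disk_measure. f z * cnj z ^ n)"
      by (subst Bochner_Integration.integral_cnj[symmetric]) (simp add: mult.commute)
    thus ?thesis using disk_coefficient_integral[OF a, of n] by (simp add: f_def)
  qed
  moreover have "(\<lambda>n. a n * (cnj (a n) * (of_real pi / of_nat (Suc n))))
     = (\<lambda>n. of_real (pi * (norm (a n))\<^sup>2 / Suc n))"
    unfolding mult.assoc[symmetric] complex_norm_square[symmetric]
    by (intro ext) (simp add: mult.commute del: of_nat_Suc)
  moreover have "(LINT z|disk_measure. f z * cnj (f z)) = of_real (LINT z|disk_measure. (norm (f z))\<^sup>2)"
    unfolding complex_norm_square[symmetric] by (rule integral_complex_of_real)
  ultimately have "(\<lambda>n. complex_of_real (pi * (norm (a n))\<^sup>2 / Suc n)) sums of_real (LINT z|disk_measure. (norm (f z))\<^sup>2)"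
    by simp
  thus ?thesis unfolding f_def by (simp only: sums_of_real_iff)
qed

lemma nn_integral_disk_scale:
  fixes g :: "complex \<Rightarrow> ennreal"
  assumes [measurable]: "g \<in> borel_measurable borel" and r: "0 < r"
  shows "ennreal (r\<^sup>2) * (\<integral>\<^sup>+z. g (of_real r * z) * indicator (ball 0 1) z \<partial>lborel)
    = (\<integral>\<^sup>+z. g z * indicator (ball 0 r) z \<partial>lborel)"
proof -
  have ind: "indicator (ball 0 r) (of_real r * z) = (indicator (ball 0 1) z :: ennreal)" for z :: complex
    using r by (auto simp: indicator_def norm_mult)
  have [measurable]: "ball (0 :: complex) s \<in> sets borel" for s by simp
  have L: "(lborel :: complex measure) = density (distr lborel borel (\<lambda>z. of_real r * z)) (\<lambda>_. ennreal (r\<^sup>2))"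
    using lborel_affine[of r "0 :: complex"] r by (simp add: scaleR_conv_of_real)
  have "(\<integral>\<^sup>+z. g z * indicator (ball 0 r) z \<partial>lborel)
      = (\<integral>\<^sup>+z. g z * indicator (ball 0 r) z
          \<partial>density (distr lborel borel (\<lambda>z. of_real r * z)) (\<lambda>_. ennreal (r\<^sup>2)))"
    using L by (rule arg_cong[where f = "\<lambda>M. \<integral>\<^sup>+z. g z * indicator (ball 0 r) z \<partial>M"])
  also have "\<dots> = (\<integral>\<^sup>+z. ennreal (r\<^sup>2) * (g z * indicator (ball 0 r) z) \<partial>distr lborel borel (\<lambda>z. of_real r * z))"
    by (rule nn_integral_density) measurable
  also have "\<dots> = (\<integral>\<^sup>+z. ennreal (r\<^sup>2) * (g (of_real r * z) * indicator (ball 0 r) (of_real r * z)) \<partial>lborel)"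
    by (rule nn_integral_distr) measurable
  also have "\<dots> = ennreal (r\<^sup>2) * (\<integral>\<^sup>+z. g (of_real r * z) * indicator (ball 0 1) z \<partial>lborel)"
    unfolding ind by (rule nn_integral_cmult) measurable
  finally show ?thesis ..
qed

lemma nn_integral_disk_measure:
  assumes "f \<in> borel_measurable disk_measure"
  shows "(\<integral>\<^sup>+z. f z \<partial>disk_measure) = (\<integral>\<^sup>+z. f z * indicator unit_disk z \<partial>lborel)"
  unfolding disk_measure_def by (rule nn_integral_restrict_space) simp

lemma measurable_disk_ennreal:
  "continuous_on unit_disk f \<Longrightarrow> (\<lambda>z. ennreal (f z)) \<in> borel_measurable disk_measure"
  by (rule measurable_compose[OF measurable_disk_continuous measurable_ennreal])

text \<open>The coefficients of \<open>\<omega>\<close> itself may fail to be summable, so Parseval's identity is applied to \<open>\<omega>(rz)\<close> and \<open>r\<close>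
increases to 1; both sides converge monotonically.  Because the values lie in \<open>[0, \<infinity>]\<close>, the identity also tells
which power series are square integrable.\<close>

lemma nn_integral_disk_parseval:
  assumes sums: "\<And>z. norm z < 1 \<Longrightarrow> (\<lambda>n. a n * z ^ n) sums \<omega> z"
  shows "(\<integral>\<^sup>+z. ennreal ((norm (\<omega> z))\<^sup>2) \<partial>disk_measure) = (\<Sum>n. ennreal (pi * (norm (a n))\<^sup>2 / Suc n))"
proof -
  define r where "r = (\<lambda>i::nat. 1 - 1 / (real i + 2))"
  have r: "0 < r i" "r i < 1" for i by (auto simp: r_def field_simps)
  have incr: "r i \<le> r j" if "i \<le> j" for i j using that by (auto simp: r_def frac_le)
  have rlim: "r \<longlonglongrightarrow> 1" unfolding r_def by real_asymp
  define g where "g = (\<lambda>z. if norm z < 1 then ennreal ((norm (\<omega> z))\<^sup>2) else 0)"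
  have inc: "incseq (\<lambda>i. ennreal (pi * (norm (a n))\<^sup>2 / Suc n * r i ^ (2 * n + 2)))" for n
    unfolding incseq_def using r
    by (intro allI impI ennreal_leI mult_left_mono power_mono incr) (auto intro: less_imp_le)
  have om: "continuous_on unit_disk \<omega>"
  proof -
    have "\<omega> holomorphic_on ball 0 1"
      by (rule power_series_holomorphic[of _ _ a]) (use sums in auto)
    thus ?thesis by (rule holomorphic_on_imp_continuous_on)
  qed
  have [measurable]: "g \<in> borel_measurable borel"
  proof -
    have "(\<lambda>z. indicator unit_disk z *\<^sub>R \<omega> z) \<in> borel_measurable borel"
      using om by (intro borel_measurable_continuous_on_indicator) auto
    hence "(\<lambda>z. ennreal ((norm (indicator unit_disk z *\<^sub>R \<omega> z))\<^sup>2)) \<in> borel_measurable borel"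
      by measurable
    also have "(\<lambda>z. ennreal ((norm (indicator unit_disk z *\<^sub>R \<omega> z))\<^sup>2)) = g"
      by (auto simp: g_def fun_eq_iff indicator_def)
    finally show ?thesis .
  qed
  have inner: "(\<integral>\<^sup>+z. g z * indicator (ball 0 (r i)) z \<partial>lborel)
      = (\<Sum>n. ennreal (pi * (norm (a n))\<^sup>2 / Suc n * r i ^ (2 * n + 2)))" for i
  proof -
    define b where "b = (\<lambda>n. a n * of_real (r i) ^ n)"
    have "summable (\<lambda>n. norm (a n * of_real (r i) ^ n))"
    proof (rule powser_insidea)
      show "summable (\<lambda>n. a n * of_real ((1 + r i) / 2) ^ n)"
        using sums[of "of_real ((1 + r i) / 2)"] r[of i] unfolding norm_of_real by (auto simp: sums_iff)
      have "norm (complex_of_real ((1 + r i) / 2)) = (1 + r i) / 2"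
        unfolding norm_of_real using r[of i] by simp
      thus "norm (complex_of_real (r i)) < norm (complex_of_real ((1 + r i) / 2))"
        using r[of i] by simp
    qed
    hence b: "summable (\<lambda>n. norm (b n))" by (simp add: b_def)
    have eq: "(\<Sum>n. b n * z ^ n) = \<omega> (of_real (r i) * z)" if "norm z < 1" for z
    proof -
      have "norm (of_real (r i) * z) < 1"
        using that r[of i] mult_left_le_one_le[of "norm z" "r i"] by (simp add: norm_mult)
      from sums[OF this] show ?thesis by (simp add: b_def sums_iff power_mult_distrib mult_ac)
    qed
    have "(\<integral>\<^sup>+z. g (of_real (r i) * z) * indicator (ball 0 1) z \<partial>lborel)
        = (\<integral>\<^sup>+z. ennreal ((norm (\<Sum>n. b n * z ^ n))\<^sup>2) * indicator (ball 0 1) z \<partial>lborel)"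
    proof (rule nn_integral_cong)
      fix z :: complex
      have "norm (of_real (r i) * z) < 1" if "norm z < 1"
        using that r[of i] mult_left_le_one_le[of "norm z" "r i"] by (simp add: norm_mult)
      thus "g (of_real (r i) * z) * indicator (ball 0 1) z
        = ennreal ((norm (\<Sum>n. b n * z ^ n))\<^sup>2) * indicator (ball 0 1) z"
        using eq[of z] by (auto simp: g_def indicator_def)
    qed
    also have "\<dots> = (\<integral>\<^sup>+z. ennreal ((norm (\<Sum>n. b n * z ^ n))\<^sup>2) \<partial>disk_measure)"
      by (rule nn_integral_disk_measure[symmetric], rule measurable_disk_ennreal,
          intro continuous_intros continuous_on_subset[OF continuous_on_abs_power_series[OF b]]) auto
    also have "\<dots> = ennreal (LINT z|disk_measure. (norm (\<Sum>n. b n * z ^ n))\<^sup>2)"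
      by (rule nn_integral_eq_integral)
        (auto intro!: integrable_disk_continuous continuous_intros continuous_on_abs_power_series[OF b])
    also have "\<dots> = (\<Sum>n. ennreal (pi * (norm (b n))\<^sup>2 / Suc n))"
      using disk_parseval[OF b] by (intro suminf_ennreal_eq[symmetric]) auto
    finally have scaled: "(\<integral>\<^sup>+z. g (of_real (r i) * z) * indicator (ball 0 1) z \<partial>lborel)
        = (\<Sum>n. ennreal (pi * (norm (b n))\<^sup>2 / Suc n))" .
    have "(\<integral>\<^sup>+z. g z * indicator (ball 0 (r i)) z \<partial>lborel)
        = ennreal ((r i)\<^sup>2) * (\<Sum>n. ennreal (pi * (norm (b n))\<^sup>2 / Suc n))"
      unfolding scaled[symmetric] by (rule nn_integral_disk_scale[symmetric]) (use r[of i] in auto)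
    also have "\<dots> = (\<Sum>n. ennreal ((r i)\<^sup>2) * ennreal (pi * (norm (b n))\<^sup>2 / Suc n))"
      by (rule ennreal_suminf_cmult[symmetric])
    also have "\<dots> = (\<Sum>n. ennreal (pi * (norm (a n))\<^sup>2 / Suc n * r i ^ (2 * n + 2)))"
    proof (intro suminf_cong)
      fix n
      have e: "(r i)\<^sup>2 * (pi * (norm (b n))\<^sup>2 / Suc n) = pi * (norm (a n))\<^sup>2 / Suc n * r i ^ (2 * n + 2)"
        using r[of i] by (simp add: b_def norm_mult norm_power power_mult_distrib power_add power_mult mult_ac
            power2_eq_square del: of_nat_Suc)
      show "ennreal ((r i)\<^sup>2) * ennreal (pi * (norm (b n))\<^sup>2 / Suc n)
        = ennreal (pi * (norm (a n))\<^sup>2 / Suc n * r i ^ (2 * n + 2))"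
        by (subst ennreal_mult'[symmetric], simp, subst e, rule refl)
    qed
    finally show ?thesis .
  qed
  have "(\<integral>\<^sup>+z. ennreal ((norm (\<omega> z))\<^sup>2) \<partial>disk_measure) = (\<integral>\<^sup>+z. g z * indicator unit_disk z \<partial>lborel)"
    by (subst nn_integral_disk_measure, rule measurable_disk_ennreal, intro continuous_intros om)
      (auto intro!: nn_integral_cong simp: g_def indicator_def)
  also have "\<dots> = (\<integral>\<^sup>+z. (SUP i. g z * indicator (ball 0 (r i)) z) \<partial>lborel)"
  proof (rule nn_integral_cong)
    fix z :: complex
    show "g z * indicator unit_disk z = (SUP i. g z * indicator (ball 0 (r i)) z)"
    proof (cases "norm z < 1")
      case True
      have "\<forall>\<^sub>F i in sequentially. norm z < r i"
        using rlim True by (rule order_tendstoD)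
      then obtain i where "norm z < r i" by (auto simp: eventually_sequentially)
      hence "g z * indicator unit_disk z \<le> g z * indicator (ball 0 (r i)) z"
        using True by simp
      thus ?thesis
        by (intro antisym SUP_upper2[of i] SUP_least)
           (auto simp: indicator_def g_def)
    qed (auto simp: g_def indicator_def)
  qed
  also have "\<dots> = (SUP i. \<integral>\<^sup>+z. g z * indicator (ball 0 (r i)) z \<partial>lborel)"
    by (rule nn_integral_monotone_convergence_SUP)
      (auto simp: incseq_def le_fun_def indicator_def dest: order.strict_trans2[OF _ incr])
  also have "\<dots> = (SUP i. \<Sum>n. ennreal (pi * (norm (a n))\<^sup>2 / Suc n * r i ^ (2 * n + 2)))"
    by (simp add: inner)
  also have "\<dots> = (\<Sum>n. SUP i. ennreal (pi * (norm (a n))\<^sup>2 / Suc n * r i ^ (2 * n + 2)))"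
    by (intro ennreal_suminf_SUP_eq[symmetric] inc)
  also have "\<dots> = (\<Sum>n. ennreal (pi * (norm (a n))\<^sup>2 / Suc n))"
  proof (intro suminf_cong)
    fix n
    have "(\<lambda>i. pi * (norm (a n))\<^sup>2 / Suc n * r i ^ (2 * n + 2)) \<longlonglongrightarrow> pi * (norm (a n))\<^sup>2 / Suc n * 1 ^ (2 * n + 2)"
      by (intro tendsto_intros rlim)
    hence "(\<lambda>i. ennreal (pi * (norm (a n))\<^sup>2 / Suc n * r i ^ (2 * n + 2))) \<longlonglongrightarrow> ennreal (pi * (norm (a n))\<^sup>2 / Suc n)"
      by (intro tendsto_ennrealI) simp
    thus "(SUP i. ennreal (pi * (norm (a n))\<^sup>2 / Suc n * r i ^ (2 * n + 2))) = ennreal (pi * (norm (a n))\<^sup>2 / Suc n)"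
      using LIMSEQ_SUP[OF inc[of n]] LIMSEQ_unique by blast
  qed
  finally show ?thesis .
qed

lemma integral_Cauchy_Schwarz:
  fixes f g :: "'a \<Rightarrow> complex"
  assumes [measurable]: "f \<in> borel_measurable M" "g \<in> borel_measurable M"
    and f2: "integrable M (\<lambda>x. (norm (f x))\<^sup>2)" and g2: "integrable M (\<lambda>x. (norm (g x))\<^sup>2)"
  shows "integrable M (\<lambda>x. f x * g x)"
    and "norm (LINT x|M. f x * g x) \<le> sqrt (LINT x|M. (norm (f x))\<^sup>2) * sqrt (LINT x|M. (norm (g x))\<^sup>2)"
proof -
  show int: "integrable M (\<lambda>x. f x * g x)"
  proof (rule Bochner_Integration.integrable_bound)
    show "integrable M (\<lambda>x. (norm (f x))\<^sup>2 + (norm (g x))\<^sup>2)" using f2 g2 by simp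
    have "norm (f x * g x) \<le> (norm (f x))\<^sup>2 + (norm (g x))\<^sup>2" for x
    proof -
      have "2 * (norm (f x) * norm (g x)) \<le> (norm (f x))\<^sup>2 + (norm (g x))\<^sup>2"
        using sum_squares_bound[of "norm (f x)" "norm (g x)"] by (simp add: mult.assoc)
      moreover have "0 \<le> norm (f x) * norm (g x)" by simp
      ultimately show ?thesis unfolding norm_mult by linarith
    qed
    thus "AE x in M. norm (f x * g x) \<le> norm ((norm (f x))\<^sup>2 + (norm (g x))\<^sup>2)" by simp
  qed simp
  let ?I = "LINT x|M. norm (f x * g x)"
  have "(\<integral>\<^sup>+x. ennreal (norm (f x)) * ennreal (norm (g x)) \<partial>M)\<^sup>2
      \<le> (\<integral>\<^sup>+x. (ennreal (norm (f x)))\<^sup>2 \<partial>M) * (\<integral>\<^sup>+x. (ennreal (norm (g x)))\<^sup>2 \<partial>M)"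
    by (rule Cauchy_Schwarz_nn_integral) auto
  also have "(\<integral>\<^sup>+x. ennreal (norm (f x)) * ennreal (norm (g x)) \<partial>M) = ennreal ?I"
    using nn_integral_eq_integral[OF integrable_norm[OF int]] by (simp add: norm_mult ennreal_mult)
  also have "(\<integral>\<^sup>+x. (ennreal (norm (f x)))\<^sup>2 \<partial>M) = ennreal (LINT x|M. (norm (f x))\<^sup>2)"
    using nn_integral_eq_integral[OF f2] by (simp add: ennreal_power)
  also have "(\<integral>\<^sup>+x. (ennreal (norm (g x)))\<^sup>2 \<partial>M) = ennreal (LINT x|M. (norm (g x))\<^sup>2)"
    using nn_integral_eq_integral[OF g2] by (simp add: ennreal_power)
  finally have "ennreal (?I\<^sup>2) \<le> ennreal ((LINT x|M. (norm (f x))\<^sup>2) * (LINT x|M. (norm (g x))\<^sup>2))"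
    by (simp add: ennreal_power ennreal_mult)
  hence "?I\<^sup>2 \<le> (LINT x|M. (norm (f x))\<^sup>2) * (LINT x|M. (norm (g x))\<^sup>2)"
    by (subst (asm) ennreal_le_iff) auto
  hence "?I \<le> sqrt ((LINT x|M. (norm (f x))\<^sup>2) * (LINT x|M. (norm (g x))\<^sup>2))"
    by (rule real_le_rsqrt)
  hence "?I \<le> sqrt (LINT x|M. (norm (f x))\<^sup>2) * sqrt (LINT x|M. (norm (g x))\<^sup>2)"
    by (simp only: real_sqrt_mult)
  with Bochner_Integration.integral_norm_bound
  show "norm (LINT x|M. f x * g x) \<le> sqrt (LINT x|M. (norm (f x))\<^sup>2) * sqrt (LINT x|M. (norm (g x))\<^sup>2)"
    by (rule order_trans)
qed

section \<open>Energy of functions with antiholomorphic boundary values\<close>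

lemma wirtinger_holomorphic:
  assumes "f holomorphic_on ball 0 R" "norm z < R"
  shows "wirtinger f (deriv f z) 0 z"
  using wirtinger_chain[OF holomorphic_derivI[OF assms(1)] wirtinger_ident, of z] assms(2) by simp

lemma wirtinger_holomorphic_cnj:
  assumes "f holomorphic_on ball 0 R" "norm z < R"
  shows "wirtinger (\<lambda>z. f (cnj z)) 0 (deriv f (cnj z)) z"
  using wirtinger_chain[OF holomorphic_derivI[OF assms(1)] wirtinger_cnj[OF wirtinger_ident], of z]
    assms(2) by simp

lemma continuous_on_holomorphic_cnj:
  assumes "f holomorphic_on ball 0 R" "1 < R"
  shows "continuous_on (cball 0 1) (\<lambda>z. f (cnj z))" "continuous_on (cball 0 1) f"
proof -
  have c: "continuous_on (ball 0 R) f" using assms(1) by (rule holomorphic_on_imp_continuous_on)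
  thus "continuous_on (cball 0 1) f" by (rule continuous_on_subset) (use assms in auto)
  show "continuous_on (cball 0 1) (\<lambda>z. f (cnj z))"
    by (rule continuous_on_compose2[OF c]) (use assms in \<open>auto intro!: continuous_intros\<close>)
qed

text \<open>Both claims say that an integral depends only on boundary values, and so may be computed for the antiholomorphic
function \<open>z \<mapsto> D(cnj z)\<close> instead of \<open>u\<close>.  For the first, the integral is that of the Jacobian
\<open>\<bar>p\<bar>\<^sup>2 - \<bar>q\<bar>\<^sup>2\<close>, which for an antiholomorphic function is nowhere positive.  The agreement of the
two mixed second derivatives of \<open>u\<close>, both called \<open>m\<close>, makes the second order terms cancel.\<close>

lemma boundary_energy:
  fixes u p q m p1 q2 D g :: "complex \<Rightarrow> complex"
  assumes cont: "continuous_on (cball 0 1) u" "continuous_on (cball 0 1) p" "continuous_on (cball 0 1) q"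
      "continuous_on (cball 0 1) m" "continuous_on (cball 0 1) p1" "continuous_on (cball 0 1) q2"
    and u: "\<And>z. norm z < 1 \<Longrightarrow> wirtinger u (p z) (q z) z"
    and p: "\<And>z. norm z < 1 \<Longrightarrow> wirtinger p (p1 z) (m z) z"
    and q: "\<And>z. norm z < 1 \<Longrightarrow> wirtinger q (m z) (q2 z) z"
    and R: "1 < R" and D: "D holomorphic_on ball 0 R" and g: "g holomorphic_on ball 0 R"
    and bdry: "\<And>z. norm z = 1 \<Longrightarrow> u z = D (cnj z)"
  shows "(LINT z|disk_measure. (norm (p z))\<^sup>2) \<le> (LINT z|disk_measure. (norm (q z))\<^sup>2)"
    and "(LINT z|disk_measure. q z * g z) = (LINT z|disk_measure. deriv D (cnj z) * g z)"
proof -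
  define w where "w = (\<lambda>z. u z - D (cnj z))"
  define d where "d = (\<lambda>z. deriv D (cnj z))"
  define d2 where "d2 = (\<lambda>z. deriv (deriv D) (cnj z))"
  have D': "deriv D holomorphic_on ball 0 R" "deriv (deriv D) holomorphic_on ball 0 R"
    using D by (auto intro!: holomorphic_intros)
  have cw: "continuous_on (cball 0 1) w" and cd: "continuous_on (cball 0 1) d"
      and cd2: "continuous_on (cball 0 1) d2"
    unfolding w_def d_def d2_def
    by (intro continuous_intros cont continuous_on_holomorphic_cnj(1)[OF _ R] D D')+
  have w: "wirtinger w (p z) (q z - d z) z" if "norm z < 1" for z
    unfolding w_def d_def
    by (rule wirtinger_cong, rule wirtinger_diff[OF u[OF that] wirtinger_holomorphic_cnj[OF D]])
       (use that R in auto)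
  have d: "wirtinger d 0 (d2 z) z" if "norm z < 1" for z
    unfolding d_def d2_def by (rule wirtinger_holomorphic_cnj[OF D'(1)]) (use that R in auto)
  have g': "wirtinger g (deriv g z) 0 z" if "norm z < 1" for z
    by (rule wirtinger_holomorphic[OF g]) (use that R in auto)
  have cg: "continuous_on (cball 0 1) g" "continuous_on (cball 0 1) (deriv g)"
    by (intro continuous_on_holomorphic_cnj(2)[OF _ R] g holomorphic_deriv open_ball)+
  have w0: "w z = 0" if "norm z = 1" for z
    using bdry[OF that] by (simp add: w_def)
  note ci = continuous_intros cont cw cd cd2 cg
  note int = integrable_disk_continuous
  \<comment> \<open>the factors \<open>cnj p\<close> and \<open>cnj q\<close> of \<open>w\<close> both produce the term \<open>cnj m * w\<close>, which is eliminated below\<close>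
  have I1: "(LINT z|disk_measure. cnj (p z) * p z + cnj (m z) * w z) = 0"
    by (rule stokes_vanishing_boundary(1)[where w = "\<lambda>z. cnj (p z) * w z"
          and q = "\<lambda>z. cnj (p z) * (q z - d z) + cnj (p1 z) * w z"])
      (use w0 in \<open>auto intro!: ci wirtinger_mult wirtinger_cnj w p\<close>)
  have I2: "(LINT z|disk_measure. cnj (q z) * (q z - d z) + cnj (m z) * w z) = 0"
    by (rule stokes_vanishing_boundary(2)[where w = "\<lambda>z. cnj (q z) * w z"
          and p = "\<lambda>z. cnj (q z) * p z + cnj (q2 z) * w z"])
      (use w0 in \<open>auto intro!: ci wirtinger_mult wirtinger_cnj w q\<close>)
  \<comment> \<open>\<open>cnj d\<close> is holomorphic, so no term with \<open>w\<close> remains\<close>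
  have I3: "(LINT z|disk_measure. cnj (d z) * (q z - d z) + cnj 0 * w z) = 0"
    by (rule stokes_vanishing_boundary(2)[where w = "\<lambda>z. cnj (d z) * w z"
          and p = "\<lambda>z. cnj (d z) * p z + cnj (d2 z) * w z"])
      (use w0 in \<open>auto intro!: ci wirtinger_mult wirtinger_cnj w d simp del: complex_cnj_zero\<close>)
  have wg: "wirtinger (\<lambda>z. w z * g z) (w z * deriv g z + p z * g z) ((q z - d z) * g z) z"
    if "norm z < 1" for z
    using wirtinger_mult[OF w[OF that] g'[OF that]] by simp
  have "(LINT z|disk_measure. (q z - d z) * g z) = 0"
    by (rule stokes_vanishing_boundary(2)[where w = "\<lambda>z. w z * g z"
          and p = "\<lambda>z. w z * deriv g z + p z * g z"])
      (use w0 wg in \<open>auto intro!: ci\<close>)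
  hence "(LINT z|disk_measure. q z * g z - d z * g z) = 0"
    by (simp only: left_diff_distrib)
  hence "(LINT z|disk_measure. q z * g z) = (LINT z|disk_measure. d z * g z)"
    by (subst (asm) Bochner_Integration.integral_diff) (auto intro!: int ci)
  thus "(LINT z|disk_measure. q z * g z) = (LINT z|disk_measure. deriv D (cnj z) * g z)"
    by (simp only: d_def)
  let ?I = "\<lambda>f g. LINT z|disk_measure. cnj (f z) * (g z :: complex)"
  have cc: "?I q d = cnj (?I d q)"
    by (subst Bochner_Integration.integral_cnj[symmetric]) (simp add: mult.commute)
  have "?I p p + ?I m w = 0" using I1 by (subst (asm) Bochner_Integration.integral_add) (auto intro!: int ci)
  moreover have "?I q q - ?I q d + ?I m w = 0"
  proof -
    have "integrable disk_measure (\<lambda>z. cnj (q z) * q z)" "integrable disk_measure (\<lambda>z. cnj (q z) * d z)"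
        "integrable disk_measure (\<lambda>z. cnj (m z) * w z)"
      by (intro int ci)+
    thus ?thesis using I2 by (simp add: right_diff_distrib)
  qed
  moreover have "?I d q - ?I d d = 0"
    using I3 unfolding right_diff_distrib complex_cnj_zero mult_zero_left add_0_right
    by (subst (asm) Bochner_Integration.integral_diff) (auto intro!: int ci)
  ultimately have "?I p p = ?I q q - cnj (?I d d)"
    unfolding cc
  proof -
    have "x = z - cnj v" if "x + y = 0" "z - cnj v' + y = 0" "v' - v = 0" for x y z v v' :: complex
    proof -
      have "y = - x" using that(1) by (simp add: add_eq_0_iff)
      thus ?thesis using that(2,3) by (simp add: algebra_simps)
    qed
    thus "?I p p + ?I m w = 0 \<Longrightarrow> ?I q q - cnj (?I d q) + ?I m w = 0 \<Longrightarrow> ?I d q - ?I d d = 0 \<Longrightarrow>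
        ?I p p = ?I q q - cnj (?I d d)" by blast
  qed
  hence "Re (?I p p) = Re (?I q q) - Re (?I d d)" by simp
  moreover have sq: "?I f f = of_real (LINT z|disk_measure. (norm (f z))\<^sup>2)" for f
  proof -
    have "cnj (f z) * f z = of_real ((norm (f z))\<^sup>2)" for z
      unfolding complex_norm_square by (rule mult.commute)
    thus ?thesis by (simp only: integral_complex_of_real)
  qed
  moreover have "0 \<le> (LINT z|disk_measure. (norm (d z))\<^sup>2)" by simp
  ultimately show "(LINT z|disk_measure. (norm (p z))\<^sup>2) \<le> (LINT z|disk_measure. (norm (q z))\<^sup>2)"
    by (simp only: sq Re_complex_of_real)
qed

section \<open>The Ahlfors-Weill extension\<close>

text \<open>For \<open>f z = z * B (1 / z)\<close> the next three functions are \<open>f' (1 / t)\<close>, \<open>- t\<^bsup>-2\<^esup> (f''/f') (1 / t)\<close> and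
\<open>t\<^bsup>-4\<^esup> S\<^sub>f (1 / t)\<close>.  The cancellations at \<open>t = 0\<close> are carried out in the formulas, so they are
holomorphic at the point that corresponds to infinity.\<close>

definition ext_deriv :: "(complex \<Rightarrow> complex) \<Rightarrow> complex \<Rightarrow> complex" where
  "ext_deriv B t = B t - t * deriv B t"

definition ext_preschwarz :: "(complex \<Rightarrow> complex) \<Rightarrow> complex \<Rightarrow> complex" where
  "ext_preschwarz B t = deriv (ext_deriv B) t / ext_deriv B t"

definition ext_schwarz :: "(complex \<Rightarrow> complex) \<Rightarrow> complex \<Rightarrow> complex" where
  "ext_schwarz B t = deriv (ext_preschwarz B) t - (ext_preschwarz B t)\<^sup>2 / 2
     - 2 * deriv (deriv B) t / ext_deriv B t"

lemma ext_holomorphic: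
  assumes B: "B holomorphic_on ball 0 R" and nz: "\<forall>t\<in>ball 0 R. ext_deriv B t \<noteq> 0"
  shows "deriv B holomorphic_on ball 0 R" "deriv (deriv B) holomorphic_on ball 0 R"
    "ext_deriv B holomorphic_on ball 0 R" "ext_preschwarz B holomorphic_on ball 0 R"
    "deriv (ext_preschwarz B) holomorphic_on ball 0 R" "ext_schwarz B holomorphic_on ball 0 R"
proof -
  show 1: "deriv B holomorphic_on ball 0 R" and 2: "deriv (deriv B) holomorphic_on ball 0 R"
    using B by (auto intro!: holomorphic_intros)
  show 3: "ext_deriv B holomorphic_on ball 0 R"
    unfolding ext_deriv_def[abs_def] by (intro holomorphic_intros B 1)
  show 4: "ext_preschwarz B holomorphic_on ball 0 R"
    unfolding ext_preschwarz_def[abs_def] using nz by (intro holomorphic_intros 3) auto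
  show 5: "deriv (ext_preschwarz B) holomorphic_on ball 0 R" using 4 by (auto intro!: holomorphic_intros)
  show "ext_schwarz B holomorphic_on ball 0 R"
    unfolding ext_schwarz_def[abs_def] using nz by (intro holomorphic_intros 2 3 4 5) auto
qed

lemma deriv_ext_deriv:
  assumes B: "B holomorphic_on ball 0 R" and t: "norm t < R"
  shows "deriv (ext_deriv B) t = - t * deriv (deriv B) t"
proof -
  have "deriv B holomorphic_on ball 0 R" using B by (auto intro!: holomorphic_intros)
  hence "(ext_deriv B has_field_derivative (deriv B t - (1 * deriv B t + deriv (deriv B) t * t))) (at t)"
    unfolding ext_deriv_def[abs_def]
    using t by (intro DERIV_diff DERIV_mult DERIV_ident holomorphic_derivI[OF B] holomorphic_derivI) auto
  thus ?thesis by (simp add: DERIV_imp_deriv mult.commute)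
qed

lemma ext_preschwarz_eq:
  assumes "B holomorphic_on ball 0 R" "norm t < R"
  shows "ext_preschwarz B t = - t * (deriv (deriv B) t / ext_deriv B t)"
  unfolding ext_preschwarz_def deriv_ext_deriv[OF assms] by simp

lemma one_minus_mult_cnj: "1 - z * cnj z = of_real (1 - (norm z)\<^sup>2)"
  by (simp only: of_real_diff of_real_1 complex_norm_square)

text \<open>The radius \<open>R\<close> exceeds 1 in order that the Ahlfors-Weill extension be smooth up to the unit circle.  The number \<open>k\<close>
will bound its Beltrami coefficient.\<close>

locale small_schwarzian =
  fixes B :: "complex \<Rightarrow> complex" and R k :: real
  assumes R: "1 < R"
    and holB: "B holomorphic_on ball 0 R"
    and nz: "\<And>t. norm t < R \<Longrightarrow> ext_deriv B t \<noteq> 0"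
    and k: "k \<le> 1 / 2"
    and bound: "\<And>t. norm t < 1 \<Longrightarrow> (1 - (norm t)\<^sup>2)\<^sup>2 * norm (ext_schwarz B t) \<le> 2 * k"
begin

abbreviation "A \<equiv> ext_deriv B"
abbreviation "a \<equiv> ext_preschwarz B"
abbreviation "S \<equiv> ext_schwarz B"

lemma k_nonneg: "0 \<le> k"
  using bound[of 0] by (smt (verit) norm_ge_zero zero_le_power2 mult_nonneg_nonneg norm_zero zero_less_one)

lemma nz_ball: "\<forall>t\<in>ball 0 R. A t \<noteq> 0"
  using nz by simp

lemmas hol = ext_holomorphic[OF holB nz_ball]
lemmas deriv_A = deriv_ext_deriv[OF holB]
lemmas a_eq = ext_preschwarz_eq[OF holB]

text \<open>The differential equation \<open>p' - p\<^sup>2/2 = S\<^sub>f\<close> for \<open>p = f''/f'\<close>, in the coordinate \<open>t\<close>.\<close>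

lemma riccati: assumes "norm t < R" 
  shows "2 * a t + t * deriv a t = t * (S t + (a t)\<^sup>2 / 2)"
  unfolding ext_schwarz_def using nz[OF assms]
  by (simp add: a_eq[OF assms] algebra_simps)

lemma DERIV_sq_a:
  assumes "norm t < R"
  shows "((\<lambda>t. t\<^sup>2 * a t) has_field_derivative t\<^sup>2 * (S t + (a t)\<^sup>2 / 2)) (at t)"
proof -
  have "((\<lambda>t. t\<^sup>2 * a t) has_field_derivative (2 * t * a t + deriv a t * t\<^sup>2)) (at t)"
    using assms by (auto intro!: derivative_eq_intros holomorphic_derivI[OF hol(4)])
  also have "2 * t * a t + deriv a t * t\<^sup>2 = t * (2 * a t + t * deriv a t)"
    by (simp add: algebra_simps power2_eq_square)
  finally show ?thesis unfolding riccati[OF assms] by (simp add: power2_eq_square mult.assoc)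
qed

text \<open>A continuity argument along a ray.  As long as \<open>(1 - \<bar>t\<bar>\<^sup>2) \<bar>a t\<bar> \<le> 1\<close>, the derivative of \<open>t\<^sup>2 a t\<close> given by the
Riccati equation is at most \<open>\<bar>t\<bar>\<^sup>2 (2 k + 1/2) / (1 - \<bar>t\<bar>\<^sup>2)\<^sup>2\<close>, and integration from 0 gives the better bound 3/4.
Hence the value 1 is never attained.\<close>

lemma preschwarz_bound:
  assumes t: "norm t < 1"
  shows "(1 - (norm t)\<^sup>2) * norm (a t) < 1"
proof (rule ccontr)
  assume neg: "\<not> (1 - (norm t)\<^sup>2) * norm (a t) < 1"
  have a0: "a 0 = 0" using a_eq[of 0] R by simp
  have t0: "t \<noteq> 0" using neg a0 by auto
  define e where "e = sgn t"
  have e: "norm e = 1" using t0 by (simp add: e_def norm_sgn)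
  have te: "t = of_real (norm t) * e" using t0 by (simp add: e_def sgn_eq)
  define y where "y = (\<lambda>s. (1 - s\<^sup>2) * norm (a (of_real s * e)))"
  have nse: "norm (of_real s * e) = \<bar>s\<bar>" for s by (simp add: norm_mult e)
  have cont_a: "continuous_on {0..norm t} (\<lambda>s. a (of_real s * e))"
    by (rule continuous_on_compose2[OF holomorphic_on_imp_continuous_on[OF hol(4)]])
       (use t R in \<open>auto intro!: continuous_intros simp: norm_mult e\<close>)
  have cont_y: "continuous_on {0..norm t} y"
    unfolding y_def by (intro continuous_intros cont_a)
  define X where "X = {s \<in> {0..norm t}. 1 \<le> y s}"
  have "closed X" unfolding X_def
    by (rule continuous_on_closed_Collect_le[OF continuous_on_const cont_y]) simp
  moreover have "y (norm t) = (1 - (norm t)\<^sup>2) * norm (a t)"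
    using te by (simp add: y_def)
  hence "norm t \<in> X"
    using neg unfolding X_def by simp
  moreover have bdX: "bdd_below X" by (auto simp: X_def bdd_below_def)
  ultimately have "Inf X \<in> X" by (intro closed_contains_Inf) auto
  define s where "s = Inf X"
  have s: "0 \<le> s" "s \<le> norm t" "1 \<le> y s" using \<open>Inf X \<in> X\<close> by (auto simp: X_def s_def)
  have below: "y x < 1" if "0 \<le> x" "x < s" for x
  proof (rule ccontr)
    assume "\<not> y x < 1"
    hence "x \<in> X" using that s by (auto simp: X_def)
    hence "s \<le> x" unfolding s_def using bdX by (rule cInf_lower)
    thus False using that by simp
  qed
  have s_pos: "0 < s" using s a0 by (cases "s = 0") (auto simp: y_def)
  have s1: "s < 1" using s t by linarith
  define f where "f = (\<lambda>x. (of_real x * e)\<^sup>2 * a (of_real x * e))"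
  define f' where "f' = (\<lambda>x. e * ((of_real x * e)\<^sup>2 * (S (of_real x * e) + (a (of_real x * e))\<^sup>2 / 2)))"
  \<comment> \<open>\<open>3 / 2\<close> is the value of \<open>2 k + 1 / 2\<close> for \<open>k = 1 / 2\<close>, and one factor \<open>x\<close> of \<open>x\<^sup>2\<close> is bounded by \<open>s\<close>\<close>
  define \<phi> where "\<phi> = (\<lambda>x. s * (3 / 4) / (1 - x\<^sup>2))"
  have "norm (f s - f 0) \<le> \<phi> s - \<phi> 0"
  proof (rule differentiable_bound_general[OF s_pos, where f' = f' and \<phi>' = "\<lambda>x. s * (3 / 2) * x / (1 - x\<^sup>2)\<^sup>2"])
    show "continuous_on {0..s} f" unfolding f_def
      by (intro continuous_intros continuous_on_subset[OF cont_a]) (use s in auto)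
    have ne: "1 - x\<^sup>2 \<noteq> 0" if "0 \<le> x" "x \<le> s" for x
      using that s1 by (smt (verit) power_less_one_iff power_strict_mono zero_less_numeral one_power2)
    show "continuous_on {0..s} \<phi>" unfolding \<phi>_def
      by (intro continuous_intros) (use ne in auto)
    fix x assume x: "0 < x" "x < s"
    have xR: "norm (of_real x * e) < R" using nse x s1 R by simp
    have x1: "norm (of_real x * e) < 1" using nse x s1 by simp
    have "((\<lambda>x. of_real x * e) has_vector_derivative e) (at x)"
      by (auto intro!: derivative_eq_intros simp: has_vector_derivative_def scaleR_conv_of_real fun_eq_iff)
    from field_vector_diff_chain_at[OF this DERIV_sq_a[OF xR]]
    show "(f has_vector_derivative f' x) (at x)"
      by (simp add: f_def f'_def o_def)
    have "(\<phi> has_real_derivative (s * (3 / 2) * x / (1 - x\<^sup>2)\<^sup>2)) (at x)"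
    proof -
      have "((\<lambda>x. c / (1 - x\<^sup>2)) has_real_derivative (c * (2 * x) / (1 - x\<^sup>2)\<^sup>2)) (at x)" for c
        using ne[of x] x by (auto intro!: derivative_eq_intros simp: power2_eq_square)
      from this[of "s * (3 / 4)"] show ?thesis by (simp add: \<phi>_def mult_ac)
    qed
    thus "(\<phi> has_vector_derivative s * (3 / 2) * x / (1 - x\<^sup>2)\<^sup>2) (at x)"
      by (simp add: has_real_derivative_iff_has_vector_derivative)
    have pos: "0 < 1 - x\<^sup>2" using x s1 by (simp add: abs_square_less_1)
    have distr: "(u + v / 2) * q = q * u + (q * v) / 2" for u v q :: real
      by (simp add: algebra_simps)
    have "(1 - x\<^sup>2)\<^sup>2 * norm (S (of_real x * e)) \<le> 1"
      using bound[OF x1] k by (simp add: nse)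
    moreover have "((1 - x\<^sup>2) * norm (a (of_real x * e)))\<^sup>2 \<le> 1"
      using below[of x] x pos unfolding y_def by (intro power_le_one) auto
    ultimately have q: "(1 - x\<^sup>2)\<^sup>2 * norm (S (of_real x * e))
        + ((1 - x\<^sup>2)\<^sup>2 * (norm (a (of_real x * e)))\<^sup>2) / 2 \<le> 3 / 2"
      unfolding power_mult_distrib by linarith
    hence "(norm (S (of_real x * e)) + (norm (a (of_real x * e)))\<^sup>2 / 2) * (1 - x\<^sup>2)\<^sup>2 \<le> 3 / 2"
      unfolding distr .
    hence "norm (S (of_real x * e)) + (norm (a (of_real x * e)))\<^sup>2 / 2 \<le> (3 / 2) / (1 - x\<^sup>2)\<^sup>2"
      using pos by (subst pos_le_divide_eq) auto
    moreover have "norm (S (of_real x * e) + (a (of_real x * e))\<^sup>2 / 2)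
        \<le> norm (S (of_real x * e)) + (norm (a (of_real x * e)))\<^sup>2 / 2"
      by (rule order_trans[OF norm_triangle_ineq]) (simp add: norm_divide norm_power)
    ultimately have "norm (S (of_real x * e) + (a (of_real x * e))\<^sup>2 / 2) \<le> (3 / 2) / (1 - x\<^sup>2)\<^sup>2"
      by linarith
    hence "x\<^sup>2 * norm (S (of_real x * e) + (a (of_real x * e))\<^sup>2 / 2) \<le> (s * x) * ((3 / 2) / (1 - x\<^sup>2)\<^sup>2)"
      using x by (intro mult_mono) (auto simp: power2_eq_square)
    thus "norm (f' x) \<le> s * (3 / 2) * x / (1 - x\<^sup>2)\<^sup>2"
      using nse[of x] x by (simp add: f'_def norm_mult e norm_power mult_ac)
  qed
  hence "s\<^sup>2 * norm (a (of_real s * e)) \<le> s * (3 / 4) / (1 - s\<^sup>2) - s * (3 / 4)"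
    using nse[of s] s_pos by (simp add: f_def \<phi>_def norm_mult norm_power e)
  moreover have pos: "0 < 1 - s\<^sup>2" using s_pos s1 by (simp add: abs_square_less_1)
  ultimately have "(1 - s\<^sup>2) * (s\<^sup>2 * norm (a (of_real s * e))) \<le> (1 - s\<^sup>2) * (s * (3 / 4) / (1 - s\<^sup>2) - s * (3 / 4))"
    by (intro mult_left_mono) auto
  also have "\<dots> = s\<^sup>2 * (3 / 4 * s)" using pos by (simp add: field_simps power2_eq_square)
  finally have "s\<^sup>2 * y s \<le> s\<^sup>2 * (3 / 4 * s)" by (simp add: y_def mult_ac)
  hence "y s \<le> 3 / 4 * s" using s_pos by simp
  thus False using s s1 by linarith
qed

text \<open>With \<open>\<zeta> = 1 / cnj z\<close> the point reflected in the circle, \<open>F\<close> is the Ahlfors-Weill extension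
\<open>F z = f \<zeta> + (z - \<zeta>) f' \<zeta> / (1 - (z - \<zeta>) f'' \<zeta> / (2 f' \<zeta>))\<close>: for fixed \<open>\<zeta>\<close> it is the Moebius map
that agrees with \<open>f\<close> to second order at \<open>\<zeta>\<close>.  It is written in the coordinate \<open>cnj z = 1 / \<zeta>\<close>, in which the
poles at \<open>z = 0\<close> cancel, and \<open>Y\<close> is twice the denominator.  The first derivatives of \<open>F\<close> are \<open>E\<close> and
\<open>\<mu> E\<close>; those of \<open>E\<close> are \<open>Ez\<close> and \<open>Em\<close>.\<close>

definition "Y z = 2 - (1 - z * cnj z) * cnj z * a (cnj z)"
definition "F z = (2 * deriv B (cnj z) + 2 * z * A (cnj z) - (1 - z * cnj z) * a (cnj z) * B (cnj z)) / Y z"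
definition "E z = 4 * A (cnj z) / (Y z)\<^sup>2"
definition "\<mu> z = - 1 / 2 * (1 - z * cnj z)\<^sup>2 * S (cnj z)"
definition "Ez z = - 8 * A (cnj z) * (cnj z)\<^sup>2 * a (cnj z) / (Y z) ^ 3"
definition "Em z = 8 * A (cnj z) * (1 - z * cnj z) * cnj z * S (cnj z) / (Y z) ^ 3"

lemma Y_nz: assumes "norm z \<le> 1" shows "Y z \<noteq> 0"
proof (cases "norm z = 1")
  case True
  thus ?thesis unfolding Y_def one_minus_mult_cnj by simp
next
  case False
  hence z: "norm z < 1" using assms by simp
  have "norm ((1 - z * cnj z) * cnj z * a (cnj z)) = norm z * ((1 - (norm z)\<^sup>2) * norm (a (cnj z)))"
    using z unfolding one_minus_mult_cnj norm_mult norm_of_real by (simp add: abs_square_le_1)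
  also have "\<dots> \<le> 1 * 1"
    using preschwarz_bound[of "cnj z"] z by (intro mult_mono) (auto simp: abs_square_le_1)
  finally have "norm ((1 - z * cnj z) * cnj z * a (cnj z)) \<le> 1" by simp
  thus ?thesis unfolding Y_def by auto
qed

lemma \<mu>_bound: assumes "norm z < 1" shows "norm (\<mu> z) \<le> k"
proof -
  have "norm (\<mu> z) = (1 - (norm z)\<^sup>2)\<^sup>2 * norm (S (cnj z)) / 2"
    unfolding \<mu>_def one_minus_mult_cnj norm_mult norm_power norm_of_real by (simp add: norm_mult norm_power)
  thus ?thesis using bound[of "cnj z"] assms by simp
qed

lemma F_boundary: assumes "norm z = 1" shows "F z = z * B (cnj z)"
proof -
  have "z * cnj z = 1" using complex_norm_square[of z] assms by simp
  hence "z * (cnj z * u) = u" for u by (simp add: mult.assoc[symmetric])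
  thus ?thesis
    unfolding F_def Y_def one_minus_mult_cnj using assms by (simp add: ext_deriv_def algebra_simps)
qed

lemma wirtinger_at_cnj:
  assumes "f holomorphic_on ball 0 R" "norm z < 1"
  shows "wirtinger (\<lambda>z. f (cnj z)) 0 (deriv f (cnj z)) z"
  by (rule wirtinger_holomorphic_cnj[OF assms(1)]) (use assms R in auto)

lemma wirtinger_Y:
  assumes "norm z < 1"
  shows "wirtinger Y ((cnj z)\<^sup>2 * a (cnj z))
    (z * cnj z * a (cnj z) - (1 - z * cnj z) * (a (cnj z) + cnj z * deriv a (cnj z))) z"
  unfolding Y_def[abs_def]
  by (rule wirtinger_cong, (rule wirtinger_mult wirtinger_diff wirtinger_const wirtinger_ident wirtinger_at_cnj[OF hol(4) assms]
       wirtinger_cnj[OF wirtinger_ident])+) (auto simp: algebra_simps power2_eq_square)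

lemma wirtinger_inverse_Y:
  assumes "norm z < 1"
  shows "wirtinger (\<lambda>z. inverse (Y z)) (- ((cnj z)\<^sup>2 * a (cnj z)) / (Y z)\<^sup>2)
    (- (z * cnj z * a (cnj z) - (1 - z * cnj z) * (a (cnj z) + cnj z * deriv a (cnj z))) / (Y z)\<^sup>2) z"
proof -
  have "(inverse has_field_derivative - (inverse (Y z))\<^sup>2) (at (Y z))"
    using Y_nz[of z] assms DERIV_inverse[of "Y z" UNIV] by (simp add: power2_eq_square)
  from wirtinger_chain[of inverse, OF this wirtinger_Y[OF assms]]
  show ?thesis by (rule wirtinger_cong) (simp_all only: divide_inverse power_inverse mult_minus_left mult.commute[of "inverse ((Y z)\<^sup>2)"])
qed

text \<open>The quotient of the derivatives of \<open>F\<close> in \<open>cnj z\<close> and in \<open>z\<close> contains \<open>f\<close> only through its Schwarzian, as the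
Schwarzian measures how far the osculating Moebius map changes with \<open>\<zeta>\<close>; this is the Beltrami equation for \<open>F\<close>.\<close>

lemma wirtinger_F:
  assumes z: "norm z < 1"
  shows "wirtinger F (E z) (\<mu> z * E z) z"
proof -
  define t where "t = cnj z"
  \<comment> \<open>in terms of \<open>b\<close> both claims are identities between rational functions of \<open>z\<close>, \<open>t\<close>, \<open>b\<close>, \<open>B t\<close>, \<open>B' t\<close> and \<open>a' t\<close>\<close>
  define b where "b = deriv (deriv B) t / A t"
  have tR: "norm t < R" using z R by (simp add: t_def)
  have b: "deriv (deriv B) t = b * A t" "a t = - t * b" "deriv A t = - t * (b * A t)"
    using nz[OF tR] a_eq[OF tR] deriv_A[OF tR] by (auto simp: b_def)
  have A: "A t = B t - t * deriv B t" by (simp add: ext_deriv_def)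
  have S: "S t = deriv a t - (t * b)\<^sup>2 / 2 - 2 * b"
    using nz[OF tR] by (simp add: ext_schwarz_def b)
  have F_eq: "F = (\<lambda>z. (2 * deriv B (cnj z) + 2 * z * A (cnj z) - (1 - z * cnj z) * a (cnj z) * B (cnj z)) * inverse (Y z))"
    by (auto simp: F_def divide_inverse)
  have nY: "Y z \<noteq> 0" using Y_nz z by simp
  have Yz: "Y z = 2 + (1 - z * t) * t * t * b" by (simp add: Y_def t_def[symmetric] b algebra_simps)
  show ?thesis unfolding F_eq
  proof (rule wirtinger_cong, (rule wirtinger_mult wirtinger_diff wirtinger_add wirtinger_const wirtinger_ident
        wirtinger_at_cnj[OF hol(4) z] wirtinger_at_cnj[OF hol(3) z] wirtinger_at_cnj[OF hol(1) z] wirtinger_at_cnj[OF holB z]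
        wirtinger_inverse_Y[OF z] wirtinger_cnj[OF wirtinger_ident])+, goal_cases)
    case 1
    show ?case unfolding t_def[symmetric] E_def using nY
      by (simp add: divide_simps b) (simp add: Yz A, algebra)
  next
    case 2
    show ?case unfolding t_def[symmetric] E_def \<mu>_def using nY
      by (simp add: divide_simps b) (simp add: Yz A S, algebra)
  qed
qed

lemma wirtinger_E:
  assumes z: "norm z < 1"
  shows "wirtinger E (Ez z) (Em z) z"
proof -
  define t where "t = cnj z"
  define b where "b = deriv (deriv B) t / A t"
  have tR: "norm t < R" using z R by (simp add: t_def)
  have b: "deriv (deriv B) t = b * A t" "a t = - t * b" "deriv A t = - t * (b * A t)"
    using nz[OF tR] a_eq[OF tR] deriv_A[OF tR] by (auto simp: b_def)
  have S: "S t = deriv a t - (t * b)\<^sup>2 / 2 - 2 * b"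
    using nz[OF tR] by (simp add: ext_schwarz_def b)
  have E_eq: "E = (\<lambda>z. 4 * A (cnj z) * (inverse (Y z)) ^ 2)"
    by (auto simp: E_def divide_inverse power_inverse)
  have nY: "Y z \<noteq> 0" using Y_nz z by simp
  have Yz: "Y z = 2 + (1 - z * t) * t * t * b" by (simp add: Y_def t_def[symmetric] b algebra_simps)
  show ?thesis unfolding E_eq
  proof (rule wirtinger_cong, (rule wirtinger_mult wirtinger_power wirtinger_const wirtinger_at_cnj[OF hol(3) z]
        wirtinger_inverse_Y[OF z])+, goal_cases)
    case 1
    show ?case unfolding t_def[symmetric] Ez_def using nY
      by (simp add: divide_simps b power2_eq_square power3_eq_cube)
  next
    case 2
    show ?case unfolding t_def[symmetric] Em_def using nY
      by (simp add: divide_simps b) (simp add: Yz S, algebra)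
  qed
qed

end

definition disk_norm :: "(complex \<Rightarrow> complex) \<Rightarrow> real" where
  "disk_norm f = sqrt (LINT z|disk_measure. (norm (f z))\<^sup>2)"

lemma disk_norm_nonneg: "0 \<le> disk_norm f"
  by (simp add: disk_norm_def)

lemma disk_Cauchy_Schwarz:
  assumes "continuous_on (cball 0 1) f" "continuous_on (cball 0 1) g"
  shows "norm (LINT z|disk_measure. f z * g z) \<le> disk_norm f * disk_norm g"
  unfolding disk_norm_def
  by (rule integral_Cauchy_Schwarz(2))
     (use assms in \<open>auto intro!: integrable_disk_continuous continuous_intros measurable_disk_continuous
        intro: continuous_on_subset\<close>)

context small_schwarzian
begin

lemma wirtinger_\<mu>:
  assumes z: "norm z < 1"
  shows "wirtinger \<mu> ((1 - z * cnj z) * cnj z * S (cnj z))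
    (z * (1 - z * cnj z) * S (cnj z) - (1 - z * cnj z)\<^sup>2 * deriv S (cnj z) / 2) z"
  unfolding \<mu>_def[abs_def]
  by (rule wirtinger_cong, (rule wirtinger_mult wirtinger_diff wirtinger_power wirtinger_const wirtinger_ident
       wirtinger_at_cnj[OF hol(6) z] wirtinger_cnj[OF wirtinger_ident])+) (auto simp: field_simps power2_eq_square)

text \<open>The mixed second derivative of \<open>F\<close>, computed in the two possible orders.\<close>

lemma Em_eq:
  assumes "norm z < 1"
  shows "Em z = \<mu> z * Ez z + (1 - z * cnj z) * cnj z * S (cnj z) * E z"
proof -
  have nY: "Y z \<noteq> 0" using Y_nz assms by simp
  define x where "x = (1 - z * cnj z) * cnj z"
  have x: "(1 - z * cnj z)\<^sup>2 * (cnj z)\<^sup>2 = x\<^sup>2" by (simp add: x_def power_mult_distrib)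
  have Yx: "Y z = 2 - x * a (cnj z)" by (simp add: Y_def x_def mult.assoc)
  have "\<mu> z * Ez z = 4 * A (cnj z) * x\<^sup>2 * S (cnj z) * a (cnj z) / (Y z) ^ 3"
    unfolding x[symmetric] \<mu>_def Ez_def by (simp add: mult_ac)
  moreover have "x * S (cnj z) * E z = 4 * A (cnj z) * x * S (cnj z) * Y z / (Y z) ^ 3"
    using nY by (simp add: E_def power2_eq_square power3_eq_cube)
  moreover have "Em z = 8 * A (cnj z) * x * S (cnj z) / (Y z) ^ 3"
    by (simp add: Em_def x_def mult_ac)
  ultimately show ?thesis unfolding x_def[symmetric]
    by (simp add: add_divide_distrib[symmetric]) (simp add: Yx algebra_simps power2_eq_square)
qed

lemma continuous_ingredients:
  "continuous_on (cball 0 1) F" "continuous_on (cball 0 1) E" "continuous_on (cball 0 1) \<mu>"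
  "continuous_on (cball 0 1) Ez" "continuous_on (cball 0 1) Em"
  "continuous_on (cball 0 1) (\<lambda>z. S (cnj z))" "continuous_on (cball 0 1) (\<lambda>z. deriv S (cnj z))"
proof -
  note c = continuous_on_holomorphic_cnj(1)[OF _ R]
  have dS: "deriv S holomorphic_on ball 0 R" using hol(6) by (auto intro!: holomorphic_intros)
  note ci = continuous_intros c[OF hol(1)] c[OF hol(3)] c[OF hol(4)] c[OF hol(6)] c[OF holB] c[OF dS]
  show "continuous_on (cball 0 1) (\<lambda>z. S (cnj z))" "continuous_on (cball 0 1) (\<lambda>z. deriv S (cnj z))"
    by (intro ci)+
  have Y: "continuous_on (cball 0 1) Y" unfolding Y_def[abs_def] by (intro ci)
  show "continuous_on (cball 0 1) F" "continuous_on (cball 0 1) E" "continuous_on (cball 0 1) \<mu>"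
    "continuous_on (cball 0 1) Ez" "continuous_on (cball 0 1) Em"
    unfolding F_def[abs_def] E_def[abs_def] \<mu>_def[abs_def] Ez_def[abs_def] Em_def[abs_def]
    by (intro ci Y; use Y_nz in simp)+
qed

text \<open>For \<open>u = G \<circ> F - c\<close> with first derivatives \<open>p\<close> and \<open>q\<close>, the Beltrami equation reads \<open>q = \<mu> (p + c')\<close>.  Together with
\<open>\<parallel>p\<parallel> \<le> \<parallel>q\<parallel>\<close> it yields \<open>\<parallel>q\<parallel>\<^sup>2 \<le> 2 k\<^sup>2 (\<parallel>q\<parallel>\<^sup>2 + \<parallel>c'\<parallel>\<^sup>2)\<close>, which can be
solved for \<open>\<parallel>q\<parallel>\<close> as \<open>k \<le> 1/2\<close>.  The integral of \<open>q g\<close> is determined by \<open>D\<close>, and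
\<open>q - \<mu> c' = \<mu> p\<close> is of second order in \<open>k\<close>.\<close>

lemma reflected_energy_estimate:
  fixes G c D g :: "complex \<Rightarrow> complex"
  assumes G: "G holomorphic_on UNIV" and c: "c holomorphic_on UNIV" and g: "g holomorphic_on UNIV"
    and D: "D holomorphic_on ball 0 R"
    and bdry: "\<And>z. norm z = 1 \<Longrightarrow> G (z * B (cnj z)) = c z + D (cnj z)"
  shows "norm (LINT z|disk_measure. deriv D (cnj z) * g z) \<le> 2 * k * disk_norm (deriv c) * disk_norm g"
    and "norm ((LINT z|disk_measure. deriv D (cnj z) * g z) - (LINT z|disk_measure. \<mu> z * deriv c z * g z))
      \<le> 2 * k\<^sup>2 * disk_norm (deriv c) * disk_norm g"
proof -
  have G': "deriv G holomorphic_on UNIV" "deriv (deriv G) holomorphic_on UNIV"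
    and c': "deriv c holomorphic_on UNIV" "deriv (deriv c) holomorphic_on UNIV"
    using G c by (auto intro!: holomorphic_intros)
  have dG: "(G has_field_derivative deriv G w) (at w)"
      "(deriv G has_field_derivative deriv (deriv G) w) (at w)" for w
    using holomorphic_derivI[OF G] holomorphic_derivI[OF G'(1)] by auto
  have wc: "wirtinger c (deriv c z) 0 z" "wirtinger (deriv c) (deriv (deriv c) z) 0 z" for z
    using wirtinger_chain[OF holomorphic_derivI[OF c open_UNIV UNIV_I] wirtinger_ident, of z]
      wirtinger_chain[OF holomorphic_derivI[OF c'(1) open_UNIV UNIV_I] wirtinger_ident, of z] by auto
  have contU: "continuous_on X h" if "h holomorphic_on UNIV" for h :: "complex \<Rightarrow> complex" and X
    using holomorphic_on_imp_continuous_on[OF that] continuous_on_subset by blast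
  have contF: "continuous_on (cball 0 1) (\<lambda>z. h (F z))" if "h holomorphic_on UNIV" for h
    by (rule continuous_on_compose2[OF contU[OF that] continuous_ingredients(1)]) auto
  define Q where "Q = (\<lambda>z. deriv G (F z) * E z)"
  define Qz where "Qz = (\<lambda>z. deriv G (F z) * Ez z + deriv (deriv G) (F z) * E z * E z)"
  define m where "m = (\<lambda>z. deriv G (F z) * Em z + deriv (deriv G) (F z) * (\<mu> z * E z) * E z)"
  define u where "u = (\<lambda>z. G (F z) - c z)"
  define p where "p = (\<lambda>z. Q z - deriv c z)"
  define q where "q = (\<lambda>z. \<mu> z * Q z)"
  define q2 where "q2 = (\<lambda>z. \<mu> z * m z + (z * (1 - z * cnj z) * S (cnj z) - (1 - z * cnj z)\<^sup>2 * deriv S (cnj z) / 2) * Q z)"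
  define p1 where "p1 = (\<lambda>z. Qz z - deriv (deriv c) z)"
  note ci = continuous_intros continuous_ingredients contF[OF G] contF[OF G'(1)] contF[OF G'(2)]
    contU[OF c] contU[OF c'(1)] contU[OF c'(2)] contU[OF g]
  have cont: "continuous_on (cball 0 1) u" "continuous_on (cball 0 1) p" "continuous_on (cball 0 1) q"
      "continuous_on (cball 0 1) m" "continuous_on (cball 0 1) p1" "continuous_on (cball 0 1) q2"
    unfolding u_def p_def q_def m_def p1_def q2_def Q_def Qz_def by (intro ci; simp)+
  have wQ: "wirtinger Q (Qz z) (m z) z" if z: "norm z < 1" for z
    unfolding Q_def Qz_def m_def
    by (intro wirtinger_mult wirtinger_chain[OF dG(2)] wirtinger_F z wirtinger_E)
  have wu: "wirtinger u (p z) (q z) z" if z: "norm z < 1" for z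
    unfolding u_def p_def q_def Q_def
    by (rule wirtinger_cong, rule wirtinger_diff[OF wirtinger_chain[OF dG(1) wirtinger_F[OF z]] wc(1)]) auto
  have wp: "wirtinger p (p1 z) (m z) z" if z: "norm z < 1" for z
    unfolding p_def p1_def
    by (rule wirtinger_cong, rule wirtinger_diff[OF wQ[OF z] wc(2)]) auto
  have wq: "wirtinger q (m z) (q2 z) z" if z: "norm z < 1" for z
    unfolding q_def q2_def
  proof (rule wirtinger_cong, rule wirtinger_mult[OF wirtinger_\<mu>[OF z] wQ[OF z]])
    show "\<mu> z * Qz z + (1 - z * cnj z) * cnj z * S (cnj z) * Q z = m z"
      unfolding m_def Em_eq[OF z] Qz_def Q_def by (simp add: algebra_simps)
  qed (rule refl)
  have ub: "u z = D (cnj z)" if "norm z = 1" for z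
    using bdry[OF that] F_boundary[OF that] by (simp add: u_def)
  have gR: "g holomorphic_on ball 0 R" using g by (rule holomorphic_on_subset) auto
  note energy = boundary_energy[where u = u and p = p and q = q and m = m and ?p1.0 = p1 and ?q2.0 = q2
      and D = D and g = g and R = R, OF cont wu wp wq R D gR ub]
  have XY: "(LINT z|disk_measure. (norm (p z))\<^sup>2) \<le> (LINT z|disk_measure. (norm (q z))\<^sup>2)"
    by (rule energy(1))
  have Qg: "(LINT z|disk_measure. q z * g z) = (LINT z|disk_measure. deriv D (cnj z) * g z)"
    by (rule energy(2))
  let ?X = "LINT z|disk_measure. (norm (p z))\<^sup>2" and ?Y = "LINT z|disk_measure. (norm (q z))\<^sup>2"
  let ?C = "LINT z|disk_measure. (norm (deriv c z))\<^sup>2"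
  note ii = integrable_disk_continuous ci cont
  have "?Y \<le> (LINT z|disk_measure. 2 * k\<^sup>2 * (norm (p z))\<^sup>2 + 2 * k\<^sup>2 * (norm (deriv c z))\<^sup>2)"
  proof (rule integral_mono)
    fix z assume "z \<in> space disk_measure"
    hence z: "norm z < 1" by simp
    have "norm (q z) = norm (\<mu> z) * norm (p z + deriv c z)" by (simp add: q_def p_def norm_mult)
    also have "\<dots> \<le> k * (norm (p z) + norm (deriv c z))"
      by (intro mult_mono \<mu>_bound z norm_triangle_ineq k_nonneg) auto
    finally have "(norm (q z))\<^sup>2 \<le> (k * (norm (p z) + norm (deriv c z)))\<^sup>2"
      by (rule power_mono) simp
    also have "\<dots> = k\<^sup>2 * (norm (p z) + norm (deriv c z))\<^sup>2" by (rule power_mult_distrib)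
    also have "\<dots> \<le> k\<^sup>2 * (2 * (norm (p z))\<^sup>2 + 2 * (norm (deriv c z))\<^sup>2)"
      using sum_squares_bound[of "norm (p z)" "norm (deriv c z)"]
      by (intro mult_left_mono) (auto simp: power2_sum)
    finally show "(norm (q z))\<^sup>2 \<le> 2 * k\<^sup>2 * (norm (p z))\<^sup>2 + 2 * k\<^sup>2 * (norm (deriv c z))\<^sup>2"
      by (simp add: algebra_simps)
  qed (intro ii)+
  also have "\<dots> = 2 * k\<^sup>2 * ?X + 2 * k\<^sup>2 * ?C"
    by (subst Bochner_Integration.integral_add) (auto intro!: ii simp del: power_mult_distrib)
  also have "2 * k\<^sup>2 * ?X \<le> 1 / 2 * ?Y"
  proof (rule mult_mono)
    have "k\<^sup>2 \<le> (1 / 2)\<^sup>2" using k k_nonneg by (intro power_mono) auto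
    thus "2 * k\<^sup>2 \<le> 1 / 2" by (simp add: power2_eq_square)
  qed (use XY in auto)
  finally have Y: "?Y \<le> (2 * k)\<^sup>2 * ?C" by (simp add: power_mult_distrib)
  have "sqrt ?Y \<le> sqrt ((2 * k)\<^sup>2 * ?C)" using Y by (rule real_sqrt_le_mono)
  hence nq: "disk_norm q \<le> 2 * k * disk_norm (deriv c)"
    using k_nonneg by (simp add: disk_norm_def real_sqrt_mult)
  have "sqrt ?X \<le> sqrt ?Y" using XY by (rule real_sqrt_le_mono)
  hence np: "disk_norm p \<le> 2 * k * disk_norm (deriv c)"
    using nq unfolding disk_norm_def by (rule order_trans)
  have "norm (LINT z|disk_measure. q z * g z) \<le> disk_norm q * disk_norm g"
    by (rule disk_Cauchy_Schwarz) (intro ci cont)+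
  also have "\<dots> \<le> 2 * k * disk_norm (deriv c) * disk_norm g"
    by (intro mult_right_mono nq disk_norm_nonneg)
  finally show "norm (LINT z|disk_measure. deriv D (cnj z) * g z) \<le> 2 * k * disk_norm (deriv c) * disk_norm g"
    unfolding Qg .
  have np': "disk_norm (\<lambda>z. \<mu> z * p z) \<le> k * disk_norm p"
  proof -
    have "(LINT z|disk_measure. (norm (\<mu> z * p z))\<^sup>2) \<le> (LINT z|disk_measure. k\<^sup>2 * (norm (p z))\<^sup>2)"
    proof (rule integral_mono)
      fix z assume "z \<in> space disk_measure"
      hence z: "norm z < 1" by simp
      have "(norm (\<mu> z))\<^sup>2 \<le> k\<^sup>2" by (rule power_mono[OF \<mu>_bound[OF z]]) simp
      thus "(norm (\<mu> z * p z))\<^sup>2 \<le> k\<^sup>2 * (norm (p z))\<^sup>2"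
        unfolding norm_mult power_mult_distrib by (rule mult_right_mono) simp
    qed (intro ii)+
    also have "\<dots> = k\<^sup>2 * ?X" by simp
    finally have "disk_norm (\<lambda>z. \<mu> z * p z) \<le> sqrt (k\<^sup>2 * ?X)"
      unfolding disk_norm_def by (rule real_sqrt_le_mono)
    thus ?thesis using k_nonneg by (simp add: disk_norm_def real_sqrt_mult)
  qed
  have "(LINT z|disk_measure. q z * g z) - (LINT z|disk_measure. \<mu> z * deriv c z * g z)
      = (LINT z|disk_measure. q z * g z - \<mu> z * deriv c z * g z)"
    by (rule Bochner_Integration.integral_diff[symmetric]) (intro ii)+
  also have "\<dots> = (LINT z|disk_measure. (\<mu> z * p z) * g z)"
    by (intro Bochner_Integration.integral_cong) (auto simp: q_def p_def algebra_simps)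
  finally have "norm ((LINT z|disk_measure. q z * g z) - (LINT z|disk_measure. \<mu> z * deriv c z * g z))
      \<le> disk_norm (\<lambda>z. \<mu> z * p z) * disk_norm g"
    by (simp only:) (rule disk_Cauchy_Schwarz; intro ci cont)
  also have "\<dots> \<le> (k * (2 * k * disk_norm (deriv c))) * disk_norm g"
    by (intro mult_right_mono order_trans[OF np'] mult_left_mono np k_nonneg disk_norm_nonneg)
  finally show "norm ((LINT z|disk_measure. deriv D (cnj z) * g z) - (LINT z|disk_measure. \<mu> z * deriv c z * g z))
      \<le> 2 * k\<^sup>2 * disk_norm (deriv c) * disk_norm g"
    unfolding Qg by (simp add: power2_eq_square mult_ac)
qed

end

section \<open>Grunsky coefficients and Faber functions\<close>

lemma holomorphic_sums_fps_expansion: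
  assumes "f holomorphic_on ball 0 1" "norm t < 1"
  shows "(\<lambda>n. fps_nth (fps_expansion f 0) n * t ^ n) sums f t"
  using holomorphic_power_series[OF assms(1), of t] assms(2) by (simp add: fps_expansion_def)

text \<open>A function of the class Sigma in the coordinate at infinity, \<open>f z = z * B (1 / z)\<close>.  The last two assumptions say
that the difference quotient of \<open>f\<close> has no zero, off and on the diagonal.\<close>

locale normalized_univalent =
  fixes B :: "complex \<Rightarrow> complex"
  assumes holB: "B holomorphic_on ball 0 1" and B0: "B 0 = 1"
    and inj: "\<And>s t. norm s < 1 \<Longrightarrow> norm t < 1 \<Longrightarrow> s \<noteq> t \<Longrightarrow> t * B s \<noteq> s * B t"
    and nz: "\<And>t. norm t < 1 \<Longrightarrow> ext_deriv B t \<noteq> 0"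
begin

text \<open>The difference quotient \<open>(f z - f \<zeta>) / (z - \<zeta>)\<close> at \<open>z = 1 / s\<close>, \<open>\<zeta> = 1 / t\<close>, continued to \<open>z = \<zeta>\<close>
and to infinity.\<close>

definition "K s t = (if t = s then ext_deriv B s else (t * B s - s * B t) / (t - s))"

lemma K_eq: "(t - s) * K s t = t * B s - s * B t"
  by (auto simp: K_def)

lemma K_nz: "norm s < 1 \<Longrightarrow> norm t < 1 \<Longrightarrow> K s t \<noteq> 0"
  using inj[of s t] nz[of s] by (auto simp: K_def)

lemma K_0: "norm s < 1 \<Longrightarrow> K s 0 = 1"
  by (auto simp: K_def B0 ext_deriv_def)

lemma K_0_left: "norm t < 1 \<Longrightarrow> K 0 t = 1"
  by (auto simp: K_def B0 ext_deriv_def)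

lemma K_holomorphic: assumes s: "norm s < 1" shows "K s holomorphic_on ball 0 1"
proof -
  define N where "N = (\<lambda>t. t * B s - s * B t)"
  have hN: "N holomorphic_on ball 0 1" unfolding N_def by (intro holomorphic_intros holB)
  have "(N has_field_derivative B s - s * deriv B s) (at s)"
    unfolding N_def using s by (auto intro!: derivative_eq_intros holomorphic_derivI[OF holB])
  hence dN: "deriv N s = ext_deriv B s" by (simp add: DERIV_imp_deriv ext_deriv_def)
  have "(\<lambda>t. if t = s then deriv N s else (N t - N s) / (t - s)) holomorphic_on ball 0 1"
    by (rule pole_lemma_open[OF hN open_ball])
  also have "(\<lambda>t. if t = s then deriv N s else (N t - N s) / (t - s)) = K s"
    by (auto simp: K_def fun_eq_iff dN) (auto simp: N_def)
  finally show ?thesis .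
qed

lemma grunsky_log_exists:
  assumes s: "norm s < 1"
  shows "\<exists>L. L holomorphic_on ball 0 1 \<and> L 0 = 0 \<and> (\<forall>t. norm t < 1 \<longrightarrow> exp (L t) = K s t)"
proof -
  obtain g where g: "g holomorphic_on ball 0 1" "\<And>t. t \<in> ball 0 1 \<Longrightarrow> K s t = exp (g t)"
    using contractible_imp_holomorphic_log[OF K_holomorphic[OF s] convex_imp_contractible[OF convex_ball]] K_nz[OF s]
    by (metis mem_ball_0)
  have "exp (g 0) = 1" using g(2)[of 0] K_0[OF s] by simp
  hence "exp (g t - g 0) = exp (g t)" for t by (simp add: exp_diff)
  thus ?thesis using g by (intro exI[of _ "\<lambda>t. g t - g 0"]) (auto intro!: holomorphic_intros)
qed

text \<open>The branch of the logarithm of the difference quotient that vanishes at \<open>\<zeta> = \<infinity>\<close>.\<close>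

definition "L s = (SOME L. L holomorphic_on ball 0 1 \<and> L 0 = 0 \<and> (\<forall>t. norm t < 1 \<longrightarrow> exp (L t) = K s t))"

lemma L:
  assumes "norm s < 1"
  shows "L s holomorphic_on ball 0 1" "L s 0 = 0" "\<And>t. norm t < 1 \<Longrightarrow> exp (L s t) = K s t"
  using someI_ex[OF grunsky_log_exists[OF assms], folded L_def] by auto

definition "\<beta> = fps_expansion B 0"
definition "\<kappa> s = fps_expansion (K s) 0"
definition "l s = fps_expansion (L s) 0"

lemma expansions:
  "B has_fps_expansion \<beta>"
  "norm s < 1 \<Longrightarrow> K s has_fps_expansion \<kappa> s"
  "norm s < 1 \<Longrightarrow> L s has_fps_expansion l s"
  unfolding \<beta>_def \<kappa>_def l_def
  using has_fps_expansion_fps_expansion[OF open_ball[of 0 1]] holB K_holomorphic L(1) by auto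

lemma constant_terms: "fps_nth \<beta> 0 = 1" "norm s < 1 \<Longrightarrow> fps_nth (\<kappa> s) 0 = 1" "norm s < 1 \<Longrightarrow> fps_nth (l s) 0 = 0"
  by (simp_all add: \<beta>_def \<kappa>_def l_def fps_expansion_def B0 K_0 L)

lemma \<kappa>_eq:
  assumes s: "norm s < 1"
  shows "(fps_X - fps_const s) * \<kappa> s = fps_X * fps_const (B s) - fps_const s * \<beta>"
proof (rule fps_expansion_unique_complex)
  show "(\<lambda>t. (t - s) * K s t) has_fps_expansion (fps_X - fps_const s) * \<kappa> s"
    by (intro fps_expansion_intros expansions s)
  show "(\<lambda>t. (t - s) * K s t) has_fps_expansion fps_X * fps_const (B s) - fps_const s * \<beta>"
    unfolding K_eq by (intro fps_expansion_intros expansions)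
qed

lemma deriv_K_L:
  assumes s: "norm s < 1" and t: "norm t < 1"
  shows "deriv (K s) t = deriv (L s) t * K s t"
proof -
  have d: "((\<lambda>t. exp (L s t)) has_field_derivative exp (L s t) * deriv (L s) t) (at t)"
    using t by (auto intro!: derivative_eq_intros holomorphic_derivI[OF L(1)[OF s]])
  have ev: "\<forall>\<^sub>F t in nhds t. exp (L s t) = K s t"
    using t by (intro eventually_nhds_in_open[of "ball 0 1", THEN eventually_mono]) (auto simp: L(3)[OF s])
  from DERIV_cong_ev[OF refl ev refl, THEN iffD1, OF d]
  have "(K s has_field_derivative exp (L s t) * deriv (L s) t) (at t)"
    by simp
  thus ?thesis using L(3)[OF s t] by (simp add: DERIV_imp_deriv)
qed

lemma \<kappa>_deriv:
  assumes s: "norm s < 1"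
  shows "fps_deriv (\<kappa> s) = fps_deriv (l s) * \<kappa> s"
proof (rule fps_expansion_unique_complex)
  show "deriv (K s) has_fps_expansion fps_deriv (\<kappa> s)"
    by (intro fps_expansion_intros expansions s)
  have e: "(\<lambda>t. deriv (L s) t * K s t) has_fps_expansion fps_deriv (l s) * \<kappa> s"
    by (intro fps_expansion_intros expansions s)
  have ev: "\<forall>\<^sub>F t in nhds 0. deriv (L s) t * K s t = deriv (K s) t"
    by (rule eventually_mono[OF eventually_nhds_in_open[of "ball 0 1"]]) (auto simp: deriv_K_L[OF s])
  show "deriv (K s) has_fps_expansion fps_deriv (l s) * \<kappa> s"
    by (rule has_fps_expansion_cong[OF ev refl, THEN iffD1, OF e])
qed

text \<open>The Taylor coefficients of \<open>K s\<close> are expressed by these remainders of the series of \<open>B\<close>, which shows that they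
depend holomorphically on \<open>s\<close>.\<close>

definition "tail j s = (\<Sum>i. fps_nth \<beta> (i + j) * s ^ i)"

lemma tail_sums: assumes s: "norm s < 1" shows "(\<lambda>i. fps_nth \<beta> (i + j) * s ^ i) sums tail j s"
proof (cases "s = 0")
  case True
  show ?thesis unfolding tail_def True by (intro summable_sums summable_finite[of "{0}"]) auto
next
  case False
  have "summable (\<lambda>n. fps_nth \<beta> n * s ^ n)"
    using holomorphic_sums_fps_expansion[OF holB s] by (simp add: \<beta>_def sums_iff)
  hence "summable (\<lambda>i. fps_nth \<beta> (i + j) * s ^ (i + j) * inverse (s ^ j))"
    by (intro summable_mult2) (subst summable_iff_shift)
  also have "(\<lambda>i. fps_nth \<beta> (i + j) * s ^ (i + j) * inverse (s ^ j)) = (\<lambda>i. fps_nth \<beta> (i + j) * s ^ i)"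
    using False by (auto simp: power_add)
  finally show ?thesis unfolding tail_def by (rule summable_sums)
qed

lemma tail_holomorphic: "tail j holomorphic_on ball 0 1"
  by (rule power_series_holomorphic[of _ _ "\<lambda>i. fps_nth \<beta> (i + j)"]) (use tail_sums in auto)

lemma tail_step: assumes s: "norm s < 1" shows "tail j s = fps_nth \<beta> j + s * tail (Suc j) s"
proof -
  have "(\<lambda>i. s * (fps_nth \<beta> (i + Suc j) * s ^ i)) sums (s * tail (Suc j) s)"
    by (rule sums_mult[OF tail_sums[OF s]])
  hence "(\<lambda>i. fps_nth \<beta> (Suc i + j) * s ^ Suc i) sums (s * tail (Suc j) s)"
    by (simp add: mult_ac)
  hence "(\<lambda>i. fps_nth \<beta> (i + j) * s ^ i) sums (s * tail (Suc j) s + fps_nth \<beta> (0 + j) * s ^ 0)"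
    by (rule sums_Suc)
  with tail_sums[OF s, of j] show ?thesis by (simp add: sums_iff)
qed

lemma tail_0: "norm s < 1 \<Longrightarrow> tail 0 s = B s"
  using holomorphic_sums_fps_expansion[OF holB, of s] by (simp add: tail_def \<beta>_def sums_iff)

text \<open>Comparison of coefficients in \<open>\<kappa>_eq\<close> determines the coefficients recursively for \<open>s \<noteq> 0\<close>.  For \<open>s = 0\<close> the
recursion degenerates, but \<open>K 0\<close> is identically 1.\<close>

lemma \<kappa>_nth:
  assumes s: "norm s < 1"
  shows "fps_nth (\<kappa> s) (Suc n) = - s * tail (Suc (Suc n)) s"
proof (cases "s = 0")
  case True
  have "\<kappa> s = 1"
  proof (rule fps_expansion_unique_complex[OF expansions(2)[OF s]])
    have ev: "\<forall>\<^sub>F t in nhds 0. 1 = K s t"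
      by (rule eventually_mono[OF eventually_nhds_in_open[of "ball 0 1"]]) (auto simp: K_0_left True)
    show "K s has_fps_expansion 1"
      by (rule has_fps_expansion_cong[OF ev refl, THEN iffD1, OF has_fps_expansion_1])
  qed
  thus ?thesis by (simp add: True)
next
  case False
  have rec: "s * fps_nth (\<kappa> s) (Suc m) = fps_nth (\<kappa> s) m + s * fps_nth \<beta> (Suc m) - (if m = 0 then B s else 0)" for m
    using arg_cong[OF \<kappa>_eq[OF s], of "\<lambda>F. fps_nth F (Suc m)"]
    by (simp add: left_diff_distrib algebra_simps split: if_splits)
  have t0: "B s = 1 + s * (fps_nth \<beta> 1 + s * tail (Suc (Suc 0)) s)"
    using tail_step[OF s, of 0] tail_step[OF s, of 1] constant_terms by (simp add: tail_0 s)
  show ?thesis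
  proof (induction n)
    case 0
    have "s * fps_nth (\<kappa> s) (Suc 0) = s * (- s * tail (Suc (Suc 0)) s)"
      using rec[of 0] t0 by (simp add: constant_terms s algebra_simps)
    thus ?case using False by (simp only: mult_cancel_left) simp
  next
    case (Suc n)
    have "s * fps_nth (\<kappa> s) (Suc (Suc n)) = s * (- s * tail (Suc (Suc (Suc n))) s)"
      using rec[of "Suc n"] Suc tail_step[OF s, of "Suc (Suc n)"] by (simp add: algebra_simps)
    thus ?case using False by (simp only: mult_cancel_left) simp
  qed
qed

lemma \<kappa>_nth_holomorphic: "(\<lambda>s. fps_nth (\<kappa> s) n) holomorphic_on ball 0 1"
proof (cases n)
  case 0
  show ?thesis by (rule holomorphic_transform[of "\<lambda>_. 1"]) (auto simp: 0 constant_terms)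
next
  case (Suc m)
  show ?thesis
    by (rule holomorphic_transform[of "\<lambda>s. - s * tail (Suc (Suc m)) s"])
       (auto simp: Suc \<kappa>_nth intro!: holomorphic_intros tail_holomorphic)
qed

text \<open>The recursion for the coefficients of a logarithm, from \<open>K' = L' K\<close>.\<close>

lemma l_rec:
  assumes s: "norm s < 1"
  shows "of_nat (Suc n) * fps_nth (l s) (Suc n) = of_nat (Suc n) * fps_nth (\<kappa> s) (Suc n)
      - (\<Sum>i<n. of_nat (Suc i) * fps_nth (l s) (Suc i) * fps_nth (\<kappa> s) (n - i))"
proof -
  have "of_nat (Suc n) * fps_nth (\<kappa> s) (Suc n) = fps_nth (fps_deriv (\<kappa> s)) n"
    by simp
  also have "\<dots> = (\<Sum>i\<le>n. of_nat (Suc i) * fps_nth (l s) (Suc i) * fps_nth (\<kappa> s) (n - i))"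
    unfolding \<kappa>_deriv[OF s] by (simp add: fps_mult_nth atLeast0AtMost)
  also have "\<dots> = (\<Sum>i<n. of_nat (Suc i) * fps_nth (l s) (Suc i) * fps_nth (\<kappa> s) (n - i))
      + of_nat (Suc n) * fps_nth (l s) (Suc n)"
    by (simp add: lessThan_Suc_atMost[symmetric] constant_terms s del: of_nat_Suc)
  finally show ?thesis by simp
qed

lemma l_nth_holomorphic: "(\<lambda>s. fps_nth (l s) n) holomorphic_on ball 0 1 \<and> fps_nth (l 0) n = 0"
proof (induction n rule: less_induct)
  case (less n)
  show ?case
  proof (cases n)
    case 0
    have "(\<lambda>s. fps_nth (l s) 0) holomorphic_on ball 0 1"
      by (rule holomorphic_transform[of "\<lambda>_. 0"]) (auto simp: constant_terms)
    thus ?thesis by (simp add: 0 constant_terms)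
  next
    case (Suc m)
    define h where "h = (\<lambda>s. (of_nat (Suc m) * fps_nth (\<kappa> s) (Suc m)
      - (\<Sum>i<m. of_nat (Suc i) * fps_nth (l s) (Suc i) * fps_nth (\<kappa> s) (m - i))) / of_nat (Suc m))"
    have h: "fps_nth (l s) n = h s" if "norm s < 1" for s
      using l_rec[OF that, of m] unfolding h_def Suc by (simp add: nonzero_eq_divide_eq mult.commute del: of_nat_Suc)
    have "h holomorphic_on ball 0 1"
      unfolding h_def
      by (intro holomorphic_intros \<kappa>_nth_holomorphic less[THEN conjunct1]) (auto simp: Suc simp del: of_nat_Suc)
    hence "(\<lambda>s. fps_nth (l s) n) holomorphic_on ball 0 1"
      by (rule holomorphic_transform) (auto simp: h)
    moreover have "h 0 = 0"
      unfolding h_def by (auto simp: \<kappa>_nth Suc less[THEN conjunct2] intro!: sum.neutral)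
    ultimately show ?thesis using h[of 0] by simp
  qed
qed

text \<open>The series on the left is \<open>1 / (1 - t/s) - t L'(t)\<close>.  Logarithmic differentiation of
\<open>(1 - t/s) K(t) = B(t) - w t\<close>, where \<open>w = B s / s = f (1 / s)\<close>, shows that it equals
\<open>(B(t) - t B'(t)) / (B(t) - w t)\<close>, the generating function of the Faber polynomials at \<open>w\<close>.\<close>

lemma faber_fps:
  assumes s: "norm s < 1" "s \<noteq> 0"
  defines "\<Gamma> \<equiv> Abs_fps (\<lambda>n. (1 / s) ^ n - of_nat n * fps_nth (l s) n)"
  shows "\<Gamma> * (\<beta> - fps_const (B s / s) * fps_X) = \<beta> - fps_X * fps_deriv \<beta>"
proof -
  define M where "M = 1 - fps_const (1 / s) * fps_X"
  have "fps_const (- (1 / s)) * ((fps_X - fps_const s) * \<kappa> s)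
      = fps_const (- (1 / s)) * (fps_X * fps_const (B s) - fps_const s * \<beta>)"
    unfolding \<kappa>_eq[OF s(1)] ..
  moreover have "fps_const (- (1 / s)) * (fps_X - fps_const s) = M"
    using s by (simp add: M_def right_diff_distrib fps_const_neg[symmetric] del: fps_const_neg)
  moreover have "fps_const (- (1 / s)) * (fps_X * fps_const (B s) - fps_const s * \<beta>) = \<beta> - fps_const (B s / s) * fps_X"
  proof -
    have "fps_const (- (1 / s)) * (fps_const s * \<beta>) = - \<beta>"
      using s by (simp add: mult.assoc[symmetric] fps_const_neg[symmetric] del: fps_const_neg)
    moreover have "fps_const (- (1 / s)) * (fps_X * fps_const (B s)) = - (fps_const (B s / s) * fps_X)"
      by (simp add: mult_ac fps_const_neg[symmetric] del: fps_const_neg)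
    ultimately show ?thesis by (simp add: right_diff_distrib)
  qed
  ultimately have N: "\<beta> - fps_const (B s / s) * fps_X = M * \<kappa> s"
    by (metis mult.assoc)
  have geo: "Abs_fps (\<lambda>n. (1 / s) ^ n) * M = 1"
  proof (rule fps_ext)
    fix n show "fps_nth (Abs_fps (\<lambda>n. (1 / s) ^ n) * M) n = fps_nth 1 n"
      unfolding M_def right_diff_distrib by (cases n) (auto simp: mult_ac)
  qed
  have \<Gamma>: "\<Gamma> = Abs_fps (\<lambda>n. (1 / s) ^ n) - fps_X * fps_deriv (l s)"
    unfolding \<Gamma>_def by (rule fps_ext) (auto simp: fps_X_mult_nth gr0_conv_Suc split: nat.splits)
  have dM: "fps_deriv M = - fps_const (1 / s)" by (simp add: M_def)
  have "\<Gamma> * (M * \<kappa> s) = (Abs_fps (\<lambda>n. (1 / s) ^ n) * M) * \<kappa> s - fps_X * (fps_deriv (l s) * \<kappa> s) * M"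
    unfolding \<Gamma> by (simp add: algebra_simps)
  also have "\<dots> = \<kappa> s - fps_X * fps_deriv (\<kappa> s) * M" unfolding geo \<kappa>_deriv[OF s(1)] by simp
  also have "\<dots> = M * \<kappa> s - fps_X * fps_deriv (M * \<kappa> s)"
  proof -
    define C where "C = fps_const (1 / s)"
    have "fps_deriv (M * \<kappa> s) = M * fps_deriv (\<kappa> s) - C * \<kappa> s"
      by (simp add: dM C_def fps_const_neg[symmetric] del: fps_const_neg)
    thus ?thesis by (simp add: M_def C_def[symmetric] algebra_simps)
  qed
  also have "\<dots> = (\<beta> - fps_const (B s / s) * fps_X) - fps_X * (fps_deriv \<beta> - fps_const (B s / s))"
    unfolding N[symmetric] by simp
  also have "\<dots> = \<beta> - fps_X * fps_deriv \<beta>" by (simp add: algebra_simps)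
  finally show ?thesis unfolding N .
qed

text \<open>Comparison of coefficients in \<open>faber_fps\<close> expresses the \<open>n\<close>-th Faber polynomial by the earlier ones.\<close>

lemma faber_exists:
  "\<exists>P. P holomorphic_on UNIV \<and> (\<forall>s. norm s < 1 \<longrightarrow> s \<noteq> 0 \<longrightarrow> P (B s / s) = (1 / s) ^ n - of_nat n * fps_nth (l s) n)"
proof (induction n rule: less_induct)
  case (less n)
  then obtain P where P: "\<And>i. i < n \<Longrightarrow> P i holomorphic_on UNIV"
    "\<And>i s. i < n \<Longrightarrow> norm s < 1 \<Longrightarrow> s \<noteq> 0 \<Longrightarrow> P i (B s / s) = (1 / s) ^ i - of_nat i * fps_nth (l s) i"
    by metis
  define Q where "Q = (\<lambda>w. (1 - of_nat n) * fps_nth \<beta> n + (if n = 0 then 0 else w * P (n - 1) w)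
      - (\<Sum>i<n. P i w * fps_nth \<beta> (n - i)))"
  have "Q holomorphic_on UNIV"
    unfolding Q_def by (cases "n = 0") (auto intro!: holomorphic_intros P(1))
  moreover have "Q (B s / s) = (1 / s) ^ n - of_nat n * fps_nth (l s) n" if s: "norm s < 1" "s \<noteq> 0" for s
  proof -
    define \<Gamma> where "\<Gamma> = Abs_fps (\<lambda>n. (1 / s) ^ n - of_nat n * fps_nth (l s) n)"
    have \<Gamma>P: "fps_nth \<Gamma> i = P i (B s / s)" if "i < n" for i
      using P(2)[OF that s] by (simp add: \<Gamma>_def)
    have "\<Gamma> * \<beta> - fps_const (B s / s) * (\<Gamma> * fps_X) = \<beta> - fps_X * fps_deriv \<beta>"
      using faber_fps[OF s, folded \<Gamma>_def] by (simp only: right_diff_distrib mult.left_commute[of \<Gamma>])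
    from arg_cong[OF this, of "\<lambda>F. fps_nth F n"]
    have "fps_nth (\<Gamma> * \<beta>) n - (if n = 0 then 0 else B s / s * fps_nth \<Gamma> (n - 1)) = (1 - of_nat n) * fps_nth \<beta> n"
      by (cases n) (auto simp: algebra_simps)
    moreover have "fps_nth (\<Gamma> * \<beta>) n = (\<Sum>i<n. fps_nth \<Gamma> i * fps_nth \<beta> (n - i)) + fps_nth \<Gamma> n"
      by (simp add: fps_mult_nth atLeast0AtMost lessThan_Suc_atMost[symmetric] constant_terms)
    moreover have "(\<Sum>i<n. fps_nth \<Gamma> i * fps_nth \<beta> (n - i)) = (\<Sum>i<n. P i (B s / s) * fps_nth \<beta> (n - i))"
      by (intro sum.cong) (auto simp: \<Gamma>P)
    ultimately have "fps_nth \<Gamma> n = Q (B s / s)"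
      unfolding Q_def using \<Gamma>P[of "n - 1"] by (auto simp: algebra_simps)
    thus ?thesis by (simp add: \<Gamma>_def)
  qed
  ultimately show ?case by blast
qed

text \<open>The sign is that of the definition of the Grunsky coefficients; \<open>m\<close> belongs to the variable \<open>s = 1 / z\<close> and \<open>n\<close> to
\<open>t = 1 / \<zeta>\<close>.\<close>

definition "\<alpha> m n = - fps_nth (fps_expansion (\<lambda>s. fps_nth (l s) n) 0) m"

lemma \<alpha>_0: "\<alpha> 0 n = 0" "\<alpha> m 0 = 0"
proof -
  show "\<alpha> 0 n = 0" using l_nth_holomorphic[of n] by (simp add: \<alpha>_def fps_expansion_def)
  have "fps_expansion (\<lambda>s. fps_nth (l s) 0) 0 = fps_expansion (\<lambda>_. 0) 0"
    by (rule fps_expansion_cong, rule eventually_mono[OF eventually_nhds_in_open[of "ball 0 1"]]) (auto simp: constant_terms)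
  also have "\<dots> = 0" by (rule fps_expansion_eqI) simp
  finally show "\<alpha> m 0 = 0" by (simp add: \<alpha>_def)
qed

lemma \<alpha>_sums: assumes "norm s < 1" shows "(\<lambda>m. \<alpha> m n * s ^ m) sums (- fps_nth (l s) n)"
  using sums_minus[OF holomorphic_sums_fps_expansion[OF l_nth_holomorphic[THEN conjunct1] assms, of n]]
  by (simp add: \<alpha>_def)

lemma l_sums: assumes "norm s < 1" "norm t < 1" shows "(\<lambda>n. fps_nth (l s) n * t ^ n) sums L s t"
  unfolding l_def by (rule holomorphic_sums_fps_expansion[OF L(1)[OF assms(1)] assms(2)])

end

section \<open>The Grunsky form on finite sequences\<close>

lemma deriv_scaled:
  assumes "g holomorphic_on ball 0 1" "norm (c * t) < 1"
  shows "((\<lambda>t. g (c * t)) has_field_derivative c * deriv g (c * t)) (at t)"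
    "deriv (\<lambda>t. g (c * t)) t = c * deriv g (c * t)"
proof -
  have "(g has_field_derivative deriv g (c * t)) (at (c * t))"
    using assms by (intro holomorphic_derivI) auto
  moreover have "((\<lambda>t. c * t) has_field_derivative c) (at t)"
    by (auto intro!: derivative_eq_intros)
  ultimately have "((\<lambda>t. g (c * t)) has_field_derivative deriv g (c * t) * c) (at t)"
    by (rule DERIV_chain2)
  thus d: "((\<lambda>t. g (c * t)) has_field_derivative c * deriv g (c * t)) (at t)"
    by (simp only: mult.commute[of c])
  thus "deriv (\<lambda>t. g (c * t)) t = c * deriv g (c * t)" by (rule DERIV_imp_deriv)
qed

lemma summable_norm_coeffs:
  assumes R: "1 < R" and D: "\<And>t. norm t < R \<Longrightarrow> (\<lambda>m. d m * t ^ m) sums (D t :: complex)"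
  shows "summable (\<lambda>m. norm (d m))"
proof -
  have "summable (\<lambda>m. norm (d m * 1 ^ m))"
  proof (rule powser_insidea)
    have n: "norm (complex_of_real ((1 + R) / 2)) = (1 + R) / 2"
      unfolding norm_of_real using R by simp
    show "summable (\<lambda>m. d m * of_real ((1 + R) / 2) ^ m)"
      using D[of "of_real ((1 + R) / 2)"] R unfolding n by (simp add: sums_iff)
    show "norm (1 :: complex) < norm (complex_of_real ((1 + R) / 2))"
      unfolding n using R by simp
  qed
  thus ?thesis by simp
qed

lemma disk_integral_cnj_series:
  assumes R: "1 < R" and D: "\<And>t. norm t < R \<Longrightarrow> (\<lambda>m. d m * t ^ m) sums (D t :: complex)"
  shows "(LINT z|disk_measure. D (cnj z) * z ^ j) = d j * (of_real pi / of_nat (Suc j))"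
proof -
  have s: "summable (\<lambda>m. norm (cnj (d m)))" using summable_norm_coeffs[OF R D] by simp
  have "(LINT z|disk_measure. D (cnj z) * z ^ j) = (LINT z|disk_measure. cnj ((\<Sum>n. cnj (d n) * z ^ n) * cnj z ^ j))"
  proof (rule Bochner_Integration.integral_cong[OF refl])
    fix z assume "z \<in> space disk_measure"
    hence "norm (cnj z) < R" using R by simp
    from D[OF this] have "(\<lambda>n. cnj (d n * cnj z ^ n)) sums cnj (D (cnj z))" by (simp only: sums_cnj)
    thus "D (cnj z) * z ^ j = cnj ((\<Sum>n. cnj (d n) * z ^ n) * cnj z ^ j)"
      by (simp add: sums_iff)
  qed
  also have "\<dots> = cnj (cnj (d j) * (of_real pi / of_nat (Suc j)))"
    unfolding Bochner_Integration.integral_cnj disk_coefficient_integral[OF s] ..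
  finally show ?thesis by simp
qed

lemma disk_integral_deriv_cnj:
  assumes R: "1 < R" and D: "\<And>t. norm t < R \<Longrightarrow> (\<lambda>m. d m * t ^ m) sums (D t :: complex)"
  shows "(LINT z|disk_measure. deriv D (cnj z) * z ^ j) = of_real pi * d (Suc j)"
proof -
  have D': "(\<lambda>m. diffs d m * t ^ m) sums deriv D t" if t: "norm t < R" for t
  proof -
    obtain t' where t': "norm t < norm t'" "norm (t' :: complex) < R"
    proof
      have "norm (complex_of_real ((norm t + R) / 2)) = (norm t + R) / 2"
        unfolding norm_of_real using R by (simp add: add_nonneg_pos less_imp_le)
      thus "norm t < norm (complex_of_real ((norm t + R) / 2))" "norm (complex_of_real ((norm t + R) / 2)) < R"
        using t by auto
    qed
    have s: "summable (\<lambda>m. d m * t' ^ m)" using D[OF t'(2)] by (rule sums_summable)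
    have "((\<lambda>t. \<Sum>m. d m * t ^ m) has_field_derivative (\<Sum>m. diffs d m * t ^ m)) (at t)"
      by (rule termdiffs_strong[OF s t'(1)])
    moreover have ev: "\<forall>\<^sub>F t in nhds t. (\<Sum>m. d m * t ^ m) = D t"
      by (rule eventually_mono[OF eventually_nhds_in_open[of "ball 0 R"]]) (use D t in \<open>auto simp: sums_iff\<close>)
    ultimately have "(D has_field_derivative (\<Sum>m. diffs d m * t ^ m)) (at t)"
      using DERIV_cong_ev[OF refl ev refl] by simp
    hence "deriv D t = (\<Sum>m. diffs d m * t ^ m)" by (rule DERIV_imp_deriv)
    moreover have "summable (\<lambda>m. diffs d m * t ^ m)"
      by (rule termdiff_converges[where K = R]) (use t D in \<open>auto simp: sums_iff\<close>)
    ultimately show ?thesis by (simp add: sums_iff)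
  qed
  show ?thesis
    using disk_integral_cnj_series[OF R D', of j] by (simp add: diffs_def del: of_nat_Suc)
qed

text \<open>The functions \<open>sqrt (n / \<pi>) z\<^bsup>n-1\<^esup>\<close>, \<open>n \<ge> 1\<close>, form an orthonormal basis of the square integrable holomorphic
functions on the disk.\<close>

definition bergman_sum :: "nat \<Rightarrow> (nat \<Rightarrow> complex) \<Rightarrow> complex \<Rightarrow> complex" where
  "bergman_sum N x z = (\<Sum>n\<in>{1..N}. of_real (sqrt (real n / pi)) * x n * z ^ (n - 1))"

lemma disk_norm_bergman_sum:
  "disk_norm (bergman_sum N x) = sqrt (\<Sum>n\<in>{1..N}. (norm (x n))\<^sup>2)"
proof -
  define a where "a = (\<lambda>n. if n < N then of_real (sqrt (real (Suc n) / pi)) * x (Suc n) else 0)"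
  have eq: "(\<Sum>n. a n * z ^ n) = bergman_sum N x z" for z
  proof -
    have "(\<Sum>n. a n * z ^ n) = (\<Sum>n<N. a n * z ^ n)" by (rule suminf_finite) (auto simp: a_def)
    also have "\<dots> = (\<Sum>n<N. of_real (sqrt (real (Suc n) / pi)) * x (Suc n) * z ^ (Suc n - 1))"
      by (intro sum.cong) (auto simp: a_def)
    also have "\<dots> = bergman_sum N x z"
      unfolding bergman_sum_def by (rule sum.reindex_bij_witness[of _ "\<lambda>n. n - 1" Suc]) auto
    finally show ?thesis .
  qed
  have s1: "(\<lambda>n. pi * (norm (a n))\<^sup>2 / Suc n) sums (LINT z|disk_measure. (norm (\<Sum>n. a n * z ^ n))\<^sup>2)"
    by (rule disk_parseval, rule summable_finite[of "{..<N}"]) (auto simp: a_def)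
  have eq2: "(\<lambda>n. pi * (norm (a n))\<^sup>2 / Suc n) = (\<lambda>n. if n < N then (norm (x (Suc n)))\<^sup>2 else 0)"
    by (auto simp: a_def norm_mult power_mult_distrib fun_eq_iff simp del: of_nat_Suc)
  have s2: "(\<lambda>n. if n < N then (norm (x (Suc n)))\<^sup>2 else 0) sums (\<Sum>n<N. (norm (x (Suc n)))\<^sup>2)"
    using sums_If_finite_set[of "{..<N}" "\<lambda>n. (norm (x (Suc n)))\<^sup>2"] by simp
  have "(LINT z|disk_measure. (norm (\<Sum>n. a n * z ^ n))\<^sup>2) = (\<Sum>n<N. (norm (x (Suc n)))\<^sup>2)"
    by (rule sums_unique2[OF s1[unfolded eq2] s2])
  also have "\<dots> = (\<Sum>n\<in>{1..N}. (norm (x n))\<^sup>2)"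
    by (rule sum.reindex_bij_witness[of _ "\<lambda>n. n - 1" Suc]) auto
  finally show ?thesis unfolding disk_norm_def eq by simp
qed

locale small_univalent = normalized_univalent +
  fixes k :: real
  assumes k: "k \<le> 1 / 2"
    and bound: "\<And>t. norm t < 1 \<Longrightarrow> (1 - (norm t)\<^sup>2)\<^sup>2 * norm (ext_schwarz B t) \<le> 2 * k"
begin

lemma nz_ball: "\<forall>t\<in>ball 0 1. ext_deriv B t \<noteq> 0"
  using nz by simp

lemmas base_holomorphic = ext_holomorphic[OF holB nz_ball]

text \<open>This replaces \<open>f z\<close> by \<open>r f (z / r)\<close>, which is univalent in \<open>\<bar>z\<bar> > r\<close>.\<close>

definition "dilated r = (\<lambda>t. B (of_real r * t))"

context
  fixes r :: real
  assumes r: "0 < r" "r < 1"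
begin

lemma scaled_ball: "norm t < 1 / r \<Longrightarrow> norm (complex_of_real r * t) < 1"
  using r by (simp add: norm_mult field_simps)

lemma scaled_holomorphic:
  "g holomorphic_on ball 0 1 \<Longrightarrow> (\<lambda>t. g (of_real r * t)) holomorphic_on ball 0 (1 / r)"
  by (rule holomorphic_on_compose_gen[where g = g and t = "ball 0 1", unfolded o_def])
     (use scaled_ball in \<open>auto intro!: holomorphic_intros\<close>)

lemma deriv_scaled_ev:
  assumes "g holomorphic_on ball 0 1" "norm t < 1 / r"
    and "\<And>t. norm t < 1 / r \<Longrightarrow> h t = c * g (of_real r * t)"
  shows "deriv h t = c * of_real r * deriv g (of_real r * t)"
proof -
  have "deriv h t = deriv (\<lambda>t. c * g (of_real r * t)) t"
    by (rule deriv_cong_ev[OF eventually_mono[OF eventually_nhds_in_open[of "ball 0 (1 / r)"]] refl])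
       (use assms in auto)
  also have "\<dots> = c * of_real r * deriv g (of_real r * t)"
    using DERIV_cmult[OF deriv_scaled(1)[OF assms(1) scaled_ball[OF assms(2)]], of c]
    by (simp add: DERIV_imp_deriv mult.assoc)
  finally show ?thesis .
qed

lemma scaled_schwarzian:
  assumes t: "norm t < 1 / r"
  shows "ext_deriv (dilated r) t = ext_deriv B (of_real r * t)"
    and "ext_schwarz (dilated r) t = of_real (r\<^sup>2) * ext_schwarz B (of_real r * t)"
proof -
  have 1: "deriv (dilated r) t = of_real r * deriv B (of_real r * t)" if "norm t < 1 / r" for t
    using deriv_scaled_ev[OF holB that, of "dilated r" 1] by (simp add: dilated_def)
  have 2: "deriv (deriv (dilated r)) t = of_real r * of_real r * deriv (deriv B) (of_real r * t)" if "norm t < 1 / r" for t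
    by (rule deriv_scaled_ev[OF base_holomorphic(1) that]) (rule 1)
  have 3: "ext_deriv (dilated r) t = ext_deriv B (of_real r * t)" if "norm t < 1 / r" for t
    unfolding ext_deriv_def 1[OF that] by (simp add: dilated_def mult_ac)
  show "ext_deriv (dilated r) t = ext_deriv B (of_real r * t)" using 3 t .
  have 4: "deriv (ext_deriv (dilated r)) t = of_real r * deriv (ext_deriv B) (of_real r * t)" if "norm t < 1 / r" for t
    using deriv_scaled_ev[OF base_holomorphic(3) that, of "ext_deriv (dilated r)" 1] 3 by simp
  have 5: "ext_preschwarz (dilated r) t = of_real r * ext_preschwarz B (of_real r * t)" if "norm t < 1 / r" for t
    unfolding ext_preschwarz_def 3[OF that] 4[OF that] by simp
  have 6: "deriv (ext_preschwarz (dilated r)) t = of_real r * of_real r * deriv (ext_preschwarz B) (of_real r * t)"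
    by (rule deriv_scaled_ev[OF base_holomorphic(4) t]) (rule 5)
  show "ext_schwarz (dilated r) t = of_real (r\<^sup>2) * ext_schwarz B (of_real r * t)"
    unfolding ext_schwarz_def 2[OF t] 3[OF t] 5[OF t] 6 by (simp add: power2_eq_square algebra_simps)
qed

text \<open>The hyperbolic norm of the Schwarzian does not increase under the dilation, because
\<open>r (1 - \<bar>t\<bar>\<^sup>2) \<le> 1 - \<bar>r t\<bar>\<^sup>2\<close>.\<close>

lemma scaled_small_schwarzian: "small_schwarzian (dilated r) (1 / r) k"
proof
  show "1 < 1 / r" using r by simp
  show "dilated r holomorphic_on ball 0 (1 / r)" unfolding dilated_def by (rule scaled_holomorphic[OF holB])
  show "k \<le> 1 / 2" by (rule k)
  show "ext_deriv (dilated r) t \<noteq> 0" if "norm t < 1 / r" for t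
    using scaled_schwarzian(1)[OF that] nz[OF scaled_ball[OF that]] by simp
  fix t :: complex assume t: "norm t < 1"
  hence tr: "norm t < 1 / r" using r by (simp add: less_divide_eq) (smt (verit) mult_left_le norm_ge_zero mult_less_cancel_left1)
  have t1: "(norm t)\<^sup>2 \<le> 1" using t by (simp add: abs_square_le_1)
  have "(r * norm t)\<^sup>2 \<le> r * (norm t)\<^sup>2 * 1"
    using r unfolding power_mult_distrib by (simp add: power2_eq_square mult_left_le_one_le mult.assoc)
  moreover have "r * (norm t)\<^sup>2 + r * (1 - (norm t)\<^sup>2) \<le> 1" using r by (simp add: algebra_simps)
  ultimately have "r * (1 - (norm t)\<^sup>2) \<le> 1 - (r * norm t)\<^sup>2" by simp
  hence "(r * (1 - (norm t)\<^sup>2))\<^sup>2 \<le> (1 - (r * norm t)\<^sup>2)\<^sup>2"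
    using r t1 by (intro power_mono) auto
  hence "(r * (1 - (norm t)\<^sup>2))\<^sup>2 * norm (ext_schwarz B (of_real r * t))
      \<le> (1 - (norm (of_real r * t))\<^sup>2)\<^sup>2 * norm (ext_schwarz B (of_real r * t))"
    using r by (intro mult_right_mono) (auto simp: norm_mult)
  also have "\<dots> \<le> 2 * k" by (rule bound[OF scaled_ball[OF tr]])
  finally show "(1 - (norm t)\<^sup>2)\<^sup>2 * norm (ext_schwarz (dilated r) t) \<le> 2 * k"
    unfolding scaled_schwarzian(2)[OF tr] norm_mult norm_of_real by (simp add: power_mult_distrib mult_ac)
qed

end

text \<open>The harmonic Beltrami coefficient of the Schwarzian, with the value at 0 that makes it continuous.\<close>

definition "nu z = 1 / 2 * (1 - z * cnj z)\<^sup>2 * ext_schwarz B (cnj z)"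

definition "faber n = (SOME P. P holomorphic_on UNIV \<and>
   (\<forall>s. norm s < 1 \<longrightarrow> s \<noteq> 0 \<longrightarrow> P (B s / s) = (1 / s) ^ n - of_nat n * fps_nth (l s) n))"

lemma faber: "faber n holomorphic_on UNIV"
  "norm s < 1 \<Longrightarrow> s \<noteq> 0 \<Longrightarrow> faber n (B s / s) = (1 / s) ^ n - of_nat n * fps_nth (l s) n"
  using someI_ex[OF faber_exists[of n], folded faber_def] by auto

text \<open>The energy estimate for the dilated function and a combination \<open>G\<close> of Faber functions.  The powers of \<open>r\<close> in \<open>G\<close> are
chosen so that its polynomial part \<open>c\<close> on the circle is free of \<open>r\<close>, and the coefficients \<open>e\<close> so that
\<open>c' = bergman_sum N x\<close>.  Then \<open>Q\<close> is the integral of \<open>D'(cnj z)\<close> against \<open>bergman_sum N y\<close>.\<close>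

lemma scaled_estimate:
  fixes x y :: "nat \<Rightarrow> complex" and N :: nat
  assumes r: "0 < r" "r < 1"
  defines "Q \<equiv> (\<Sum>m\<in>{1..N}. \<Sum>n\<in>{1..N}. of_real (sqrt (real m * real n)) * \<alpha> m n * of_real r ^ (m + n) * y m * x n)"
  defines "nn \<equiv> sqrt (\<Sum>n\<in>{1..N}. (norm (x n))\<^sup>2) * sqrt (\<Sum>n\<in>{1..N}. (norm (y n))\<^sup>2)"
  shows "norm Q \<le> 2 * k * nn"
    and "norm (Q - (LINT z|disk_measure. small_schwarzian.\<mu> (dilated r) z * bergman_sum N x z * bergman_sum N y z)) \<le> 2 * k\<^sup>2 * nn"
proof -
  interpret S: small_schwarzian "dilated r" "1 / r" k by (rule scaled_small_schwarzian[OF r])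
  define e where "e = (\<lambda>n. x n / of_real (sqrt (real n * pi)))"
  define c where "c = (\<lambda>z. \<Sum>n\<in>{1..N}. e n * z ^ n)"
  define G where "G = (\<lambda>w. \<Sum>n\<in>{1..N}. e n * of_real r ^ n * faber n (w / of_real r))"
  define D where "D = (\<lambda>t. \<Sum>n\<in>{1..N}. e n * of_real r ^ n * (- of_nat n * fps_nth (l (of_real r * t)) n))"
  have hG: "G holomorphic_on UNIV"
    unfolding G_def
    by (intro holomorphic_intros holomorphic_on_compose_gen[OF _ faber(1), unfolded o_def]) (use r in auto)
  have hc: "c holomorphic_on UNIV" unfolding c_def by (intro holomorphic_intros)
  have hg: "bergman_sum N y holomorphic_on UNIV" unfolding bergman_sum_def[abs_def] by (intro holomorphic_intros)
  have hD: "D holomorphic_on ball 0 (1 / r)"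
    unfolding D_def by (intro holomorphic_intros scaled_holomorphic[OF r] l_nth_holomorphic[THEN conjunct1])
  have bdry: "G (z * dilated r (cnj z)) = c z + D (cnj z)" if z: "norm z = 1" for z
  proof -
    define s where "s = of_real r * cnj z"
    have zz: "z * cnj z = 1" using complex_norm_square[of z] z by simp
    have s: "norm s < 1" "s \<noteq> 0" using r z by (auto simp: s_def norm_mult)
    have w: "z * dilated r (cnj z) / of_real r = B s / s"
      using zz s r by (simp add: dilated_def s_def field_simps)
    have rs: "of_real r * (1 / s) = z" using zz s r by (simp add: s_def field_simps)
    have "of_real r ^ n * faber n (z * dilated r (cnj z) / of_real r)
        = z ^ n + of_real r ^ n * (- of_nat n * fps_nth (l s) n)" for n
      unfolding w faber(2)[OF s] right_diff_distrib power_mult_distrib[symmetric] rs by simp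
    thus ?thesis unfolding G_def c_def D_def s_def[symmetric] sum.distrib[symmetric]
      by (intro sum.cong refl) (simp add: mult.assoc right_diff_distrib)
  qed
  have dc: "deriv c = bergman_sum N x"
  proof
    fix z
    have "(c has_field_derivative (\<Sum>n\<in>{1..N}. e n * (of_nat n * z ^ (n - 1)))) (at z)"
      unfolding c_def by (auto intro!: derivative_eq_intros sum.cong)
    moreover have "e n * (of_nat n * z ^ (n - 1)) = of_real (sqrt (real n / pi)) * x n * z ^ (n - 1)" if "n \<in> {1..N}" for n
    proof -
      have "real n / sqrt (real n * pi) = sqrt (real n / pi)"
        using that by (simp add: real_sqrt_mult real_sqrt_divide field_simps)
      hence "complex_of_real (sqrt (real n / pi)) = of_nat n / of_real (sqrt (real n * pi))"
        by (metis of_real_divide of_real_of_nat_eq)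
      thus ?thesis by (simp add: e_def)
    qed
    hence "(\<Sum>n\<in>{1..N}. e n * (of_nat n * z ^ (n - 1))) = bergman_sum N x z" unfolding bergman_sum_def by (rule sum.cong[OF refl])
    ultimately show "deriv c z = bergman_sum N x z" by (simp add: DERIV_imp_deriv)
  qed
  define d where "d = (\<lambda>m. \<Sum>n\<in>{1..N}. e n * of_real r ^ n * of_nat n * \<alpha> m n * of_real r ^ m)"
  have dD: "(\<lambda>m. d m * t ^ m) sums D t" if t: "norm t < 1 / r" for t
  proof -
    have "(\<lambda>m. \<Sum>n\<in>{1..N}. e n * of_real r ^ n * of_nat n * (\<alpha> m n * (of_real r * t) ^ m)) sums
        (\<Sum>n\<in>{1..N}. e n * of_real r ^ n * of_nat n * (- fps_nth (l (of_real r * t)) n))"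
      by (intro sums_sum sums_mult \<alpha>_sums scaled_ball[OF r t])
    thus ?thesis unfolding d_def D_def sum_distrib_right by (simp add: power_mult_distrib mult_ac)
  qed
  have "(LINT z|disk_measure. deriv D (cnj z) * bergman_sum N y z)
      = (LINT z|disk_measure. (\<Sum>m\<in>{1..N}. of_real (sqrt (real m / pi)) * y m * (deriv D (cnj z) * z ^ (m - 1))))"
    unfolding bergman_sum_def sum_distrib_left by (simp only: mult_ac)
  also have "\<dots> = (\<Sum>m\<in>{1..N}. of_real (sqrt (real m / pi)) * y m * (LINT z|disk_measure. deriv D (cnj z) * z ^ (m - 1)))"
  proof -
    have "integrable disk_measure (\<lambda>z. deriv D (cnj z) * z ^ i)" for i
      by (intro integrable_disk_continuous continuous_intros
          continuous_on_holomorphic_cnj(1)[OF holomorphic_deriv[OF hD open_ball] S.R])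
    thus ?thesis by (subst Bochner_Integration.integral_sum) auto
  qed
  also have "\<dots> = (\<Sum>m\<in>{1..N}. of_real (sqrt (real m / pi)) * y m * (of_real pi * d m))"
    by (intro sum.cong refl) (subst disk_integral_deriv_cnj[OF S.R dD], auto)
  also have "\<dots> = Q"
  proof -
    have "of_real (sqrt (real m / pi)) * y m * (of_real pi * (e n * of_real r ^ n * of_nat n * \<alpha> m n * of_real r ^ m))
       = of_real (sqrt (real m * real n)) * \<alpha> m n * of_real r ^ (m + n) * y m * x n" if "m \<in> {1..N}" "n \<in> {1..N}" for m n
    proof -
      have "sqrt (real m / pi) * pi * real n / sqrt (real n * pi) = sqrt (real m * real n)"
        using that by (simp add: real_sqrt_mult real_sqrt_divide field_simps)
      hence "complex_of_real (sqrt (real m * real n))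
          = of_real (sqrt (real m / pi)) * of_real pi * of_nat n / of_real (sqrt (real n * pi))"
        by (metis of_real_divide of_real_mult of_real_of_nat_eq)
      thus ?thesis by (simp add: e_def power_add mult_ac)
    qed
    thus ?thesis unfolding d_def Q_def sum_distrib_left by (intro sum.cong refl)
  qed
  finally have QI: "(LINT z|disk_measure. deriv D (cnj z) * bergman_sum N y z) = Q" .
  have nn: "disk_norm (bergman_sum N x) * disk_norm (bergman_sum N y) = nn"
    unfolding nn_def disk_norm_bergman_sum ..
  show "norm Q \<le> 2 * k * nn"
    using S.reflected_energy_estimate(1)[OF hG hc hg hD bdry] unfolding QI dc by (simp only: nn mult.assoc)
  show "norm (Q - (LINT z|disk_measure. S.\<mu> z * bergman_sum N x z * bergman_sum N y z)) \<le> 2 * k\<^sup>2 * nn"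
    using S.reflected_energy_estimate(2)[OF hG hc hg hD bdry] unfolding QI dc by (simp only: nn mult.assoc)
qed

end

context small_univalent
begin

lemma nu_bound: assumes "norm z < 1" shows "norm (nu z) \<le> k"
proof -
  have "norm (nu z) = (1 - (norm z)\<^sup>2)\<^sup>2 * norm (ext_schwarz B (cnj z)) / 2"
    unfolding nu_def one_minus_mult_cnj norm_mult norm_power norm_of_real by simp
  thus ?thesis using bound[of "cnj z"] assms by simp
qed

lemma k_nonneg: "0 \<le> k"
  using nu_bound[of 0] norm_ge_zero[of "nu 0"] by (simp del: norm_ge_zero)

lemma continuous_on_nu: "continuous_on unit_disk nu"
proof -
  have "continuous_on unit_disk (\<lambda>z. ext_schwarz B (cnj z))"
    by (rule continuous_on_compose2[OF holomorphic_on_imp_continuous_on[OF base_holomorphic(6)]])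
       (auto intro!: continuous_intros)
  thus ?thesis unfolding nu_def[abs_def] by (intro continuous_intros)
qed

lemma continuous_on_bergman_sum: "continuous_on X (bergman_sum N x)"
  unfolding bergman_sum_def[abs_def] by (intro continuous_intros)

text \<open>The limit \<open>r \<rightarrow> 1\<close> of the preceding estimate: only finitely many powers of \<open>r\<close> occur, and the Beltrami coefficients
of the dilated functions converge pointwise and are bounded by \<open>k\<close>.\<close>

lemma finite_estimate:
  fixes x y :: "nat \<Rightarrow> complex" and N :: nat
  defines "Q \<equiv> (\<Sum>m\<in>{1..N}. \<Sum>n\<in>{1..N}. of_real (sqrt (real m * real n)) * \<alpha> m n * y m * x n)"
  defines "nn \<equiv> sqrt (\<Sum>n\<in>{1..N}. (norm (x n))\<^sup>2) * sqrt (\<Sum>n\<in>{1..N}. (norm (y n))\<^sup>2)"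
  shows "norm Q \<le> 2 * k * nn"
    and "norm (Q + (LINT z|disk_measure. nu z * bergman_sum N x z * bergman_sum N y z)) \<le> 2 * k\<^sup>2 * nn"
proof -
  define r where "r = (\<lambda>i::nat. 1 - 1 / (real i + 2))"
  have r: "0 < r i" "r i < 1" for i by (auto simp: r_def field_simps)
  have rlim: "r \<longlonglongrightarrow> 1" unfolding r_def by real_asymp
  have rc: "(\<lambda>i. complex_of_real (r i)) \<longlonglongrightarrow> 1" using tendsto_of_real[OF rlim] by simp
  define Qr where "Qr = (\<lambda>i. \<Sum>m\<in>{1..N}. \<Sum>n\<in>{1..N}. of_real (sqrt (real m * real n)) * \<alpha> m n * of_real (r i) ^ (m + n) * y m * x n)"
  have "Qr \<longlonglongrightarrow> (\<Sum>m\<in>{1..N}. \<Sum>n\<in>{1..N}. of_real (sqrt (real m * real n)) * \<alpha> m n * 1 ^ (m + n) * y m * x n)"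
    unfolding Qr_def by (intro tendsto_intros rc)
  hence Qlim: "Qr \<longlonglongrightarrow> Q" by (simp add: Q_def)
  define \<mu> where "\<mu> = (\<lambda>i. small_schwarzian.\<mu> (dilated (r i)))"
  have ss: "small_schwarzian (dilated (r i)) (1 / r i) k" for i
    by (rule scaled_small_schwarzian[OF r])
  have \<mu>_eq: "\<mu> i z = - 1 / 2 * (1 - z * cnj z)\<^sup>2 * (of_real ((r i)\<^sup>2) * ext_schwarz B (of_real (r i) * cnj z))"
    if z: "norm z < 1" for i z
  proof -
    have "norm (cnj z) < 1 / r i" using z r[of i] by (simp add: less_divide_eq) (smt (verit) mult_left_le norm_ge_zero)
    thus ?thesis unfolding \<mu>_def small_schwarzian.\<mu>_def[OF ss] using scaled_schwarzian(2)[OF r] by simp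
  qed
  have Ilim: "(\<lambda>i. LINT z|disk_measure. \<mu> i z * bergman_sum N x z * bergman_sum N y z)
      \<longlonglongrightarrow> (LINT z|disk_measure. - (nu z * bergman_sum N x z * bergman_sum N y z))"
  proof (rule integral_dominated_convergence[where w = "\<lambda>z. k * norm (bergman_sum N x z) * norm (bergman_sum N y z)"])
    show "(\<lambda>z. - (nu z * bergman_sum N x z * bergman_sum N y z)) \<in> borel_measurable disk_measure"
      by (intro measurable_disk_continuous continuous_intros continuous_on_nu continuous_on_bergman_sum)
    have "continuous_on unit_disk (\<mu> i)" for i
      unfolding \<mu>_def by (rule continuous_on_subset[OF small_schwarzian.continuous_ingredients(3)[OF ss]]) auto
    thus "(\<lambda>z. \<mu> i z * bergman_sum N x z * bergman_sum N y z) \<in> borel_measurable disk_measure" for i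
      by (intro measurable_disk_continuous continuous_intros continuous_on_bergman_sum)
    show "integrable disk_measure (\<lambda>z. k * norm (bergman_sum N x z) * norm (bergman_sum N y z))"
      by (intro integrable_disk_continuous continuous_intros continuous_on_bergman_sum)
    show "AE z in disk_measure. (\<lambda>i. \<mu> i z * bergman_sum N x z * bergman_sum N y z) \<longlonglongrightarrow> - (nu z * bergman_sum N x z * bergman_sum N y z)"
    proof (rule AE_I2)
      fix z assume "z \<in> space disk_measure"
      hence z: "norm z < 1" by simp
      have "isCont (ext_schwarz B) (cnj z)"
        using holomorphic_on_imp_continuous_on[OF base_holomorphic(6)] z
        by (subst (asm) continuous_on_eq_continuous_at) auto
      moreover have "(\<lambda>i. of_real (r i) * cnj z) \<longlonglongrightarrow> 1 * cnj z" by (intro tendsto_intros rc)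
      ultimately have "(\<lambda>i. ext_schwarz B (of_real (r i) * cnj z)) \<longlonglongrightarrow> ext_schwarz B (cnj z)"
        by (auto intro: isCont_tendsto_compose)
      hence "(\<lambda>i. \<mu> i z) \<longlonglongrightarrow> - 1 / 2 * (1 - z * cnj z)\<^sup>2 * (of_real (1\<^sup>2) * ext_schwarz B (cnj z))"
        unfolding \<mu>_eq[OF z] by (intro tendsto_intros rlim)
      hence "(\<lambda>i. \<mu> i z) \<longlonglongrightarrow> - nu z" by (simp add: nu_def)
      hence "(\<lambda>i. \<mu> i z * bergman_sum N x z * bergman_sum N y z) \<longlonglongrightarrow> - nu z * bergman_sum N x z * bergman_sum N y z"
        by (intro tendsto_intros)
      thus "(\<lambda>i. \<mu> i z * bergman_sum N x z * bergman_sum N y z) \<longlonglongrightarrow> - (nu z * bergman_sum N x z * bergman_sum N y z)" by simp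
    qed
    show "AE z in disk_measure. norm (\<mu> i z * bergman_sum N x z * bergman_sum N y z) \<le> k * norm (bergman_sum N x z) * norm (bergman_sum N y z)" for i
      unfolding \<mu>_def norm_mult
      by (intro AE_I2 mult_right_mono small_schwarzian.\<mu>_bound[OF ss]) auto
  qed
  show "norm Q \<le> 2 * k * nn"
  proof (rule LIMSEQ_le_const2[OF tendsto_norm[OF Qlim]])
    show "\<exists>M. \<forall>i\<ge>M. norm (Qr i) \<le> 2 * k * nn"
      using scaled_estimate(1)[OF r, where N = N and x = x and y = y] unfolding Qr_def nn_def by blast
  qed
  have "(\<lambda>i. norm (Qr i - (LINT z|disk_measure. \<mu> i z * bergman_sum N x z * bergman_sum N y z)))
      \<longlonglongrightarrow> norm (Q - (LINT z|disk_measure. - (nu z * bergman_sum N x z * bergman_sum N y z)))"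
    by (intro tendsto_intros Qlim Ilim)
  hence "norm (Q - (LINT z|disk_measure. - (nu z * bergman_sum N x z * bergman_sum N y z))) \<le> 2 * k\<^sup>2 * nn"
  proof (rule LIMSEQ_le_const2)
    show "\<exists>M. \<forall>i\<ge>M. norm (Qr i - (LINT z|disk_measure. \<mu> i z * bergman_sum N x z * bergman_sum N y z)) \<le> 2 * k\<^sup>2 * nn"
      using scaled_estimate(2)[OF r, where N = N and x = x and y = y] unfolding Qr_def nn_def \<mu>_def by blast
  qed
  thus "norm (Q + (LINT z|disk_measure. nu z * bergman_sum N x z * bergman_sum N y z)) \<le> 2 * k\<^sup>2 * nn"
    by simp
qed

text \<open>The estimate of the Grunsky form on unit vectors, where \<open>2 k \<le> 1\<close>.  It makes the double series of the coefficients
converge absolutely.\<close>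

lemma \<alpha>_bound: "norm (\<alpha> m n) \<le> 1"
proof (cases "m = 0 \<or> n = 0")
  case True
  thus ?thesis using \<alpha>_0 by auto
next
  case False
  define N where "N = max m n"
  have mn: "m \<in> {1..N}" "n \<in> {1..N}" using False by (auto simp: N_def)
  define \<delta> :: "nat \<Rightarrow> nat \<Rightarrow> complex" where "\<delta> = (\<lambda>i j. if j = i then 1 else 0)"
  have nrm: "(\<Sum>j\<in>{1..N}. (norm (\<delta> i j))\<^sup>2) = 1" if "i \<in> {1..N}" for i
  proof -
    have "(\<Sum>j\<in>{1..N}. (norm (\<delta> i j))\<^sup>2) = (\<Sum>j\<in>{1..N}. if j = i then 1 else 0)"
      by (intro sum.cong) (auto simp: \<delta>_def)
    thus ?thesis using that by (simp add: sum.delta)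
  qed
  have "(\<Sum>i\<in>{1..N}. \<Sum>j\<in>{1..N}. of_real (sqrt (real i * real j)) * \<alpha> i j * \<delta> m i * \<delta> n j)
      = (\<Sum>i\<in>{1..N}. if i = m then of_real (sqrt (real m * real n)) * \<alpha> m n else 0)"
  proof (intro sum.cong refl)
    fix i
    have "(\<Sum>j\<in>{1..N}. of_real (sqrt (real i * real j)) * \<alpha> i j * \<delta> m i * \<delta> n j)
        = (\<Sum>j\<in>{1..N}. if j = n then of_real (sqrt (real i * real n)) * \<alpha> i n * \<delta> m i else 0)"
      by (intro sum.cong) (auto simp: \<delta>_def)
    thus "(\<Sum>j\<in>{1..N}. of_real (sqrt (real i * real j)) * \<alpha> i j * \<delta> m i * \<delta> n j)
        = (if i = m then of_real (sqrt (real m * real n)) * \<alpha> m n else 0)"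
      using mn by (simp add: sum.delta \<delta>_def)
  qed
  also have "\<dots> = of_real (sqrt (real m * real n)) * \<alpha> m n" using mn by (simp add: sum.delta)
  finally have "norm (of_real (sqrt (real m * real n)) * \<alpha> m n) \<le> 2 * k * (sqrt 1 * sqrt 1)"
    using finite_estimate(1)[where N = N and y = "\<delta> m" and x = "\<delta> n"] unfolding nrm[OF mn(1)] nrm[OF mn(2)] by simp
  hence "sqrt (real m * real n) * norm (\<alpha> m n) \<le> 1" using k by (simp add: norm_mult)
  moreover have "1 \<le> real m * real n" using False by (simp add: mult_ge1_I Suc_leI)
  hence "1 * norm (\<alpha> m n) \<le> sqrt (real m * real n) * norm (\<alpha> m n)"
    by (intro mult_right_mono) auto
  ultimately show ?thesis by simp
qed

lemma double_series:
  assumes s: "norm s < 1" and t: "norm t < 1"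
  shows "((\<lambda>(m, n). \<alpha> m n * (s ^ m * t ^ n)) has_sum - L s t) ({1..} \<times> {1..})"
proof -
  let ?f = "\<lambda>(n, m). \<alpha> m n * (s ^ m * t ^ n)"
  have gs: "((\<lambda>m. norm s ^ m) has_sum (1 / (1 - norm s))) UNIV"
    using s by (intro sums_nonneg_imp_has_sum geometric_sums) auto
  have gt: "((\<lambda>n. norm t ^ n) has_sum (1 / (1 - norm t))) UNIV"
    using t by (intro sums_nonneg_imp_has_sum geometric_sums) auto
  have "(\<lambda>(n, m). norm t ^ n * norm s ^ m) summable_on (UNIV \<times> UNIV)"
  proof (rule summable_on_SigmaI)
    show "((\<lambda>m. case (n, m) of (n, m) \<Rightarrow> norm t ^ n * norm s ^ m) has_sum (norm t ^ n * (1 / (1 - norm s)))) UNIV" for n :: nat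
      using has_sum_cmult_right[OF gs, of "norm t ^ n"] by simp
    show "(\<lambda>n. norm t ^ n * (1 / (1 - norm s))) summable_on UNIV"
      using has_sum_cmult_left[OF gt] has_sum_imp_summable by blast
  qed auto
  hence "(\<lambda>p. norm (?f p)) summable_on (UNIV \<times> UNIV)"
  proof (rule Infinite_Sum.abs_summable_on_comparison_test')
    fix p :: "nat \<times> nat"
    obtain n m where p: "p = (n, m)" by force
    have "norm (\<alpha> m n) * (norm s ^ m * norm t ^ n) \<le> 1 * (norm s ^ m * norm t ^ n)"
      by (intro mult_right_mono \<alpha>_bound) auto
    thus "norm (?f p) \<le> (case p of (n, m) \<Rightarrow> norm t ^ n * norm s ^ m)"
      by (simp add: p norm_mult norm_power mult_ac)
  qed
  hence summ: "?f summable_on (UNIV \<times> UNIV)" by (rule abs_summable_summable)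
  have col: "((\<lambda>m. \<alpha> m n * s ^ m) has_sum (- fps_nth (l s) n)) UNIV" for n
  proof (rule norm_summable_imp_has_sum[OF _ \<alpha>_sums[OF s]])
    show "summable (\<lambda>m. norm (\<alpha> m n * s ^ m))"
    proof (rule summable_comparison_test'[where N = 0])
      show "summable (\<lambda>m. norm s ^ m)" using s by (intro summable_geometric) simp
      show "norm (norm (\<alpha> m n * s ^ m)) \<le> norm s ^ m" for m
        using mult_right_mono[OF \<alpha>_bound[of m n], of "norm s ^ m"] by (simp add: norm_mult norm_power)
    qed
  qed
  have inner: "((\<lambda>m. ?f (n, m)) has_sum (- fps_nth (l s) n) * t ^ n) UNIV" for n
    using has_sum_cmult_left[OF col[of n], of "t ^ n"] by (simp add: mult_ac)
  have "?f summable_on (UNIV \<times> UNIV)" by (rule summ)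
  then obtain T where T: "(?f has_sum T) (UNIV \<times> UNIV)" by (auto simp: summable_on_def)
  have "((\<lambda>n. (- fps_nth (l s) n) * t ^ n) has_sum T) UNIV"
    by (rule has_sum_SigmaD[OF T]) (rule inner)
  hence "(\<lambda>n. (- fps_nth (l s) n) * t ^ n) sums T" by (rule has_sum_imp_sums)
  moreover have "(\<lambda>n. (- fps_nth (l s) n) * t ^ n) sums (- L s t)"
    using sums_minus[OF l_sums[OF s t]] by simp
  ultimately have "T = - L s t" by (rule sums_unique2)
  with T have "((\<lambda>(m, n). \<alpha> m n * (s ^ m * t ^ n)) has_sum - L s t) (UNIV \<times> UNIV)"
    by (subst has_sum_swap) simp
  moreover have "\<alpha> m n \<noteq> 0 \<Longrightarrow> Suc 0 \<le> m \<and> Suc 0 \<le> n" for m n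
    using \<alpha>_0 by (metis Suc_leI neq0_conv)
  ultimately show ?thesis
    by (subst has_sum_cong_neutral[of UNIV "{1..} \<times> {1..}"]) (auto simp: \<alpha>_0)
qed

lemma grunsky_expansion_\<alpha>:
  assumes f: "\<And>z. 1 < norm z \<Longrightarrow> f z = z * B (1 / z)"
  shows "grunsky_expansion f \<alpha>"
  unfolding grunsky_expansion_def
proof (intro ballI impI)
  fix z \<zeta> assume z: "z \<in> ext_disk" and \<zeta>: "\<zeta> \<in> ext_disk" and ne: "z \<noteq> \<zeta>"
  define s t where "s = 1 / z" and "t = 1 / \<zeta>"
  have nz: "z \<noteq> 0" "\<zeta> \<noteq> 0" using z \<zeta> by (auto simp: ext_disk_def)
  have s: "norm s < 1" "norm t < 1" "s \<noteq> t"
    using z \<zeta> ne nz by (auto simp: s_def t_def ext_disk_def norm_divide divide_simps)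
  have "exp (- (- L s t)) = K s t" using L(3)[OF s(1,2)] by simp
  also have "\<dots> = (f z - f \<zeta>) / (z - \<zeta>)"
  proof -
    have "K s t = (t * B s - s * B t) / (t - s)" using s(3) by (simp add: K_def)
    also have "\<dots> = (z * \<zeta> * (t * B s - s * B t)) / (z * \<zeta> * (t - s))" using nz by simp
    also have "z * \<zeta> * (t - s) = z - \<zeta>" using nz by (simp add: s_def t_def field_simps)
    also have "z * \<zeta> * (t * B s - s * B t) = f z - f \<zeta>"
      using f[of z] f[of \<zeta>] z \<zeta> nz by (simp add: s_def t_def ext_disk_def field_simps)
    finally show ?thesis .
  qed
  finally have "exp (- (- L s t)) = (f z - f \<zeta>) / (z - \<zeta>)" .
  moreover have "((\<lambda>(m, n). \<alpha> m n / (z ^ m * \<zeta> ^ n)) has_sum - L s t) ({1..} \<times> {1..})"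
    using double_series[OF s(1,2)] by (simp add: s_def t_def power_divide)
  ultimately show "\<exists>S. ((\<lambda>(m, n). \<alpha> m n / (z ^ m * \<zeta> ^ n)) has_sum S) ({1..} \<times> {1..}) \<and>
      exp (- S) = (f z - f \<zeta>) / (z - \<zeta>)" by blast
qed

end

section \<open>Uniqueness of the Grunsky expansion\<close>

text \<open>One point \<open>t\<close> is exempted because Grunsky expansions are only required off the diagonal.\<close>

lemma power_series_zero_coeffs:
  fixes a :: "nat \<Rightarrow> complex"
  assumes r: "0 < r" and sums: "\<And>x. norm x < r \<Longrightarrow> (\<lambda>n. a n * x ^ n) sums f x"
    and a0: "a 0 = 0" and zero: "\<And>x. norm x < r \<Longrightarrow> x \<noteq> 0 \<Longrightarrow> x \<noteq> t \<Longrightarrow> f x = 0" and t: "t \<noteq> 0"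
  shows "a m = 0"
proof (rule ccontr)
  assume am: "a m \<noteq> 0"
  hence m: "m > 0" using a0 by (cases m) auto
  have f0: "f 0 = 0" using sums[of 0] r a0 by (simp add: powser_sums_zero_iff)
  obtain s where s: "0 < s" "\<And>z. z \<in> cball 0 s - {0} \<Longrightarrow> f z \<noteq> 0"
    by (rule powser_0_nonzero[OF r, of 0 a f m]) (use sums f0 am m in auto)
  \<comment> \<open>a nonzero point inside all the disks that avoids \<open>t\<close>\<close>
  define d where "d = Min {s, r / 2, norm t / 2}"
  have d: "0 < d" "d \<le> s" "d < r" "d < norm t"
    using s(1) r t by (auto simp: d_def min_def)
  have "f (of_real d) = 0" using d by (intro zero) auto
  moreover have "f (of_real d) \<noteq> 0" using d by (intro s(2)) auto
  ultimately show False by contradiction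
qed

lemma exp_eq_1_small: assumes "exp (x :: complex) = 1" "norm x < 1" shows "x = 0"
proof -
  from assms(1) obtain n :: int where re: "Re x = 0" and im: "Im x = of_int (2 * n) * pi"
    by (auto simp: exp_eq_1)
  have "\<bar>Im x\<bar> < 1" using abs_Im_le_cmod[of x] assms(2) by linarith
  moreover have "n \<noteq> 0 \<Longrightarrow> 1 \<le> \<bar>real_of_int n\<bar>" by linarith
  hence "n \<noteq> 0 \<Longrightarrow> 1 * 1 \<le> \<bar>real_of_int n\<bar> * (2 * pi)" using pi_gt3 by (intro mult_mono) auto
  ultimately have "n = 0" using im by (auto simp: abs_mult)
  thus ?thesis using re im by (simp add: complex_eq_iff)
qed

text \<open>The difference of two expansions takes values in \<open>2 \<pi> \<i> \<int>\<close>, since both exponentiate to the same quotient.  It is small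
near infinity, because there is no term with an index 0, and so vanishes there.  The coefficients are then extracted one
variable at a time.\<close>

lemma grunsky_expansion_unique:
  assumes \<alpha>: "grunsky_expansion f \<alpha>" and \<alpha>0: "\<And>m n. m = 0 \<or> n = 0 \<Longrightarrow> \<alpha> m n = 0"
    and \<beta>: "grunsky_expansion f \<beta>" and \<beta>0: "\<And>m n. m = 0 \<or> n = 0 \<Longrightarrow> \<beta> m n = 0"
  shows "\<alpha> = \<beta>"
proof -
  define \<delta> where "\<delta> = (\<lambda>m n. \<alpha> m n - \<beta> m n)"
  have supp: "\<alpha> m n \<noteq> \<beta> m n \<Longrightarrow> Suc 0 \<le> m" "\<alpha> m n \<noteq> \<beta> m n \<Longrightarrow> Suc 0 \<le> n" for m n
    using \<alpha>0[of m n] \<beta>0[of m n] by (metis Suc_leI neq0_conv)+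
  have \<delta>0: "\<delta> m n = 0" if "m = 0 \<or> n = 0" for m n using that \<alpha>0 \<beta>0 by (simp add: \<delta>_def)
  have ex: "\<exists>S. ((\<lambda>(m, n). \<delta> m n * (s ^ m * t ^ n)) has_sum S) (UNIV \<times> UNIV) \<and> exp S = 1"
    if st: "norm s < 1" "norm t < 1" "s \<noteq> 0" "t \<noteq> 0" "s \<noteq> t" for s t
  proof -
    define z \<zeta> where "z = 1 / s" and "\<zeta> = 1 / t"
    have z: "z \<in> ext_disk" "\<zeta> \<in> ext_disk" "z \<noteq> \<zeta>"
      using st by (auto simp: z_def \<zeta>_def ext_disk_def norm_divide divide_simps)
    obtain S1 where S1: "((\<lambda>(m, n). \<alpha> m n / (z ^ m * \<zeta> ^ n)) has_sum S1) ({1..} \<times> {1..})"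
        "exp (- S1) = (f z - f \<zeta>) / (z - \<zeta>)"
      using \<alpha> z unfolding grunsky_expansion_def by blast
    obtain S2 where S2: "((\<lambda>(m, n). \<beta> m n / (z ^ m * \<zeta> ^ n)) has_sum S2) ({1..} \<times> {1..})"
        "exp (- S2) = (f z - f \<zeta>) / (z - \<zeta>)"
      using \<beta> z unfolding grunsky_expansion_def by blast
    have "((\<lambda>p. (case p of (m, n) \<Rightarrow> \<alpha> m n / (z ^ m * \<zeta> ^ n)) + (- 1) * (case p of (m, n) \<Rightarrow> \<beta> m n / (z ^ m * \<zeta> ^ n)))
        has_sum (S1 + (- 1) * S2)) ({1..} \<times> {1..})"
      by (rule has_sum_add[OF S1(1) has_sum_cmult_right[OF S2(1)]])
    hence "((\<lambda>(m, n). \<delta> m n * (s ^ m * t ^ n)) has_sum (S1 + (- 1) * S2)) (UNIV \<times> UNIV)"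
      by (subst (asm) has_sum_cong_neutral[of "UNIV \<times> UNIV" "{1..} \<times> {1..}" "\<lambda>(m, n). \<delta> m n * (s ^ m * t ^ n)"])
         (auto simp: not_less_eq_eq \<delta>0 z_def \<zeta>_def power_divide, auto simp: \<delta>_def algebra_simps intro: supp)
    hence "((\<lambda>(m, n). \<delta> m n * (s ^ m * t ^ n)) has_sum (S1 - S2)) (UNIV \<times> UNIV)" by simp
    moreover have "exp (S1 - S2) = exp (- S2) / exp (- S1)" by (simp add: exp_diff exp_minus field_simps)
    hence "exp (S1 - S2) = 1" using S1(2) S2(2) by (metis divide_self exp_not_eq_zero)
    ultimately show ?thesis by blast
  qed
  let ?g = "\<lambda>(m, n). norm (\<delta> m n) * ((1 / 2) ^ m * (1 / 3) ^ n)"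
  \<comment> \<open>any two distinct points serve as base point for the majorant \<open>?g\<close>\<close>
  obtain S0 where "((\<lambda>(m, n). \<delta> m n * ((1 / 2) ^ m * (1 / 3) ^ n)) has_sum S0) (UNIV \<times> UNIV)"
    using ex[of "1 / 2" "1 / 3"] by auto
  hence "(\<lambda>(m, n). \<delta> m n * ((1 / 2) ^ m * (1 / 3) ^ n)) summable_on (UNIV \<times> UNIV)"
    by (rule has_sum_imp_summable)
  hence "(\<lambda>p. norm (case p of (m, n) \<Rightarrow> \<delta> m n * ((1 / 2) ^ m * (1 / 3) ^ n))) summable_on (UNIV \<times> UNIV)"
    by (simp only: summable_on_iff_abs_summable_on_complex)
  hence g: "?g summable_on (UNIV \<times> UNIV)"
    by (simp add: case_prod_unfold norm_mult norm_power norm_divide)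
  define M where "M = infsum ?g (UNIV \<times> UNIV)"
  have gM: "(?g has_sum M) (UNIV \<times> UNIV)" unfolding M_def using g by (rule has_sum_infsum)
  have M0: "0 \<le> M" unfolding M_def by (rule infsum_nonneg) auto
  have bd: "norm (\<delta> m n * (s ^ m * t ^ n)) \<le> norm (\<delta> m n) * ((1 / 2) ^ m * (1 / 3) ^ n) * c"
    if "norm s \<le> c / 2" "norm t \<le> 1 / 3" "c \<le> 1" "0 \<le> c" for s t c m n
  proof (cases "m = 0")
    case True
    thus ?thesis by (simp add: \<delta>0)
  next
    case False
    have "norm s ^ m \<le> (c / 2) ^ m" using that by (intro power_mono) auto
    also have "\<dots> = c ^ m * (1 / 2) ^ m" by (simp add: power_divide)
    also have "\<dots> \<le> c ^ 1 * (1 / 2) ^ m"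
      using False that by (intro mult_right_mono power_decreasing) auto
    finally have "norm s ^ m \<le> (1 / 2) ^ m * c" by (simp add: mult.commute)
    moreover have "norm t ^ n \<le> (1 / 3) ^ n" using that by (intro power_mono) auto
    ultimately have "norm s ^ m * norm t ^ n \<le> ((1 / 2) ^ m * c) * (1 / 3) ^ n"
      using that by (intro mult_mono) auto
    hence "norm (\<delta> m n) * (norm s ^ m * norm t ^ n) \<le> norm (\<delta> m n) * (((1 / 2) ^ m * c) * (1 / 3) ^ n)"
      by (intro mult_left_mono) auto
    thus ?thesis by (simp add: norm_mult norm_power mult_ac)
  qed
  define h where "h = (\<lambda>s t. infsum (\<lambda>(m, n). \<delta> m n * (s ^ m * t ^ n)) (UNIV \<times> UNIV))"
  have habs: "(\<lambda>p. norm (case p of (m, n) \<Rightarrow> \<delta> m n * (s ^ m * t ^ n))) summable_on (UNIV \<times> UNIV)"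
    if "norm s \<le> 1 / 2" "norm t \<le> 1 / 3" for s t
    by (rule Infinite_Sum.abs_summable_on_comparison_test'[OF g]) (use bd[of s 1 t] that in auto)
  have hs: "((\<lambda>(m, n). \<delta> m n * (s ^ m * t ^ n)) has_sum h s t) (UNIV \<times> UNIV)"
    if "norm s \<le> 1 / 2" "norm t \<le> 1 / 3" for s t
    unfolding h_def by (rule has_sum_infsum[OF abs_summable_summable[OF habs[OF that]]])
  \<comment> \<open>for \<open>\<bar>s\<bar> \<le> c / 2\<close> and \<open>\<bar>t\<bar> \<le> 1 / 3\<close> the double series is at most \<open>M c < 1\<close> in modulus\<close>
  define c where "c = 1 / (M + 1)"
  have c: "0 < c" "c \<le> 1" "M * c < 1" using M0 by (auto simp: c_def field_simps)
  have h0: "h s t = 0" if st: "norm s \<le> c / 2" "norm t \<le> 1 / 3" "s \<noteq> 0" "t \<noteq> 0" "s \<noteq> t" for s t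
  proof -
    have n: "norm s \<le> 1 / 2" using st c by linarith
    have "norm s < 1" "norm t < 1" using n st by linarith+
    then obtain S where S: "((\<lambda>(m, n). \<delta> m n * (s ^ m * t ^ n)) has_sum S) (UNIV \<times> UNIV)" "exp S = 1"
      using ex[of s t] st by auto
    have "h s t = S" using hs[OF n st(2)] S(1) by (rule has_sum_unique)
    have "norm S \<le> infsum (\<lambda>p. norm (case p of (m, n) \<Rightarrow> \<delta> m n * (s ^ m * t ^ n))) (UNIV \<times> UNIV)"
      by (rule norm_has_sum_bound[OF has_sum_infsum[OF habs[OF n st(2)]] S(1)])
    also have "\<dots> \<le> M * c"
      by (rule has_sum_mono[OF has_sum_infsum[OF habs[OF n st(2)]] has_sum_cmult_left[OF gM, of c]])
         (use bd[of s c t] st c in auto)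
    finally have "S = 0" using c S(2) by (intro exp_eq_1_small) auto
    thus ?thesis using \<open>h s t = S\<close> by simp
  qed
  have row_abs: "(\<lambda>n. norm (\<delta> m n * t ^ n)) summable_on UNIV" if "norm t \<le> 1 / 3" for m t
  proof -
    have "(\<lambda>n. norm (\<delta> m n * ((1 / 2) ^ m * t ^ n))) summable_on UNIV"
      using habs[of "1 / 2" t] that unfolding Infinite_Sum.abs_summable_on_Sigma_iff by auto
    hence "(\<lambda>n. (2 ^ m) * norm (\<delta> m n * ((1 / 2) ^ m * t ^ n))) summable_on UNIV"
      by (rule summable_on_cmult_right)
    thus ?thesis by (simp add: norm_mult norm_power norm_divide power_divide)
  qed
  define R where "R = (\<lambda>m t. infsum (\<lambda>n. \<delta> m n * t ^ n) UNIV)"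
  have row: "((\<lambda>n. \<delta> m n * t ^ n) has_sum R m t) UNIV" if "norm t \<le> 1 / 3" for m t
    unfolding R_def by (rule has_sum_infsum[OF abs_summable_summable[OF row_abs[OF that]]])
  have "R m t = 0" if t: "norm t \<le> 1 / 3" "t \<noteq> 0" for m t
  proof (rule power_series_zero_coeffs[where r = "c / 2" and f = "\<lambda>s. h s t" and a = "\<lambda>m. R m t" and t = t])
    fix s :: complex assume s: "norm s < c / 2"
    hence n: "norm s \<le> 1 / 2" using c by linarith
    have "((\<lambda>m. R m t * s ^ m) has_sum h s t) UNIV"
    proof (rule has_sum_SigmaD[OF hs[OF n t(1)]])
      show "((\<lambda>n. case (m, n) of (m, n) \<Rightarrow> \<delta> m n * (s ^ m * t ^ n)) has_sum R m t * s ^ m) UNIV" for m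
        using has_sum_cmult_left[OF row[OF t(1), of m], of "s ^ m"] by (simp add: mult_ac)
    qed
    thus "(\<lambda>m. R m t * s ^ m) sums h s t" by (rule has_sum_imp_sums)
  next
    show "R 0 t = 0" by (simp add: R_def \<delta>0)
  qed (use c t h0 in auto)
  hence R0: "R m t = 0" if "norm t \<le> 1 / 3" "t \<noteq> 0" for m t using that by blast
  have "\<delta> m n = 0" for m n
    by (rule power_series_zero_coeffs[where r = "1 / 3" and f = "R m" and a = "\<delta> m" and t = 1])
       (use R0 in \<open>auto simp: \<delta>0 intro!: has_sum_imp_sums row\<close>)
  thus ?thesis by (auto simp: \<delta>_def fun_eq_iff)
qed

lemma grunsky_coeff_eqI:
  assumes "grunsky_expansion f \<alpha>" "\<And>m n. m = 0 \<or> n = 0 \<Longrightarrow> \<alpha> m n = 0"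
  shows "grunsky_coeff f = \<alpha>"
  unfolding grunsky_coeff_def
  by (rule the_equality) (use assms grunsky_expansion_unique in blast)+

section \<open>From finite to square summable sequences\<close>

lemma has_sum_imp_LIMSEQ_from_1:
  fixes f :: "nat \<Rightarrow> 'a::real_normed_vector"
  assumes "(f has_sum S) {1..}"
  shows "(\<lambda>N. \<Sum>n\<in>{1..N}. f n) \<longlonglongrightarrow> S"
proof -
  have "((\<lambda>n. if n = 0 then 0 else f n) has_sum S) UNIV"
    using assms by (subst has_sum_cong_neutral[of "{1..}" UNIV f]) auto
  hence "(\<lambda>n. if n = 0 then 0 else f n) sums S" by (rule has_sum_imp_sums)
  hence "(\<lambda>N. \<Sum>n\<le>N. if n = 0 then 0 else f n) \<longlonglongrightarrow> S" by (simp add: sums_def_le)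
  also have "(\<lambda>N. \<Sum>n\<le>N. if n = 0 then 0 else f n) = (\<lambda>N. \<Sum>n\<in>{1..N}. f n)"
    by (intro ext sum.mono_neutral_cong_right) auto
  finally show ?thesis .
qed

locale bounded_bilinear_form =
  fixes M :: "nat \<Rightarrow> nat \<Rightarrow> complex" and C :: real
  assumes C: "0 \<le> C"
    and bounded: "\<And>N x y. norm (\<Sum>m\<in>{1..N}. \<Sum>n\<in>{1..N}. M m n * y m * x n)
      \<le> C * (sqrt (\<Sum>n\<in>{1..N}. (norm (x n))\<^sup>2) * sqrt (\<Sum>n\<in>{1..N}. (norm (y n))\<^sup>2))"
begin

lemma bounded_finite_sets:
  assumes "finite I" "I \<subseteq> {1..}" "finite J" "J \<subseteq> {1..}"
  shows "norm (\<Sum>m\<in>I. \<Sum>n\<in>J. M m n * y m * x n)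
    \<le> C * (sqrt (\<Sum>n\<in>J. (norm (x n))\<^sup>2) * sqrt (\<Sum>m\<in>I. (norm (y m))\<^sup>2))"
proof -
  obtain N where N: "I \<union> J \<subseteq> {..N}"
    using assms by (metis finite_UnI finite_nat_iff_bounded_le)
  hence sub: "I \<subseteq> {1..N}" "J \<subseteq> {1..N}" using assms by auto
  define x' where "x' = (\<lambda>n. if n \<in> J then x n else 0)"
  define y' where "y' = (\<lambda>n. if n \<in> I then y n else 0)"
  have "(\<Sum>m\<in>{1..N}. \<Sum>n\<in>{1..N}. M m n * y' m * x' n) = (\<Sum>m\<in>I. \<Sum>n\<in>{1..N}. M m n * y' m * x' n)"
    using sub by (intro sum.mono_neutral_right) (auto simp: y'_def)
  also have "\<dots> = (\<Sum>m\<in>I. \<Sum>n\<in>J. M m n * y m * x n)"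
    using sub by (intro sum.cong refl sum.mono_neutral_cong_right) (auto simp: y'_def x'_def)
  finally have 1: "(\<Sum>m\<in>{1..N}. \<Sum>n\<in>{1..N}. M m n * y' m * x' n) = (\<Sum>m\<in>I. \<Sum>n\<in>J. M m n * y m * x n)" .
  have 2: "(\<Sum>n\<in>{1..N}. (norm (x' n))\<^sup>2) = (\<Sum>n\<in>J. (norm (x n))\<^sup>2)"
    using sub by (intro sum.mono_neutral_cong_right) (auto simp: x'_def)
  have 3: "(\<Sum>n\<in>{1..N}. (norm (y' n))\<^sup>2) = (\<Sum>n\<in>I. (norm (y n))\<^sup>2)"
    using sub by (intro sum.mono_neutral_cong_right) (auto simp: y'_def)
  show ?thesis using bounded[where N = N and x = x' and y = y'] unfolding 1 2 3 .
qed

text \<open>The bilinear form is tested with the conjugates of the numbers whose squares are to be summed.\<close>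

lemma column_bound:
  assumes "finite I" "I \<subseteq> {1..}" "finite J" "J \<subseteq> {1..}"
  shows "(\<Sum>m\<in>I. (norm (\<Sum>n\<in>J. M m n * x n))\<^sup>2) \<le> C\<^sup>2 * (\<Sum>n\<in>J. (norm (x n))\<^sup>2)"
proof -
  define v where "v = (\<lambda>m. \<Sum>n\<in>J. M m n * x n)"
  define V where "V = (\<Sum>m\<in>I. (norm (v m))\<^sup>2)"
  define X where "X = (\<Sum>n\<in>J. (norm (x n))\<^sup>2)"
  have V0: "0 \<le> V" "0 \<le> X" by (auto simp: V_def X_def sum_nonneg)
  have "(\<Sum>m\<in>I. \<Sum>n\<in>J. M m n * cnj (v m) * x n) = (\<Sum>m\<in>I. v m * cnj (v m))"
    by (intro sum.cong refl) (simp add: v_def sum_distrib_right mult_ac)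
  also have "\<dots> = of_real V"
    unfolding V_def of_real_sum by (intro sum.cong refl) (simp only: complex_norm_square)
  finally have eqV: "(\<Sum>m\<in>I. \<Sum>n\<in>J. M m n * cnj (v m) * x n) = of_real V" .
  have "V \<le> C * (sqrt X * sqrt V)"
    using bounded_finite_sets[OF assms, of "\<lambda>m. cnj (v m)" x] V0(1)
    unfolding eqV complex_mod_cnj V_def[symmetric] X_def[symmetric] norm_of_real by simp
  hence le: "sqrt V * sqrt V \<le> (C * sqrt X) * sqrt V" using V0 by (simp add: mult.assoc)
  have "sqrt V \<le> C * sqrt X"
  proof (cases "V = 0")
    case False
    hence "0 < sqrt V" using V0 by simp
    thus ?thesis using le by (rule mult_right_le_imp_le[rotated])
  qed (use V0 C in auto)
  hence "(sqrt V)\<^sup>2 \<le> (C * sqrt X)\<^sup>2" using V0 by (intro power_mono) auto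
  thus ?thesis using V0 by (simp add: V_def X_def v_def power_mult_distrib)
qed

text \<open>Every row of \<open>M\<close> is square summable, and so is the sequence \<open>v\<close> of row sums by \<open>column_bound\<close>; hence both iterated
sums converge absolutely.  The square partial sums differ from the partial sums of \<open>v m * x m\<close> by the form applied
to \<open>x\<close> and a tail of \<open>x\<close>.\<close>

lemma quadratic_form_limit:
  assumes x: "x \<in> l2_sphere"
  shows "(\<lambda>N. \<Sum>m\<in>{1..N}. \<Sum>n\<in>{1..N}. M m n * x m * x n)
    \<longlonglongrightarrow> (\<Sum>\<^sub>\<infinity>m\<in>{1..}. \<Sum>\<^sub>\<infinity>n\<in>{1..}. M m n * x m * x n)"
proof -
  have hx: "((\<lambda>n. (norm (x n))\<^sup>2) has_sum 1) {1..}" using x by (simp add: l2_sphere_def)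
  have x_le: "(\<Sum>n\<in>J. (norm (x n))\<^sup>2) \<le> 1" if "finite J" "J \<subseteq> {1..}" for J
    using finite_sum_le_has_sum[OF hx] that by auto
  have x2: "(\<lambda>n. norm (x n * x n)) summable_on {1..}"
    using has_sum_imp_summable[OF hx] by (simp add: norm_mult power2_eq_square)
  have row: "(\<lambda>n. norm (M m n * x n)) summable_on {1..}" if m: "1 \<le> m" for m
  proof (rule abs_summable_product[OF _ x2])
    show "(\<lambda>n. norm (M m n * M m n)) summable_on {1..}"
    proof (rule nonneg_bdd_above_summable_on)
      show "bdd_above (sum (\<lambda>n. norm (M m n * M m n)) ` {F. F \<subseteq> {1..} \<and> finite F})"
      proof (rule bdd_aboveI2)
        fix F :: "nat set" assume F: "F \<in> {F. F \<subseteq> {1..} \<and> finite F}"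
        define V where "V = (\<Sum>n\<in>F. (norm (M m n))\<^sup>2)"
        have V0: "0 \<le> V" by (simp add: V_def sum_nonneg)
        have "(\<Sum>n\<in>F. M m n * cnj (M m n)) = of_real V"
          unfolding V_def of_real_sum by (intro sum.cong refl) (simp only: complex_norm_square)
        moreover have "(norm (\<Sum>n\<in>F. M m n * cnj (M m n)))\<^sup>2 \<le> C\<^sup>2 * V"
          using column_bound[of "{m}" F "\<lambda>n. cnj (M m n)"] F m by (simp add: V_def)
        ultimately have "V * V \<le> C\<^sup>2 * V" using V0 by (simp add: power2_eq_square)
        hence "V \<le> C\<^sup>2" using V0 by (cases "V = 0") (auto simp: mult_le_cancel_right)
        thus "sum (\<lambda>n. norm (M m n * M m n)) F \<le> C\<^sup>2"
          by (simp add: V_def norm_mult power2_eq_square)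
      qed
    qed simp
  qed
  define v where "v = (\<lambda>m. \<Sum>\<^sub>\<infinity>n\<in>{1..}. M m n * x n)"
  have hv: "((\<lambda>n. M m n * x n) has_sum v m) {1..}" if "1 \<le> m" for m
    unfolding v_def by (rule has_sum_infsum[OF abs_summable_summable[OF row[OF that]]])
  have lim_v: "(\<lambda>N. \<Sum>n\<in>{1..N}. M m n * x n) \<longlonglongrightarrow> v m" if "1 \<le> m" for m
    by (rule has_sum_imp_LIMSEQ_from_1[OF hv[OF that]])
  have v_le: "(\<Sum>m\<in>I. (norm (v m))\<^sup>2) \<le> C\<^sup>2" if I: "finite I" "I \<subseteq> {1..}" for I
  proof (rule LIMSEQ_le_const2)
    show "(\<lambda>N. \<Sum>m\<in>I. (norm (\<Sum>n\<in>{1..N}. M m n * x n))\<^sup>2) \<longlonglongrightarrow> (\<Sum>m\<in>I. (norm (v m))\<^sup>2)"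
      using I by (intro tendsto_intros lim_v) auto
    have "(\<Sum>m\<in>I. (norm (\<Sum>n\<in>{1..N}. M m n * x n))\<^sup>2) \<le> C\<^sup>2" for N
    proof -
      have "(\<Sum>m\<in>I. (norm (\<Sum>n\<in>{1..N}. M m n * x n))\<^sup>2) \<le> C\<^sup>2 * (\<Sum>n\<in>{1..N}. (norm (x n))\<^sup>2)"
        using I by (intro column_bound) auto
      also have "\<dots> \<le> C\<^sup>2 * 1" by (intro mult_left_mono x_le) auto
      finally show ?thesis by simp
    qed
    thus "\<exists>N0. \<forall>N\<ge>N0. (\<Sum>m\<in>I. (norm (\<Sum>n\<in>{1..N}. M m n * x n))\<^sup>2) \<le> C\<^sup>2" by blast
  qed
  have "(\<lambda>m. norm (v m * x m)) summable_on {1..}"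
  proof (rule abs_summable_product[OF _ x2])
    show "(\<lambda>m. norm (v m * v m)) summable_on {1..}"
    proof (rule nonneg_bdd_above_summable_on)
      show "bdd_above (sum (\<lambda>m. norm (v m * v m)) ` {F. F \<subseteq> {1..} \<and> finite F})"
        by (rule bdd_aboveI2[where M = "C\<^sup>2"]) (use v_le in \<open>auto simp: norm_mult power2_eq_square\<close>)
    qed simp
  qed
  hence "((\<lambda>m. v m * x m) has_sum (\<Sum>\<^sub>\<infinity>m\<in>{1..}. v m * x m)) {1..}"
    by (rule has_sum_infsum[OF abs_summable_summable])
  hence outer: "(\<lambda>N. \<Sum>m\<in>{1..N}. v m * x m) \<longlonglongrightarrow> (\<Sum>\<^sub>\<infinity>m\<in>{1..}. v m * x m)"
    by (rule has_sum_imp_LIMSEQ_from_1)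
  have total: "(\<Sum>\<^sub>\<infinity>m\<in>{1..}. v m * x m) = (\<Sum>\<^sub>\<infinity>m\<in>{1..}. \<Sum>\<^sub>\<infinity>n\<in>{1..}. M m n * x m * x n)"
  proof (rule infsum_cong)
    fix m :: nat assume "m \<in> {1..}"
    hence "((\<lambda>n. M m n * x n * x m) has_sum v m * x m) {1..}" by (intro has_sum_cmult_left hv) auto
    hence "((\<lambda>n. M m n * x m * x n) has_sum v m * x m) {1..}" by (simp add: mult_ac)
    thus "v m * x m = (\<Sum>\<^sub>\<infinity>n\<in>{1..}. M m n * x m * x n)" by (simp add: infsumI)
  qed
  define X where "X = (\<lambda>N. \<Sum>n\<in>{1..N}. (norm (x n))\<^sup>2)"
  have Xlim: "X \<longlonglongrightarrow> 1" unfolding X_def by (rule has_sum_imp_LIMSEQ_from_1[OF hx])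
  have QN: "(\<Sum>m\<in>{1..N}. \<Sum>n\<in>{1..N}. M m n * x m * x n) = (\<Sum>m\<in>{1..N}. (\<Sum>n\<in>{1..N}. M m n * x n) * x m)" for N
    unfolding sum_distrib_right by (simp only: mult_ac)
  have diff: "norm ((\<Sum>m\<in>{1..N}. \<Sum>n\<in>{1..N}. M m n * x m * x n) - (\<Sum>m\<in>{1..N}. v m * x m)) \<le> C * sqrt (1 - X N)" for N
  proof (rule LIMSEQ_le_const2)
    have "(\<lambda>N'. (\<Sum>m\<in>{1..N}. (\<Sum>n\<in>{1..N}. M m n * x n) * x m) - (\<Sum>m\<in>{1..N}. (\<Sum>n\<in>{1..N'}. M m n * x n) * x m))
      \<longlonglongrightarrow> (\<Sum>m\<in>{1..N}. (\<Sum>n\<in>{1..N}. M m n * x n) * x m) - (\<Sum>m\<in>{1..N}. v m * x m)"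
      by (intro tendsto_intros lim_v) auto
    thus "(\<lambda>N'. norm ((\<Sum>m\<in>{1..N}. (\<Sum>n\<in>{1..N}. M m n * x n) * x m) - (\<Sum>m\<in>{1..N}. (\<Sum>n\<in>{1..N'}. M m n * x n) * x m)))
      \<longlonglongrightarrow> norm ((\<Sum>m\<in>{1..N}. \<Sum>n\<in>{1..N}. M m n * x m * x n) - (\<Sum>m\<in>{1..N}. v m * x m))"
      unfolding QN by (rule tendsto_norm)
    have "norm ((\<Sum>m\<in>{1..N}. (\<Sum>n\<in>{1..N}. M m n * x n) * x m) - (\<Sum>m\<in>{1..N}. (\<Sum>n\<in>{1..N'}. M m n * x n) * x m)) \<le> C * sqrt (1 - X N)"
      if "N \<le> N'" for N'
    proof -
      have split: "(\<Sum>n\<in>{1..N'}. h n) = (\<Sum>n\<in>{1..N}. h n) + (\<Sum>n\<in>{N<..N'}. h n)" for h :: "nat \<Rightarrow> 'b::comm_monoid_add"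
        using that by (subst sum.union_disjoint[symmetric]) (auto intro!: sum.cong)
      have "(\<Sum>m\<in>{1..N}. (\<Sum>n\<in>{1..N}. M m n * x n) * x m) - (\<Sum>m\<in>{1..N}. (\<Sum>n\<in>{1..N'}. M m n * x n) * x m)
          = - (\<Sum>m\<in>{1..N}. \<Sum>n\<in>{N<..N'}. M m n * x m * x n)"
        unfolding split distrib_right sum.distrib unfolding sum_distrib_right by (simp add: mult_ac)
      hence "norm ((\<Sum>m\<in>{1..N}. (\<Sum>n\<in>{1..N}. M m n * x n) * x m) - (\<Sum>m\<in>{1..N}. (\<Sum>n\<in>{1..N'}. M m n * x n) * x m))
         \<le> C * (sqrt (\<Sum>n\<in>{N<..N'}. (norm (x n))\<^sup>2) * sqrt (\<Sum>m\<in>{1..N}. (norm (x m))\<^sup>2))"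
        using bounded_finite_sets[of "{1..N}" "{N<..N'}" x x] by (simp add: subset_eq)
      also have "\<dots> \<le> C * (sqrt (1 - X N) * 1)"
      proof (intro mult_left_mono mult_mono C)
        have "X N + (\<Sum>n\<in>{N<..N'}. (norm (x n))\<^sup>2) \<le> 1"
          using x_le[of "{1..N'}"] unfolding X_def split by auto
        thus "sqrt (\<Sum>n\<in>{N<..N'}. (norm (x n))\<^sup>2) \<le> sqrt (1 - X N)" by simp
        show "sqrt (\<Sum>m\<in>{1..N}. (norm (x m))\<^sup>2) \<le> 1" using x_le[of "{1..N}"] by auto
        show "0 \<le> sqrt (1 - X N)" using x_le[of "{1..N}"] by (auto simp: X_def)
      qed (simp add: sum_nonneg)
      finally show ?thesis by simp
    qed
    thus "\<exists>N0. \<forall>N'\<ge>N0. norm ((\<Sum>m\<in>{1..N}. (\<Sum>n\<in>{1..N}. M m n * x n) * x m) - (\<Sum>m\<in>{1..N}. (\<Sum>n\<in>{1..N'}. M m n * x n) * x m)) \<le> C * sqrt (1 - X N)"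
      by blast
  qed
  have "(\<lambda>N. C * sqrt (1 - X N)) \<longlonglongrightarrow> C * sqrt (1 - 1)" by (intro tendsto_intros Xlim)
  hence z: "(\<lambda>N. C * sqrt (1 - X N)) \<longlonglongrightarrow> 0" by simp
  have "(\<lambda>N. (\<Sum>m\<in>{1..N}. \<Sum>n\<in>{1..N}. M m n * x m * x n) - (\<Sum>m\<in>{1..N}. v m * x m)) \<longlonglongrightarrow> 0"
    by (rule Lim_null_comparison[OF _ z]) (use diff in auto)
  from tendsto_add[OF this outer] show ?thesis unfolding total by simp
qed

end

lemma disk_L2_power_series:
  assumes sums: "\<And>z. norm z < 1 \<Longrightarrow> (\<lambda>n. a n * z ^ n) sums \<omega> z"
    and S: "(\<lambda>n. pi * (norm (a n))\<^sup>2 / Suc n) sums S"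
  shows "\<omega> \<in> borel_measurable disk_measure" "integrable disk_measure (\<lambda>z. (norm (\<omega> z))\<^sup>2)"
    "(LINT z|disk_measure. (norm (\<omega> z))\<^sup>2) = S"
proof -
  have "\<omega> holomorphic_on ball 0 1"
    by (rule power_series_holomorphic[of _ _ a]) (use sums in auto)
  thus m [measurable]: "\<omega> \<in> borel_measurable disk_measure"
    by (intro measurable_disk_continuous holomorphic_on_imp_continuous_on)
  have S0: "0 \<le> S" by (rule sums_le[OF _ sums_zero S]) auto
  have "(\<integral>\<^sup>+z. ennreal ((norm (\<omega> z))\<^sup>2) \<partial>disk_measure) = (\<Sum>n. ennreal (pi * (norm (a n))\<^sup>2 / Suc n))"
    by (rule nn_integral_disk_parseval[OF sums])
  also have "\<dots> = ennreal S" using S by (intro suminf_ennreal_eq) auto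
  finally have "has_bochner_integral disk_measure (\<lambda>z. (norm (\<omega> z))\<^sup>2) S"
    by (intro has_bochner_integral_nn_integral) (use S0 in auto)
  thus "integrable disk_measure (\<lambda>z. (norm (\<omega> z))\<^sup>2)" "(LINT z|disk_measure. (norm (\<omega> z))\<^sup>2) = S"
    by (auto simp: has_bochner_integral_iff)
qed

definition bergman_coeff :: "(nat \<Rightarrow> complex) \<Rightarrow> nat \<Rightarrow> complex" where
  "bergman_coeff x n = of_real (sqrt (real (Suc n) / pi)) * x (Suc n)"

definition bergman_series :: "(nat \<Rightarrow> complex) \<Rightarrow> complex \<Rightarrow> complex" where
  "bergman_series x z = (\<Sum>n. bergman_coeff x n * z ^ n)"

lemma norm_bergman_coeff: "pi * (norm (bergman_coeff x n))\<^sup>2 / Suc n = (norm (x (Suc n)))\<^sup>2"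
  by (simp add: bergman_coeff_def norm_mult power_mult_distrib del: of_nat_Suc)

lemma l2_sphere_sums: "x \<in> l2_sphere \<longleftrightarrow> (\<lambda>n. (norm (x (Suc n)))\<^sup>2) sums 1"
proof -
  have "x \<in> l2_sphere \<longleftrightarrow> ((\<lambda>n. (norm (x (Suc n)))\<^sup>2) has_sum 1) UNIV"
  proof -
    have "bij_betw Suc UNIV {1..}" by (rule bij_betwI[of _ _ _ "\<lambda>n. n - 1"]) auto
    from has_sum_reindex_bij_betw[OF this, of "\<lambda>n. (norm (x n))\<^sup>2"] show ?thesis
      by (simp add: l2_sphere_def)
  qed
  thus ?thesis using sums_nonneg_imp_has_sum has_sum_imp_sums by fastforce
qed

lemma bergman_series_sums:
  assumes "x \<in> l2_sphere" "norm z < 1"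
  shows "(\<lambda>n. bergman_coeff x n * z ^ n) sums bergman_series x z"
  unfolding bergman_series_def
proof (rule summable_sums, rule summable_comparison_test'[where N = 0])
  show "summable (\<lambda>n. real (Suc n) * norm z ^ n)"
    using geometric_deriv_sums[of "norm z"] assms(2) by (auto simp: sums_iff)
  fix n
  have "summable (\<lambda>n. (norm (x (Suc n)))\<^sup>2)" "(\<Sum>n. (norm (x (Suc n)))\<^sup>2) = 1"
    using assms(1) by (auto simp: l2_sphere_sums sums_iff)
  hence "(norm (x (Suc n)))\<^sup>2 \<le> 1\<^sup>2" using sum_le_suminf[of "\<lambda>n. (norm (x (Suc n)))\<^sup>2" "{n}"] by simp
  hence x1: "norm (x (Suc n)) \<le> 1" by (rule power2_le_imp_le) simp
  have "sqrt (real (Suc n) / pi) \<le> sqrt (real (Suc n) * real (Suc n))"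
  proof (rule real_sqrt_le_mono)
    have "real (Suc n) / pi \<le> real (Suc n) / 1" using pi_gt3 by (intro divide_left_mono) auto
    also have "\<dots> \<le> real (Suc n) * real (Suc n)" by simp
    finally show "real (Suc n) / pi \<le> real (Suc n) * real (Suc n)" .
  qed
  hence "norm (bergman_coeff x n) \<le> real (Suc n) * 1"
    unfolding bergman_coeff_def norm_mult using x1 by (intro mult_mono) auto
  thus "norm (bergman_coeff x n * z ^ n) \<le> real (Suc n) * norm z ^ n"
    unfolding norm_mult norm_power by (intro mult_right_mono) auto
qed

lemma bergman_series_norm:
  assumes "x \<in> l2_sphere"
  shows "bergman_series x \<in> borel_measurable disk_measure"
    "integrable disk_measure (\<lambda>z. (norm (bergman_series x z))\<^sup>2)"
    "(LINT z|disk_measure. (norm (bergman_series x z))\<^sup>2) = 1"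
  using disk_L2_power_series[of "bergman_coeff x" "bergman_series x" 1, OF bergman_series_sums[OF assms]] assms
  unfolding norm_bergman_coeff l2_sphere_sums by auto

lemma bergman_sum_eq: "bergman_sum N x z = (\<Sum>n<N. bergman_coeff x n * z ^ n)"
  unfolding bergman_sum_def bergman_coeff_def
  by (rule sum.reindex_bij_witness[of _ Suc "\<lambda>n. n - 1"]) auto

lemma sums_initial_segment:
  fixes g :: "nat \<Rightarrow> 'b::real_normed_vector"
  shows "(\<lambda>n. if n < N then g n else 0) sums (\<Sum>n<N. g n)"
  using sums_If_finite_set[of "{..<N}" g] by simp

text \<open>The integrals differ by that of \<open>\<nu> (\<omega> - s) (\<omega> + s)\<close>, with \<open>s\<close> the partial sum of \<open>\<omega>\<close>.  By Parseval's identity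
\<open>\<omega> - s\<close> tends to 0 in the \<open>L\<^sup>2\<close> norm and \<open>\<omega> + s\<close> stays bounded by 2.\<close>

lemma pairing_limit:
  fixes \<nu> :: "complex \<Rightarrow> complex"
  assumes x: "x \<in> l2_sphere" and \<nu>: "\<nu> \<in> borel_measurable disk_measure"
    and bd: "\<And>z. norm z < 1 \<Longrightarrow> norm (\<nu> z) \<le> k"
  shows "(\<lambda>N. LINT z|disk_measure. \<nu> z * bergman_sum N x z * bergman_sum N x z)
    \<longlonglongrightarrow> (LINT z|disk_measure. \<nu> z * (bergman_series x z)\<^sup>2)"
proof -
  define \<omega> where "\<omega> = bergman_series x"
  define e where "e = (\<lambda>n. (norm (x (Suc n)))\<^sup>2)"
  have e_eq: "pi * (norm (bergman_coeff x n))\<^sup>2 / Suc n = e n" for n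
    unfolding e_def by (rule norm_bergman_coeff)
  have e_eq4: "pi * (4 * (norm (bergman_coeff x n))\<^sup>2) / Suc n = 4 * e n" for n
    unfolding e_eq[symmetric] by simp
  have e: "e sums 1" using x by (simp add: l2_sphere_sums e_def)
  define X where "X = (\<lambda>N. \<Sum>n<N. e n)"
  have X: "X \<longlonglongrightarrow> 1" using e by (simp add: sums_def X_def)
  have k0: "0 \<le> k" using bd[of 0] norm_ge_zero[of "\<nu> 0"] by (simp del: norm_ge_zero)
  have dsum: "(\<lambda>n. (if n < N then 0 else bergman_coeff x n) * z ^ n) sums (\<omega> z - bergman_sum N x z)" if "norm z < 1" for z N
    using sums_diff[OF bergman_series_sums[OF x that] sums_initial_segment[where N = N and g = "\<lambda>n. bergman_coeff x n * z ^ n"]]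
    unfolding \<omega>_def bergman_sum_eq by (rule back_subst[of "\<lambda>f. f sums _"]) auto
  have ssum: "(\<lambda>n. (if n < N then 2 * bergman_coeff x n else bergman_coeff x n) * z ^ n) sums (\<omega> z + bergman_sum N x z)" if "norm z < 1" for z N
    using sums_add[OF bergman_series_sums[OF x that] sums_initial_segment[where N = N and g = "\<lambda>n. bergman_coeff x n * z ^ n"]]
    unfolding \<omega>_def bergman_sum_eq by (rule back_subst[of "\<lambda>f. f sums _"]) auto
  have d2: "(\<lambda>n. pi * (norm (if n < N then 0 else bergman_coeff x n))\<^sup>2 / Suc n) sums (1 - X N)" for N
    using sums_diff[OF e sums_initial_segment[where N = N and g = e]]
    unfolding X_def by (rule back_subst[of "\<lambda>f. f sums _"])
      (intro ext, simp add: e_eq del: of_nat_Suc)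
  have s2: "(\<lambda>n. pi * (norm (if n < N then 2 * bergman_coeff x n else bergman_coeff x n))\<^sup>2 / Suc n) sums (1 + 3 * X N)" for N
    using sums_add[OF e sums_mult[OF sums_initial_segment[where N = N and g = e], of 3]]
    unfolding X_def by (rule back_subst[of "\<lambda>f. f sums _"])
      (intro ext, simp add: e_eq e_eq4 norm_mult power_mult_distrib del: of_nat_Suc)
  have X1: "X N \<le> 1" for N
    using sums_le[OF _ sums_initial_segment[where N = N and g = e] e] by (auto simp: X_def e_def)
  have X0: "0 \<le> X N" for N by (simp add: X_def e_def sum_nonneg)
  note dL = disk_L2_power_series[OF dsum d2] and sL = disk_L2_power_series[OF ssum s2]
  note wL = bergman_series_norm[OF x, folded \<omega>_def]
  have mb: "bergman_sum N x \<in> borel_measurable disk_measure" for N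
    unfolding bergman_sum_def[abs_def] by (intro measurable_disk_continuous continuous_intros)
  have bounded_mult: "(\<lambda>z. \<nu> z * f z) \<in> borel_measurable disk_measure"
      "integrable disk_measure (\<lambda>z. (norm (\<nu> z * f z))\<^sup>2)"
      "(LINT z|disk_measure. (norm (\<nu> z * f z))\<^sup>2) \<le> k\<^sup>2 * (LINT z|disk_measure. (norm (f z))\<^sup>2)"
    if f: "f \<in> borel_measurable disk_measure" "integrable disk_measure (\<lambda>z. (norm (f z))\<^sup>2)" for f
  proof -
    show m: "(\<lambda>z. \<nu> z * f z) \<in> borel_measurable disk_measure" using \<nu> f(1) by (rule borel_measurable_times)
    have le: "(norm (\<nu> z * f z))\<^sup>2 \<le> k\<^sup>2 * (norm (f z))\<^sup>2" if "z \<in> space disk_measure" for z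
      unfolding norm_mult power_mult_distrib
      by (intro mult_right_mono power_mono bd) (use that in auto)
    show i: "integrable disk_measure (\<lambda>z. (norm (\<nu> z * f z))\<^sup>2)"
      by (rule Bochner_Integration.integrable_bound[OF integrable_mult_right[OF f(2), of "k\<^sup>2"]])
         (use m le in \<open>auto intro!: AE_I2\<close>)
    have "(LINT z|disk_measure. (norm (\<nu> z * f z))\<^sup>2) \<le> (LINT z|disk_measure. k\<^sup>2 * (norm (f z))\<^sup>2)"
      by (rule integral_mono[OF i integrable_mult_right[OF f(2)] le])
    thus "(LINT z|disk_measure. (norm (\<nu> z * f z))\<^sup>2) \<le> k\<^sup>2 * (LINT z|disk_measure. (norm (f z))\<^sup>2)" by simp
  qed
  have est: "norm ((LINT z|disk_measure. \<nu> z * (\<omega> z)\<^sup>2) - (LINT z|disk_measure. \<nu> z * bergman_sum N x z * bergman_sum N x z))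
      \<le> k * sqrt (1 - X N) * 2" for N
  proof -
    have bs2: "integrable disk_measure (\<lambda>z. (norm (bergman_sum N x z))\<^sup>2)"
      unfolding bergman_sum_def by (intro integrable_disk_continuous continuous_intros)
    have i1: "integrable disk_measure (\<lambda>z. (\<nu> z * \<omega> z) * \<omega> z)"
      by (rule integral_Cauchy_Schwarz(1)) (use bounded_mult wL in auto)
    have i2: "integrable disk_measure (\<lambda>z. (\<nu> z * bergman_sum N x z) * bergman_sum N x z)"
      by (rule integral_Cauchy_Schwarz(1)) (use bounded_mult bs2 mb in auto)
    have "(LINT z|disk_measure. \<nu> z * (\<omega> z)\<^sup>2) - (LINT z|disk_measure. \<nu> z * bergman_sum N x z * bergman_sum N x z)
       = (LINT z|disk_measure. (\<nu> z * \<omega> z) * \<omega> z - (\<nu> z * bergman_sum N x z) * bergman_sum N x z)"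
      using Bochner_Integration.integral_diff[OF i1 i2] by (simp add: power2_eq_square mult.assoc)
    also have "\<dots> = (LINT z|disk_measure. (\<nu> z * (\<omega> z - bergman_sum N x z)) * (\<omega> z + bergman_sum N x z))"
      by (intro Bochner_Integration.integral_cong) (auto simp: algebra_simps)
    finally have "norm ((LINT z|disk_measure. \<nu> z * (\<omega> z)\<^sup>2) - (LINT z|disk_measure. \<nu> z * bergman_sum N x z * bergman_sum N x z))
       \<le> sqrt (LINT z|disk_measure. (norm (\<nu> z * (\<omega> z - bergman_sum N x z)))\<^sup>2) * sqrt (LINT z|disk_measure. (norm (\<omega> z + bergman_sum N x z))\<^sup>2)"
      by (simp only:) (rule integral_Cauchy_Schwarz(2); use bounded_mult dL sL in auto)
    also have "\<dots> \<le> sqrt (k\<^sup>2 * (1 - X N)) * sqrt (1 + 3 * X N)"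
      using bounded_mult(3)[OF dL(1,2)[of N]] dL(3)[of N] sL(3)[of N] X0[of N] X1[of N]
      by (intro mult_mono) auto
    also have "\<dots> \<le> (k * sqrt (1 - X N)) * sqrt (2\<^sup>2)"
    proof (rule mult_mono)
      show "sqrt (k\<^sup>2 * (1 - X N)) \<le> k * sqrt (1 - X N)" using k0 by (simp add: real_sqrt_mult)
      show "sqrt (1 + 3 * X N) \<le> sqrt (2\<^sup>2)"
        by (rule real_sqrt_le_mono) (use X1[of N] in simp)
    qed (use k0 X0[of N] X1[of N] in auto)
    finally show ?thesis by simp
  qed
  have "(\<lambda>N. k * sqrt (1 - X N) * 2) \<longlonglongrightarrow> k * sqrt (1 - 1) * 2" by (intro tendsto_intros X)
  hence z: "(\<lambda>N. k * sqrt (1 - X N) * 2) \<longlonglongrightarrow> 0" by simp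
  have "(\<lambda>N. (LINT z|disk_measure. \<nu> z * (\<omega> z)\<^sup>2) - (LINT z|disk_measure. \<nu> z * bergman_sum N x z * bergman_sum N x z)) \<longlonglongrightarrow> 0"
    by (rule Lim_null_comparison[OF _ z]) (use est in auto)
  from tendsto_diff[OF tendsto_const[of "LINT z|disk_measure. \<nu> z * (\<omega> z)\<^sup>2"] this]
  show ?thesis unfolding \<omega>_def by simp
qed

lemma A1_norm_power2: "A1_norm (\<lambda>z. (\<omega> z)\<^sup>2) = (LINT z|disk_measure. (norm (\<omega> z))\<^sup>2)"
  unfolding A1_norm_def LINT_disk_measure by (simp add: norm_power)

lemma bergman_series_in_A1_sq:
  assumes x: "x \<in> l2_sphere"
  shows "(\<lambda>z. (bergman_series x z)\<^sup>2) \<in> A1_sq" "A1_norm (\<lambda>z. (bergman_series x z)\<^sup>2) = 1"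
proof -
  have hol: "bergman_series x holomorphic_on unit_disk"
    by (rule power_series_holomorphic[of _ _ "bergman_coeff x"]) (use bergman_series_sums[OF x] in auto)
  have m: "(\<lambda>z. (bergman_series x z)\<^sup>2) \<in> borel_measurable disk_measure"
    using bergman_series_norm(1)[OF x] by measurable
  have i: "integrable disk_measure (\<lambda>z. norm ((bergman_series x z)\<^sup>2))"
    using bergman_series_norm(2)[OF x] by (simp add: norm_power)
  have "integrable disk_measure (\<lambda>z. (bergman_series x z)\<^sup>2)"
    by (rule integrable_norm_cancel[OF i m])
  thus "(\<lambda>z. (bergman_series x z)\<^sup>2) \<in> A1_sq"
    using hol unfolding A1_sq_def A1_def integrable_disk_measure by (auto intro!: holomorphic_intros)
  show "A1_norm (\<lambda>z. (bergman_series x z)\<^sup>2) = 1"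
    unfolding A1_norm_power2 by (rule bergman_series_norm(3)[OF x])
qed

text \<open>For \<open>\<psi> = \<omega>\<^sup>2\<close> the \<open>L\<^sup>1\<close> norm of \<open>\<psi>\<close> is the square of the \<open>L\<^sup>2\<close> norm of \<open>\<omega>\<close>, and Parseval's identity turns the latter
into the \<open>l\<^sup>2\<close> norm of the coefficients of \<open>\<omega>\<close> in the orthonormal basis.\<close>

lemma A1_sq_imp_bergman_series:
  assumes \<psi>: "\<psi> \<in> A1_sq" and norm1: "A1_norm \<psi> = 1"
  obtains x where "x \<in> l2_sphere" "\<And>z. norm z < 1 \<Longrightarrow> \<psi> z = (bergman_series x z)\<^sup>2"
proof -
  obtain \<omega> where \<omega>: "\<omega> holomorphic_on unit_disk" "\<And>z. norm z < 1 \<Longrightarrow> \<psi> z = (\<omega> z)\<^sup>2"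
    and int: "integrable disk_measure \<psi>"
    using \<psi> unfolding A1_sq_def A1_def integrable_disk_measure by auto
  define a where "a = fps_nth (fps_expansion \<omega> 0)"
  have a: "(\<lambda>n. a n * z ^ n) sums \<omega> z" if "norm z < 1" for z
    unfolding a_def by (rule holomorphic_sums_fps_expansion[OF \<omega>(1) that])
  define x where "x = (\<lambda>n. a (n - 1) / of_real (sqrt (real n / pi)))"
  have xa: "bergman_coeff x = a"
    by (auto simp: bergman_coeff_def x_def fun_eq_iff simp del: of_nat_Suc)
  have "(\<integral>\<^sup>+z. ennreal ((norm (\<omega> z))\<^sup>2) \<partial>disk_measure) = (\<integral>\<^sup>+z. ennreal (norm (\<psi> z)) \<partial>disk_measure)"
    by (intro nn_integral_cong) (auto simp: \<omega>(2) norm_power)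
  also have "\<dots> = ennreal (LINT z|disk_measure. norm (\<psi> z))"
    by (rule nn_integral_eq_integral) (use int in auto)
  also have "\<dots> = 1" using norm1 by (simp add: A1_norm_def LINT_disk_measure)
  finally have "(\<Sum>n. ennreal ((norm (x (Suc n)))\<^sup>2)) = 1"
    using nn_integral_disk_parseval[of a \<omega>, OF a] by (simp only: xa[symmetric] norm_bergman_coeff)
  hence s: "(\<Sum>n. ennreal ((norm (x (Suc n)))\<^sup>2)) = ennreal 1" by simp
  have summ: "summable (\<lambda>n. (norm (x (Suc n)))\<^sup>2)"
    by (rule summable_suminf_not_top) (use s in auto)
  have "ennreal (\<Sum>n. (norm (x (Suc n)))\<^sup>2) = ennreal 1"
    using suminf_ennreal2[OF _ summ] s by simp
  hence "(\<Sum>n. (norm (x (Suc n)))\<^sup>2) = 1"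
    by (subst (asm) ennreal_inj) (auto intro: suminf_nonneg summ)
  hence x: "x \<in> l2_sphere" using summ by (simp add: l2_sphere_sums sums_iff)
  have "bergman_series x z = \<omega> z" if "norm z < 1" for z
    using a[OF that] by (simp add: bergman_series_def xa sums_iff)
  thus ?thesis using that[OF x] \<omega>(2) by simp
qed

lemma l2_sphere_nonempty: "l2_sphere \<noteq> {}"
proof -
  have "(\<lambda>n. (norm (if Suc n = 1 then 1 else 0 :: complex))\<^sup>2) = (\<lambda>n. if n = 0 then 1 else 0)" by auto
  moreover have "(\<lambda>n. if n = 0 then 1 else 0 :: real) sums 1" using sums_single[of 0 "\<lambda>_. 1 :: real"] by simp
  ultimately have "(\<lambda>n. if n = 1 then 1 else 0 :: complex) \<in> l2_sphere"
    unfolding l2_sphere_sums by (simp only:)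
  thus ?thesis by blast
qed

context small_univalent
begin

definition "grunsky_form x = (\<Sum>\<^sub>\<infinity>m\<in>{1..}. \<Sum>\<^sub>\<infinity>n\<in>{1..}. of_real (sqrt (real m * real n)) * \<alpha> m n * x m * x n)"

lemma grunsky_form_estimate:
  assumes x: "x \<in> l2_sphere"
  shows "norm (grunsky_form x + (LINT z|disk_measure. nu z * (bergman_series x z)\<^sup>2)) \<le> 2 * k\<^sup>2"
proof -
  define M where "M = (\<lambda>m n. of_real (sqrt (real m * real n)) * \<alpha> m n)"
  interpret M: bounded_bilinear_form M "2 * k"
  proof
    show "0 \<le> 2 * k" using k_nonneg by simp
    show "norm (\<Sum>m\<in>{1..N}. \<Sum>n\<in>{1..N}. M m n * y m * x n)
      \<le> 2 * k * (sqrt (\<Sum>n\<in>{1..N}. (norm (x n))\<^sup>2) * sqrt (\<Sum>n\<in>{1..N}. (norm (y n))\<^sup>2))" for N x y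
      unfolding M_def by (rule finite_estimate(1))
  qed
  have Q: "(\<lambda>N. \<Sum>m\<in>{1..N}. \<Sum>n\<in>{1..N}. M m n * x m * x n) \<longlonglongrightarrow> grunsky_form x"
    using M.quadratic_form_limit[OF x] by (simp add: grunsky_form_def M_def)
  have I: "(\<lambda>N. LINT z|disk_measure. nu z * bergman_sum N x z * bergman_sum N x z)
      \<longlonglongrightarrow> (LINT z|disk_measure. nu z * (bergman_series x z)\<^sup>2)"
    by (rule pairing_limit[OF x measurable_disk_continuous[OF continuous_on_nu]]) (rule nu_bound)
  show ?thesis
  proof (rule LIMSEQ_le_const2[OF tendsto_norm[OF tendsto_add[OF Q I]]], intro exI[of _ 0] allI impI)
    fix N
    define X where "X = (\<Sum>n\<in>{1..N}. (norm (x n))\<^sup>2)"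
    have "((\<lambda>n. (norm (x n))\<^sup>2) has_sum 1) {1..}" using x by (simp add: l2_sphere_def)
    from finite_sum_le_has_sum[OF this] have "X \<le> 1" unfolding X_def by auto
    have "norm ((\<Sum>m\<in>{1..N}. \<Sum>n\<in>{1..N}. M m n * x m * x n) + (LINT z|disk_measure. nu z * bergman_sum N x z * bergman_sum N x z))
        \<le> 2 * k\<^sup>2 * (sqrt X * sqrt X)"
      unfolding M_def X_def by (rule finite_estimate(2))
    also have "\<dots> \<le> 2 * k\<^sup>2 * 1"
      using \<open>X \<le> 1\<close> by (intro mult_left_mono) (auto simp: X_def sum_nonneg)
    finally show "norm ((\<Sum>m\<in>{1..N}. \<Sum>n\<in>{1..N}. M m n * x m * x n) + (LINT z|disk_measure. nu z * bergman_sum N x z * bergman_sum N x z)) \<le> 2 * k\<^sup>2"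
      by simp
  qed
qed

lemma nu_pairing_le:
  assumes "\<psi> \<in> A1" "A1_norm \<psi> = 1"
  shows "norm (LINT z|disk_measure. nu z * \<psi> z) \<le> k"
proof -
  have int: "integrable disk_measure \<psi>" using assms(1) by (simp add: A1_def integrable_disk_measure)
  have nu: "nu \<in> borel_measurable disk_measure" by (rule measurable_disk_continuous[OF continuous_on_nu])
  have le: "norm (nu z * \<psi> z) \<le> k * norm (\<psi> z)" if "z \<in> space disk_measure" for z
    unfolding norm_mult using that by (intro mult_right_mono nu_bound) auto
  have i: "integrable disk_measure (\<lambda>z. nu z * \<psi> z)"
    by (rule Bochner_Integration.integrable_bound[OF integrable_mult_right[OF integrable_norm[OF int], of k]])
       (use nu int k_nonneg le in \<open>auto intro!: AE_I2 borel_measurable_times borel_measurable_integrable simp: abs_mult\<close>)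
  have "norm (LINT z|disk_measure. nu z * \<psi> z) \<le> (LINT z|disk_measure. norm (nu z * \<psi> z))"
    by (rule Bochner_Integration.integral_norm_bound)
  also have "\<dots> \<le> (LINT z|disk_measure. k * norm (\<psi> z))"
    by (rule integral_mono[OF integrable_norm[OF i] integrable_mult_right[OF integrable_norm[OF int]] le])
  also have "\<dots> = k" using assms(2) by (simp add: A1_norm_def LINT_disk_measure)
  finally show ?thesis .
qed

text \<open>The two suprema run over families that correspond under \<open>x \<mapsto> (bergman_series x)\<^sup>2\<close>, and corresponding values are
close by \<open>grunsky_form_estimate\<close>.\<close>

lemma sup_estimate:
  shows "\<bar>(SUP x\<in>l2_sphere. norm (grunsky_form x))
    - (SUP \<psi>\<in>{\<psi>\<in>A1_sq. A1_norm \<psi> = 1}. norm (LINT z|disk_measure. nu z * \<psi> z))\<bar> \<le> 2 * k\<^sup>2"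
proof -
  let ?P = "\<lambda>\<psi>. norm (LINT z|disk_measure. nu z * \<psi> z)"
  let ?A = "{\<psi>\<in>A1_sq. A1_norm \<psi> = 1}"
  have close: "\<bar>norm (grunsky_form x) - ?P (\<lambda>z. (bergman_series x z)\<^sup>2)\<bar> \<le> 2 * k\<^sup>2" if "x \<in> l2_sphere" for x
    using grunsky_form_estimate[OF that] norm_triangle_ineq3[of "grunsky_form x" "- (LINT z|disk_measure. nu z * (bergman_series x z)\<^sup>2)"]
    by simp
  have mem: "(\<lambda>z. (bergman_series x z)\<^sup>2) \<in> ?A" if "x \<in> l2_sphere" for x
    using bergman_series_in_A1_sq[OF that] by simp
  have Pk: "?P \<psi> \<le> k" if "\<psi> \<in> ?A" for \<psi>
    using nu_pairing_le that by (auto simp: A1_sq_def)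
  have bP: "bdd_above (?P ` ?A)" using Pk by (auto intro!: bdd_aboveI2)
  have bF: "bdd_above ((\<lambda>x. norm (grunsky_form x)) ` l2_sphere)"
  proof (rule bdd_aboveI2)
    fix x assume "x \<in> l2_sphere"
    thus "norm (grunsky_form x) \<le> k + 2 * k\<^sup>2" using close[of x] Pk[OF mem[of x]] by simp
  qed
  have ne: "l2_sphere \<noteq> {}" "?A \<noteq> {}" using l2_sphere_nonempty mem by blast+
  have "(SUP x\<in>l2_sphere. norm (grunsky_form x)) \<le> (SUP \<psi>\<in>?A. ?P \<psi>) + 2 * k\<^sup>2"
  proof (rule cSUP_least[OF ne(1)])
    fix x assume x: "x \<in> l2_sphere"
    have "?P (\<lambda>z. (bergman_series x z)\<^sup>2) \<le> (SUP \<psi>\<in>?A. ?P \<psi>)" by (rule cSUP_upper[OF mem[OF x] bP])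
    thus "norm (grunsky_form x) \<le> (SUP \<psi>\<in>?A. ?P \<psi>) + 2 * k\<^sup>2" using close[OF x] by simp
  qed
  moreover have "(SUP \<psi>\<in>?A. ?P \<psi>) \<le> (SUP x\<in>l2_sphere. norm (grunsky_form x)) + 2 * k\<^sup>2"
  proof (rule cSUP_least[OF ne(2)])
    fix \<psi> assume "\<psi> \<in> ?A"
    then obtain x where x: "x \<in> l2_sphere" "\<And>z. norm z < 1 \<Longrightarrow> \<psi> z = (bergman_series x z)\<^sup>2"
      using A1_sq_imp_bergman_series by blast
    have "(LINT z|disk_measure. nu z * \<psi> z) = (LINT z|disk_measure. nu z * (bergman_series x z)\<^sup>2)"
      by (intro Bochner_Integration.integral_cong) (auto simp: x(2))
    moreover have "norm (grunsky_form x) \<le> (SUP x\<in>l2_sphere. norm (grunsky_form x))" by (rule cSUP_upper[OF x(1) bF])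
    ultimately show "?P \<psi> \<le> (SUP x\<in>l2_sphere. norm (grunsky_form x)) + 2 * k\<^sup>2" using close[OF x(1)] by simp
  qed
  ultimately show ?thesis by linarith
qed

end

section \<open>The class Sigma and the asymptotic formula\<close>

definition inverted :: "(complex \<Rightarrow> complex) \<Rightarrow> complex \<Rightarrow> complex" where
  "inverted f t = (if t = 0 then 1 else t * f (1 / t))"

lemma ext_disk_open: "open ext_disk"
proof -
  have "ext_disk = - cball 0 1" by (auto simp: ext_disk_def)
  thus ?thesis using open_Compl[OF closed_cball] by metis
qed

lemma inverted_eq: "1 < norm z \<Longrightarrow> f z = z * inverted f (1 / z)"
  by (auto simp: inverted_def)

lemma inverted_holomorphic:
  assumes f: "f \<in> Sigma_class"
  shows "inverted f holomorphic_on ball 0 1"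
proof -
  have holf: "f holomorphic_on ext_disk" using f by (simp add: Sigma_class_def)
  obtain b :: "nat \<Rightarrow> complex" and R where b: "\<And>z. R < norm z \<Longrightarrow> (\<lambda>n. b n / z ^ n) sums (f z - z)"
    using f unfolding Sigma_class_def by blast
  define r where "r = 1 / (\<bar>R\<bar> + 1)"
  have r: "0 < r" "r \<le> 1" by (auto simp: r_def)
  define g where "g = (\<lambda>t. \<Sum>n. b n * t ^ n)"
  have g: "(\<lambda>n. b n * t ^ n) sums g t" "t \<noteq> 0 \<longrightarrow> g t = f (1 / t) - 1 / t" if t: "norm t < r" for t
  proof -
    have "(\<lambda>n. b n * t ^ n) sums g t \<and> (t \<noteq> 0 \<longrightarrow> g t = f (1 / t) - 1 / t)"
    proof (cases "t = 0")
      case True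
      thus ?thesis using powser_sums_zero[of b] by (simp add: g_def sums_iff)
    next
      case False
      have "R < norm (1 / t)"
        using t False by (simp add: r_def norm_divide field_simps) (smt (verit, best) mult_right_mono norm_ge_zero)
      from b[OF this] have "(\<lambda>n. b n * t ^ n) sums (f (1 / t) - 1 / t)"
        by (simp add: power_divide)
      thus ?thesis by (simp add: g_def sums_iff)
    qed
    thus "(\<lambda>n. b n * t ^ n) sums g t" "t \<noteq> 0 \<longrightarrow> g t = f (1 / t) - 1 / t" by auto
  qed
  have "g holomorphic_on ball 0 r"
    by (rule power_series_holomorphic[of _ _ b]) (use g in auto)
  hence "(\<lambda>t. 1 + t * g t) holomorphic_on ball 0 r" by (intro holomorphic_intros)
  hence 1: "inverted f holomorphic_on ball 0 r"
  proof (rule holomorphic_transform)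
    fix t :: complex assume "t \<in> ball 0 r"
    thus "1 + t * g t = inverted f t" using g(2)[of t] by (simp add: inverted_def right_diff_distrib)
  qed
  have "(\<lambda>t. t * f (1 / t)) holomorphic_on (ball 0 1 - {0})"
    by (intro holomorphic_intros holomorphic_on_compose_gen[OF _ holf, unfolded o_def])
       (auto simp: ext_disk_def norm_divide)
  hence 2: "inverted f holomorphic_on (ball 0 1 - {0})"
    by (rule holomorphic_transform) (auto simp: inverted_def)
  have "inverted f holomorphic_on (ball 0 r \<union> (ball 0 1 - {0}))"
    by (rule holomorphic_on_Un[OF 1 2]) auto
  moreover have "ball 0 r \<union> (ball 0 1 - {0}) = ball (0 :: complex) 1" using r by auto
  ultimately show ?thesis by simp
qed

lemma norm_reciprocal:
  fixes z :: complex
  shows "1 < norm z \<Longrightarrow> norm (1 / z) < 1" "norm z < 1 \<Longrightarrow> z \<noteq> 0 \<Longrightarrow> 1 < norm (1 / z)"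
  by (auto simp: norm_divide divide_less_eq less_divide_eq)

lemma DERIV_at_inverse:
  assumes "g holomorphic_on ball 0 1" "1 < norm z"
  shows "((\<lambda>z. g (1 / z)) has_field_derivative - deriv g (1 / z) / z\<^sup>2) (at z)"
proof -
  have nz: "z \<noteq> 0" using assms(2) by auto
  have "norm (1 / z) < 1" by (rule norm_reciprocal(1)[OF assms(2)])
  hence "(g has_field_derivative deriv g (1 / z)) (at (1 / z))"
    using holomorphic_derivI[OF assms(1)] by simp
  moreover have "((\<lambda>z. 1 / z) has_field_derivative - (1 / z\<^sup>2)) (at z)"
    using nz by (auto intro!: derivative_eq_intros simp: power2_eq_square)
  ultimately have "((\<lambda>z. g (1 / z)) has_field_derivative deriv g (1 / z) * - (1 / z\<^sup>2)) (at z)"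
    by (rule DERIV_chain2)
  thus ?thesis by simp
qed

lemma deriv_eq_on_ext_disk:
  fixes f g :: "complex \<Rightarrow> complex"
  assumes "\<And>z. 1 < norm z \<Longrightarrow> f z = g z" "(g has_field_derivative D) (at z)" "1 < norm z"
  shows "deriv f z = D"
proof -
  have "deriv f z = deriv g z"
    by (rule deriv_cong_ev[OF eventually_mono[OF eventually_nhds_in_open[OF ext_disk_open]] refl])
       (use assms in \<open>auto simp: ext_disk_def\<close>)
  thus ?thesis using assms(2) by (simp add: DERIV_imp_deriv)
qed

lemma schwarzian_inverted:
  fixes f B
  assumes f: "\<And>z. 1 < norm z \<Longrightarrow> f z = z * B (1 / z)"
    and B: "B holomorphic_on ball 0 1"
    and z: "1 < norm z"
  shows "deriv f z = ext_deriv B (1 / z)"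
    and "(\<And>t. norm t < 1 \<Longrightarrow> ext_deriv B t \<noteq> 0) \<Longrightarrow> schwarzian f z = ext_schwarz B (1 / z) / z ^ 4"
proof -
  have d1: "deriv f w = ext_deriv B (1 / w)" if w: "1 < norm w" for w
  proof (rule deriv_eq_on_ext_disk[OF f _ w])
    have "((\<lambda>w. w * B (1 / w)) has_field_derivative (1 * B (1 / w) + - deriv B (1 / w) / w\<^sup>2 * w)) (at w)"
      by (rule DERIV_mult[OF DERIV_ident DERIV_at_inverse[OF B w]])
    moreover have "1 * B (1 / w) + - deriv B (1 / w) / w\<^sup>2 * w = ext_deriv B (1 / w)"
      using w by (auto simp: ext_deriv_def power2_eq_square)
    ultimately show "((\<lambda>w. w * B (1 / w)) has_field_derivative ext_deriv B (1 / w)) (at w)" by simp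
  qed
  show "deriv f z = ext_deriv B (1 / z)" by (rule d1[OF z])
  assume nz: "\<And>t. norm t < 1 \<Longrightarrow> ext_deriv B t \<noteq> 0"
  have nz_ball: "\<forall>t\<in>ball 0 1. ext_deriv B t \<noteq> 0" using nz by simp
  note hA = ext_holomorphic(3)[OF B nz_ball] and ha = ext_holomorphic(4)[OF B nz_ball]
  have d2: "deriv (deriv f) w = - deriv (ext_deriv B) (1 / w) / w\<^sup>2" if w: "1 < norm w" for w
    by (rule deriv_eq_on_ext_disk[OF d1 DERIV_at_inverse[OF hA w] w])
  have q: "deriv (deriv f) w / deriv f w = - (ext_preschwarz B (1 / w) / w\<^sup>2)" if w: "1 < norm w" for w
    unfolding d1[OF w] d2[OF w] ext_preschwarz_def by simp
  define t where "t = 1 / z"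
  have t: "norm t < 1" "t \<noteq> 0" using norm_reciprocal(1)[OF z] z by (auto simp: t_def)
  have dq: "deriv (\<lambda>w. deriv (deriv f) w / deriv f w) z
      = deriv (ext_preschwarz B) t / z ^ 4 + 2 * ext_preschwarz B t / z ^ 3"
  proof (rule deriv_eq_on_ext_disk[OF q _ z])
    have nz': "z \<noteq> 0" using z by auto
    have "((\<lambda>w. ext_preschwarz B (1 / w) / w\<^sup>2) has_field_derivative
        ((- deriv (ext_preschwarz B) (1 / z) / z\<^sup>2) * z\<^sup>2 - ext_preschwarz B (1 / z) * (2 * z)) / (z\<^sup>2 * z\<^sup>2)) (at z)"
      using nz' by (intro DERIV_divide DERIV_at_inverse[OF ha z]) (auto intro!: derivative_eq_intros)
    from DERIV_minus[OF this]
    show "((\<lambda>w. - (ext_preschwarz B (1 / w) / w\<^sup>2)) has_field_derivative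
        deriv (ext_preschwarz B) t / z ^ 4 + 2 * ext_preschwarz B t / z ^ 3) (at z)"
    proof (rule DERIV_cong)
      show "- (((- deriv (ext_preschwarz B) (1 / z) / z\<^sup>2) * z\<^sup>2 - ext_preschwarz B (1 / z) * (2 * z)) / (z\<^sup>2 * z\<^sup>2))
          = deriv (ext_preschwarz B) t / z ^ 4 + 2 * ext_preschwarz B t / z ^ 3"
        using nz' unfolding t_def[symmetric] by (simp add: field_simps eval_nat_numeral)
    qed
  qed
  have a: "ext_preschwarz B t = - t * (deriv (deriv B) t / ext_deriv B t)"
    by (rule ext_preschwarz_eq[OF B t(1)])
  have "2 * ext_preschwarz B t / z ^ 3 = - (2 * deriv (deriv B) t / ext_deriv B t) / z ^ 4"
    unfolding a using z by (auto simp: t_def eval_nat_numeral)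
  thus "schwarzian f z = ext_schwarz B (1 / z) / z ^ 4"
    unfolding schwarzian_def dq q[OF z] t_def[symmetric] ext_schwarz_def
    by (simp add: power_divide power_mult_distrib diff_divide_distrib add_divide_distrib)
qed

text \<open>At \<open>t = 0\<close>, which corresponds to \<open>z = \<infinity>\<close> and is not covered by the supremum in the norm, the bound for the
Schwarzian follows by continuity.\<close>

lemma Sigma_class_small_univalent:
  assumes f: "f \<in> Sigma_class" and small: "bers_norm (schwarzian f) < ennreal 1"
  shows "small_univalent (inverted f) (enn2real (bers_norm (schwarzian f)) / 2)"
proof -
  define B where "B = inverted f"
  define \<beta> where "\<beta> = enn2real (bers_norm (schwarzian f))"
  have holf: "f holomorphic_on ext_disk" and injf: "inj_on f ext_disk" using f by (auto simp: Sigma_class_def)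
  have holB: "B holomorphic_on ball 0 1" unfolding B_def by (rule inverted_holomorphic[OF f])
  have fB: "f z = z * B (1 / z)" if "1 < norm z" for z unfolding B_def by (rule inverted_eq[OF that])
  have ext: "1 / t \<in> ext_disk" if "norm t < 1" "t \<noteq> 0" for t
    using norm_reciprocal(2)[OF that] by (simp add: ext_disk_def)
  have nz: "ext_deriv B t \<noteq> 0" if t: "norm t < 1" for t
  proof (cases "t = 0")
    case True
    thus ?thesis by (simp add: ext_deriv_def B_def inverted_def)
  next
    case False
    have "deriv f (1 / t) \<noteq> 0"
      by (rule holomorphic_injective_imp_regular[OF holf ext_disk_open injf ext[OF t False]])
    thus ?thesis using schwarzian_inverted(1)[OF fB holB, of "1 / t"] ext[OF t False] by (simp add: ext_disk_def)
  qed
  have inj: "t * B s \<noteq> s * B t" if st: "norm s < 1" "norm t < 1" "s \<noteq> t" for s t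
  proof
    assume eq: "t * B s = s * B t"
    consider "s = 0" | "t = 0" | "s \<noteq> 0" "t \<noteq> 0" by blast
    thus False
    proof cases
      case 3
      hence "f (1 / s) = f (1 / t)" using eq by (simp add: B_def inverted_def)
      hence "1 / s = 1 / t" using injf ext 3 st by (meson inj_onD)
      thus False using st 3 by (simp add: field_simps)
    qed (use eq st in \<open>auto simp: B_def inverted_def\<close>)
  qed
  have fin: "bers_norm (schwarzian f) = ennreal \<beta>" and \<beta>1: "\<beta> < 1" and \<beta>0: "0 \<le> \<beta>"
  proof -
    show 1: "bers_norm (schwarzian f) = ennreal \<beta>"
      unfolding \<beta>_def using small by (intro ennreal_enn2real[symmetric]) (auto simp: top_unique intro: order.strict_trans)
    show "0 \<le> \<beta>" by (simp add: \<beta>_def)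
    show "\<beta> < 1" using small unfolding 1 by (simp add: ennreal_less_iff \<open>0 \<le> \<beta>\<close>)
  qed
  have bound': "(1 - (norm t)\<^sup>2)\<^sup>2 * norm (ext_schwarz B t) \<le> \<beta>" if t: "norm t < 1" "t \<noteq> 0" for t
  proof -
    define z where "z = 1 / t"
    have z: "z \<in> ext_disk" using ext[OF t] by (simp add: z_def)
    have "ennreal (((norm z)\<^sup>2 - 1)\<^sup>2 * norm (schwarzian f z)) \<le> bers_norm (schwarzian f)"
      unfolding bers_norm_def by (rule SUP_upper[OF z])
    hence i: "((norm z)\<^sup>2 - 1)\<^sup>2 * norm (schwarzian f z) \<le> \<beta>" unfolding fin using \<beta>0 by simp
    have ii: "schwarzian f z = ext_schwarz B t / z ^ 4"
      using schwarzian_inverted(2)[OF fB holB _ nz, of z] z by (simp add: ext_disk_def z_def)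
    have iii: "((norm z)\<^sup>2 - 1)\<^sup>2 / (norm z) ^ 4 = (1 - (norm t)\<^sup>2)\<^sup>2"
    proof -
      have nt: "norm t \<noteq> 0" using t by simp
      have "((norm z)\<^sup>2 - 1)\<^sup>2 / (norm z) ^ 4 = (((norm z)\<^sup>2 - 1) / (norm z)\<^sup>2)\<^sup>2"
        by (simp add: power_divide power_mult[symmetric])
      also have "((norm z)\<^sup>2 - 1) / (norm z)\<^sup>2 = 1 - (norm t)\<^sup>2"
        using nt by (simp add: z_def norm_divide field_simps)
      finally show ?thesis .
    qed
    show ?thesis using i unfolding ii iii[symmetric] by (simp add: norm_divide norm_power)
  qed
  have hS: "ext_schwarz B holomorphic_on ball 0 1" by (rule ext_holomorphic(6)[OF holB]) (simp add: nz)
  have bound: "(1 - (norm t)\<^sup>2)\<^sup>2 * norm (ext_schwarz B t) \<le> \<beta>" if t: "norm t < 1" for t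
  proof (cases "t = 0")
    case False
    thus ?thesis using bound' t by simp
  next
    case True
    have "isCont (ext_schwarz B) 0"
      using holomorphic_on_imp_continuous_on[OF hS] by (subst (asm) continuous_on_eq_continuous_at) auto
    hence "((\<lambda>t. (1 - (norm t)\<^sup>2)\<^sup>2 * norm (ext_schwarz B t)) \<longlongrightarrow> (1 - (norm (0 :: complex))\<^sup>2)\<^sup>2 * norm (ext_schwarz B 0)) (at 0)"
      by (intro tendsto_intros) (auto simp: isCont_def)
    moreover have "\<forall>\<^sub>F t in at 0. (1 - (norm t)\<^sup>2)\<^sup>2 * norm (ext_schwarz B t) \<le> \<beta>"
      using eventually_at_in_open[of "ball 0 1" "0 :: complex"] by (rule eventually_mono) (use bound' in auto)
    ultimately show ?thesis unfolding True by (intro tendsto_upperbound) auto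
  qed
  show ?thesis
    unfolding B_def[symmetric] \<beta>_def[symmetric]
  proof
    show "B 0 = 1" by (simp add: B_def inverted_def)
    show "\<beta> / 2 \<le> 1 / 2" using \<beta>1 by simp
  qed (use holB inj nz bound in auto)
qed

theorem corollary2p4:
  "\<exists>\<epsilon>>0. \<exists>C::real. \<forall>f\<in>Sigma_class. bers_norm (schwarzian f) < ennreal \<epsilon> \<longrightarrow>
     \<bar>grunsky_norm f -
       (SUP \<psi>\<in>{\<psi>\<in>A1_sq. A1_norm \<psi> = 1}. norm (disk_pairing (harmonic_beltrami (schwarzian f)) \<psi>))\<bar>
     \<le> C * (enn2real (bers_norm (schwarzian f)))\<^sup>2"
proof (rule exI[of _ 1], rule conjI, simp, rule exI[of _ "1 / 2"], intro ballI impI)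
  fix f assume f: "f \<in> Sigma_class" and small: "bers_norm (schwarzian f) < ennreal 1"
  define B where "B = inverted f"
  define k where "k = enn2real (bers_norm (schwarzian f)) / 2"
  interpret small_univalent B k unfolding B_def k_def by (rule Sigma_class_small_univalent[OF f small])
  have fB: "f z = z * B (1 / z)" if "1 < norm z" for z unfolding B_def by (rule inverted_eq[OF that])
  have coeff: "grunsky_coeff f = \<alpha>"
    by (rule grunsky_coeff_eqI[OF grunsky_expansion_\<alpha>[OF fB]]) (auto simp: \<alpha>_0)
  have gn: "grunsky_norm f = (SUP x\<in>l2_sphere. norm (grunsky_form x))"
    unfolding grunsky_norm_def coeff grunsky_form_def ..
  have hb: "harmonic_beltrami (schwarzian f) z = nu z" if z: "norm z < 1" "z \<noteq> 0" for z
  proof -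
    have w: "1 < norm (1 / cnj z)" using norm_reciprocal(2)[of "cnj z"] z by simp
    have "schwarzian f (1 / cnj z) = ext_schwarz B (1 / (1 / cnj z)) / (1 / cnj z) ^ 4"
      by (rule schwarzian_inverted(2)[OF fB holB w nz])
    moreover have "of_real ((1 - (norm z)\<^sup>2)\<^sup>2) = (1 - z * cnj z)\<^sup>2"
      by (simp only: of_real_power one_minus_mult_cnj)
    ultimately show ?thesis
      unfolding harmonic_beltrami_def nu_def using z by (simp add: power_divide)
  qed
  have dp: "disk_pairing (harmonic_beltrami (schwarzian f)) \<psi> = (LINT z|disk_measure. nu z * \<psi> z)"
    if "\<psi> \<in> A1_sq" for \<psi>
  proof -
    have \<psi>m: "\<psi> \<in> borel_measurable disk_measure"
      using that by (auto simp: A1_sq_def A1_def integrable_disk_measure[symmetric] intro: borel_measurable_integrable)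
    have num: "nu \<in> borel_measurable disk_measure" by (rule measurable_disk_continuous[OF continuous_on_nu])
    have null: "AE z in disk_measure. z \<noteq> 0"
      unfolding disk_measure_def by (subst AE_restrict_space_iff) (auto intro: AE_mp[OF AE_lborel_singleton])
    have sing: "{0} \<in> sets disk_measure"
      by (auto simp: disk_measure_def sets_restrict_space image_iff intro!: bexI[of _ "{0}"])
    have "(\<lambda>z. if z \<in> {0} then harmonic_beltrami (schwarzian f) 0 * \<psi> 0 else nu z * \<psi> z) \<in> borel_measurable disk_measure"
      using sing by (intro measurable_If_set borel_measurable_times num \<psi>m) auto
    hence "(\<lambda>z. harmonic_beltrami (schwarzian f) z * \<psi> z) \<in> borel_measurable disk_measure"
      by (rule measurable_cong[THEN iffD1, rotated]) (auto simp: hb)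
    hence "(LINT z|disk_measure. harmonic_beltrami (schwarzian f) z * \<psi> z) = (LINT z|disk_measure. nu z * \<psi> z)"
    proof (rule integral_cong_AE)
      show "(\<lambda>z. nu z * \<psi> z) \<in> borel_measurable disk_measure" by (intro borel_measurable_times num \<psi>m)
      show "AE z in disk_measure. harmonic_beltrami (schwarzian f) z * \<psi> z = nu z * \<psi> z"
        using null AE_space by eventually_elim (auto simp: hb)
    qed
    thus ?thesis by (simp add: disk_pairing_def LINT_disk_measure)
  qed
  have "(SUP \<psi>\<in>{\<psi>\<in>A1_sq. A1_norm \<psi> = 1}. norm (disk_pairing (harmonic_beltrami (schwarzian f)) \<psi>))
      = (SUP \<psi>\<in>{\<psi>\<in>A1_sq. A1_norm \<psi> = 1}. norm (LINT z|disk_measure. nu z * \<psi> z))"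
    by (intro SUP_cong refl) (simp add: dp)
  moreover have "2 * k\<^sup>2 = 1 / 2 * (enn2real (bers_norm (schwarzian f)))\<^sup>2"
    by (simp add: k_def power2_eq_square)
  ultimately show "\<bar>grunsky_norm f -
       (SUP \<psi>\<in>{\<psi>\<in>A1_sq. A1_norm \<psi> = 1}. norm (disk_pairing (harmonic_beltrami (schwarzian f)) \<psi>))\<bar>
     \<le> 1 / 2 * (enn2real (bers_norm (schwarzian f)))\<^sup>2"
    using sup_estimate unfolding gn by simp
qed

end
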